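(* There exists $\varepsilon>0$ such that the following holds. Let $u_0\in\dot H^3(\mathbb{T})$ have zero mean and satisfy $\|u_0\|_{\dot H^3(\mathbb{T})}\le\varepsilon$. Then the Cauchy problem $$u_t+u^2u_\alpha=-\Lambda^{-1}(u)\quad(\alpha\in\mathbb{T},\ t\ge 0),\qquad u(\alpha,0)=u_0(\alpha),$$ has a solution $u$ with $u\in C([0,T],H^3(\mathbb{T}))$ for all $T>0$. Furthermore, there is a constant $C$ such that this solution satisfies $$\|u(t)\|_{L^2}\le C(1+t)^{-1.25}\quad\text{for all } t\ge 0.$$
   Context: $\mathbb{T}=\mathbb{R}/2\pi\mathbb{Z}$, identified with $[-\pi,\pi]$; functions are real-valued. The operator $\Lambda^{-1}$ is $$\Lambda^{-1}(u)(\alpha)=-\frac{1}{2\pi}\int_{-\pi}^{\pi}\log\Big(4\sin^2\Big(\frac{\alpha-\beta}{2}\Big)\Big)u(\beta)\,d\beta,$$ i.e. the Fourier multiplier $1/|n|$ for $n\neq0$ and $0$ for $n=0$. $\dot H^s(\mathbb{T})$ is the homogeneous Sobolev space, with norm $\|\Lambda^s u\|_{L^2}$, $\Lambda=(-\Delta)^{1/2}$. *)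

theory Defs
  imports "HOL-Analysis.Analysis"
begin

text \<open>
  Functions on the circle are represented by \<open>2\<pi>\<close>-periodic functions on the real line; integrals over
  the circle are taken with respect to unnormalised Lebesgue measure on \<open>[-\<pi>, \<pi>]\<close>.
  Elements of the function spaces below are representatives, not almost-everywhere classes.
\<close>

abbreviation circ :: "real measure" where
  "circ \<equiv> lebesgue_on {- pi..pi}"

definition L2 :: "(real \<Rightarrow> real) set" where
  "L2 = {f. (\<forall>x. f (x + 2 * pi) = f x) \<and> f \<in> borel_measurable circ \<and> integrable circ (\<lambda>x. (f x)\<^sup>2)}"

definition L2_norm :: "(real \<Rightarrow> real) \<Rightarrow> real" where
  "L2_norm f = sqrt (\<integral>x. (f x)\<^sup>2 \<partial>circ)"

definition fourier_coeff :: "(real \<Rightarrow> real) \<Rightarrow> int \<Rightarrow> complex" where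
  "fourier_coeff f n = 1 / (2 * pi) * (\<integral>x. complex_of_real (f x) * cis (- (of_int n * x)) \<partial>circ)"

text \<open>
  \<open>is_Lambda_powr s u g\<close> says that \<open>g\<close> is (a representative of) \<open>\<Lambda>\<^sup>s u\<close>, where \<open>\<Lambda> = (-\<Delta>)\<^sup>1\<^sup>/\<^sup>2\<close> is the
  Fourier multiplier \<open>\<bar>n\<bar>\<close>.  As \<open>0 powr s = 0\<close>, the zero mode is annihilated.  Such a \<open>g\<close> is unique
  up to null sets, so the choice in \<open>Lambda_powr\<close> does not affect \<open>L2\<close> norms.
\<close>

definition is_Lambda_powr :: "real \<Rightarrow> (real \<Rightarrow> real) \<Rightarrow> (real \<Rightarrow> real) \<Rightarrow> bool" where
  "is_Lambda_powr s u g \<longleftrightarrow> g \<in> L2 \<and>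
     (\<forall>n. fourier_coeff g n = complex_of_real (\<bar>real_of_int n\<bar> powr s) * fourier_coeff u n)"

definition Lambda_powr :: "real \<Rightarrow> (real \<Rightarrow> real) \<Rightarrow> real \<Rightarrow> real" where
  "Lambda_powr s u = (SOME g. is_Lambda_powr s u g)"

text \<open>
  For \<open>s > 0\<close> the homogeneous and inhomogeneous Sobolev spaces on the circle consist of the same
  functions (up to the treatment of constants) and differ in their norms only.
\<close>

definition sobolev :: "real \<Rightarrow> (real \<Rightarrow> real) set" where
  "sobolev s = {u \<in> L2. \<exists>g. is_Lambda_powr s u g}"

definition Hdot_norm :: "real \<Rightarrow> (real \<Rightarrow> real) \<Rightarrow> real" where
  "Hdot_norm s u = L2_norm (Lambda_powr s u)"

definition H_norm :: "real \<Rightarrow> (real \<Rightarrow> real) \<Rightarrow> real" where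
  "H_norm s u = sqrt ((L2_norm u)\<^sup>2 + (Hdot_norm s u)\<^sup>2)"

definition continuous_into_sobolev :: "real set \<Rightarrow> real \<Rightarrow> (real \<Rightarrow> real \<Rightarrow> real) \<Rightarrow> bool" where
  "continuous_into_sobolev I s u \<longleftrightarrow> (\<forall>t\<in>I. u t \<in> sobolev s) \<and>
     (\<forall>t\<in>I. ((\<lambda>r. H_norm s (\<lambda>\<alpha>. u r \<alpha> - u t \<alpha>)) \<longlongrightarrow> 0) (at t within I))"

text \<open>
  The value \<open>ln 0 = 0\<close> enters the integrand only at \<open>\<beta> \<equiv> \<alpha>\<close> modulo \<open>2\<pi>\<close>, a null set.
\<close>

definition Lambda_inv :: "(real \<Rightarrow> real) \<Rightarrow> real \<Rightarrow> real" where
  "Lambda_inv u \<alpha> = - 1 / (2 * pi) * (\<integral>\<beta>. ln (4 * (sin ((\<alpha> - \<beta>) / 2))\<^sup>2) * u \<beta> \<partial>circ)"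

text \<open>
  Classical solutions: \<open>u t \<alpha>\<close> is differentiable in \<open>t\<close> (one-sidedly at \<open>t = 0\<close>) and in \<open>\<alpha>\<close>, and the
  equation holds at every point.  The initial condition is equality almost everywhere because \<open>u0\<close>
  may be an arbitrary representative of its class, whereas \<open>u 0\<close> is continuous.
\<close>

definition solves_cauchy :: "(real \<Rightarrow> real) \<Rightarrow> (real \<Rightarrow> real \<Rightarrow> real) \<Rightarrow> bool" where
  "solves_cauchy u0 u \<longleftrightarrow>
     (\<forall>t\<ge>0. \<forall>\<alpha>. \<exists>u_t u_\<alpha>.
        ((\<lambda>r. u r \<alpha>) has_real_derivative u_t) (at t within {0..}) \<and>
        (u t has_real_derivative u_\<alpha>) (at \<alpha>) \<and>
        u_t + (u t \<alpha>)\<^sup>2 * u_\<alpha> = - Lambda_inv (u t) \<alpha>) \<and>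
     (AE \<alpha> in lebesgue. u 0 \<alpha> = u0 \<alpha>)"

end

theory Submission
  imports Defs "HOL-Complex_Analysis.Great_Picard" "HOL-Library.Nat_Bijection"
begin

text \<open>
  Everything happens on the side of the Fourier coefficients, where the equation is the system
  \<open>a\<^sub>n' = - (i n / 3) (a * a * a)\<^sub>n - a\<^sub>n / \<bar>n\<bar>\<close>. Symmetrising the energy flux over all quadruples with
  \<open>n\<^sub>1 + n\<^sub>2 + n\<^sub>3 + n\<^sub>4 = 0\<close>, the nonlinearity contributes nothing to the \<open>L\<^sup>2\<close> balance, and to the energy
  \<open>\<Sum> w n \<bar>a\<^sub>n\<bar>\<^sup>2\<close> with \<open>w n = n\<^sup>6 min 1 (\<bar>n\<bar> / R)\<close> at most a constant times this energy times
  \<open>(\<Sum> \<bar>n\<bar> \<bar>a\<^sub>n\<bar>)\<^sup>2\<close>. As long as the \<open>H\<^sup>3\<close> energy (\<open>R = 1\<close>) stays small, interpolating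
  \<open>1 \<le> \<rho> / \<bar>n\<bar> + n\<^sup>6 / \<rho>\<^sup>6\<close> with \<open>\<rho>\<close> proportional to \<open>1 + t\<close> turns the weak damping into the decay
  \<open>(1 + t)\<^sup>-\<^sup>3\<close> of the \<open>L\<^sup>2\<close> norm and \<open>(1 + t)\<^sup>-\<^sup>1\<close> of the \<open>H\<^sup>2\<close> norm. Hence the growth rate of the
  weighted energies is integrable in time, which closes the bootstrap for Galerkin approximations.
  The bounds for all \<open>R\<close> together make the \<open>H\<^sup>3\<close> tails small uniformly in time, so that
  convergence and continuity of the single coefficients upgrade to strong continuity in \<open>H\<^sup>3\<close>.
\<close>

section \<open>Ordinary differential equations and differential inequalities\<close>

text \<open>The damping \<open>1 / |n|\<close> has no spectral gap, so the L^2 balance alone gives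
  no rate: a bound on a high norm must be kept for all time. Two obstacles shape the estimates. The
  nonlinearity is a derivative of a cube, and estimated mode by mode the H^3 flux would lose a
  derivative; in the symmetrised flux the two largest frequencies almost cancel and the derivative
  falls on the third largest. A sharp high-frequency cut-off of n^6 would destroy this cancellation,
  which rests on increments of n w(n). The ramp is mild enough to keep it with constants independent
  of R, yet it tends to 0 on each fixed mode as R grows. Truncating all four frequencies to [-N, N]
  leaves the quadruple sum invariant under permutations, so the Galerkin systems obey the same
  identities as the equation. Constants are explicit and generous: the threshold 1 / 10^10 keeps the
  total growth exponent, 320000 * 13001 / 10^10, below 1/2, and exp(1/2) < 2 closes the bootstrap
  from data of half that size.\<close>

lemma nonincreasing_on_halfline:
  fixes f :: "real \<Rightarrow> real"
  assumes "\<And>t. t \<ge> 0 \<Longrightarrow> (f has_real_derivative f' t) (at t within {0..})"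
    and "\<And>t. 0 \<le> t \<Longrightarrow> t \<le> T \<Longrightarrow> f' t \<le> 0" and "0 \<le> T"
  shows "f T \<le> f 0"
proof (rule DERIV_nonpos_imp_decreasing_open[OF \<open>0 \<le> T\<close>])
    show "\<exists>y. DERIV f x :> y \<and> y \<le> 0" if "0 < x" "x < T" for x
    proof -
      have "at x within {0..} = at x"
        by (rule at_within_interior) (use that in simp)
      then show ?thesis using assms(1)[of x] assms(2)[of x] that by auto
    qed
    show "continuous_on {0..T} f"
      by (rule continuous_on_subset[of "{0..}"])
         (auto intro!: DERIV_continuous_on assms(1))
qed

text \<open>The integrating factor exp(k / (1 + t)) absorbs the growth rate. Since k / (1 + t)^2 has
  integral k over the whole half-line, the growth factor is exp k whatever T is.\<close>

lemma gronwall_inverse_square: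
  fixes f :: "real \<Rightarrow> real"
  assumes "\<And>t. t \<ge> 0 \<Longrightarrow> (f has_real_derivative f' t) (at t within {0..})"
    and "\<And>t. 0 \<le> t \<Longrightarrow> t \<le> T \<Longrightarrow> f' t \<le> k / (1 + t)\<^sup>2 * f t" and "0 \<le> T"
    and "f T \<ge> 0" "k \<ge> 0"
  shows "f T \<le> exp k * f 0"
proof -
  let ?g = "\<lambda>t. f t * exp (k / (1 + t))"
  have "?g T \<le> ?g 0"
  proof (rule nonincreasing_on_halfline[where f' = "\<lambda>t. (f' t - k / (1 + t)\<^sup>2 * f t) * exp (k / (1 + t))"])
    show "(?g has_real_derivative (f' t - k / (1 + t)\<^sup>2 * f t) * exp (k / (1 + t))) (at t within {0..})"
      if "t \<ge> 0" for t
      using that by (auto intro!: derivative_eq_intros assms(1) simp: field_simps power2_eq_square)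
  qed (use assms in \<open>auto simp: mult_le_0_iff\<close>)
  moreover have "f T \<le> ?g T"
    using assms mult_left_mono[of 1 "exp (k / (1 + T))" "f T"] by simp
  ultimately show ?thesis by (simp add: mult.commute)
qed

text \<open>With the integrating factor (1 + t)^7 the forcing becomes the constant K, which
  integrates to K t. Together with the initial value this is at most K (1 + T), hence one power less
  than 7 in the decay.\<close>

lemma power_decay:
  fixes y :: "real \<Rightarrow> real"
  assumes "\<And>t. t \<ge> 0 \<Longrightarrow> (y has_real_derivative y' t) (at t within {0..})"
    and "\<And>t. 0 \<le> t \<Longrightarrow> t \<le> T \<Longrightarrow> y' t \<le> - 7 / (1 + t) * y t + K / (1 + t) ^ 7"
    and "0 \<le> T" "y 0 \<le> K"
  shows "y T \<le> K / (1 + T) ^ 6"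
proof -
  let ?g = "\<lambda>t. (1 + t) ^ 7 * y t - K * t"
  let ?g' = "\<lambda>t. 7 * (1 + t) ^ 6 * y t + (1 + t) ^ 7 * y' t - K"
  have "?g T \<le> ?g 0"
  proof (rule nonincreasing_on_halfline[where f' = ?g'])
    show "(?g has_real_derivative ?g' t) (at t within {0..})" if "t \<ge> 0" for t
      using that by (auto intro!: derivative_eq_intros assms(1))
    show "?g' t \<le> 0" if t: "0 \<le> t" "t \<le> T" for t
    proof -
      have "(1 + t) ^ 7 * y' t \<le> (1 + t) ^ 7 * (- 7 / (1 + t) * y t + K / (1 + t) ^ 7)"
        using assms(2) t by (intro mult_left_mono) auto
      also have "\<dots> = - 7 * (1 + t) ^ 6 * y t + K"
      proof -
        have "(1 + t) ^ 7 = (1 + t) * (1 + t) ^ 6" by (simp add: eval_nat_numeral)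
        then have "(1 + t) ^ 7 * (- 7 / (1 + t) * y t) = - 7 * (1 + t) ^ 6 * y t"
          using t by simp
        moreover have "(1 + t) ^ 7 * (K / (1 + t) ^ 7) = K" using t by simp
        ultimately show ?thesis by (simp only: distrib_left)
      qed
      finally show ?thesis by simp
    qed
  qed (use assms in auto)
  then have "(1 + T) ^ 7 * y T \<le> K * (1 + T)" using assms by (simp add: algebra_simps)
  then have "(1 + T) * ((1 + T) ^ 6 * y T) \<le> (1 + T) * K" by (simp add: eval_nat_numeral algebra_simps)
  then have "(1 + T) ^ 6 * y T \<le> K" using assms by simp
  then show ?thesis using assms by (simp add: field_simps)
qed

text \<open>First hitting time: the set where f equals d is compact, so if it is nonempty it has a
  least element m. Up to m the weak bound holds, and \<open>step\<close> then gives the strict bound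
  at m itself, a contradiction.\<close>

lemma continuous_bootstrap:
  fixes f :: "real \<Rightarrow> real"
  assumes cont: "continuous_on {0..} f" and "f 0 < d"
    and step: "\<And>t. 0 \<le> t \<Longrightarrow> (\<And>s. 0 \<le> s \<Longrightarrow> s \<le> t \<Longrightarrow> f s \<le> d) \<Longrightarrow> f t < d"
    and "0 \<le> t"
  shows "f t < d"
proof (rule ccontr)
  assume "\<not> f t < d"
  have ivt: "\<exists>s. 0 \<le> s \<and> s \<le> r \<and> f s = d" if "0 \<le> r" "f r \<ge> d" for r
    by (rule IVT'[of f 0 d r])
       (use that \<open>f 0 < d\<close> in \<open>auto intro: continuous_on_subset[OF cont]\<close>)
  define S where "S = {s \<in> {0..t}. f s = d}"
  have "closed S" unfolding S_def
    by (intro continuous_closed_preimage_constant continuous_on_subset[OF cont]) auto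
  then have "compact S"
    unfolding S_def by (metis (no_types, lifting) Collect_mem_eq Collect_mono_iff bounded_closed_interval bounded_subset
      compact_eq_bounded_closed mem_Collect_eq)
  moreover have "S \<noteq> {}" using ivt[of t] \<open>\<not> f t < d\<close> \<open>0 \<le> t\<close> by (auto simp: S_def)
  ultimately obtain m where m: "m \<in> S" "\<And>s. s \<in> S \<Longrightarrow> m \<le> s"
    using compact_attains_inf by metis
  have "f s \<le> d" if s: "0 \<le> s" "s \<le> m" for s
  proof (rule ccontr)
    assume "\<not> f s \<le> d"
    then obtain r where r: "0 \<le> r" "r \<le> s" "f r = d" using ivt[of s] s by force
    then have "r \<in> S" using that m(1) by (auto simp: S_def)
    then have "m \<le> r" using m(2) by simp
    then have "r = s" using r s by simp
    then show False using r \<open>\<not> f s \<le> d\<close> by simp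
  qed
  then have "f m < d" using step[of m] m(1) by (auto simp: S_def)
  then show False using m(1) by (simp add: S_def)
qed

lemma integral_equation_has_vector_derivative:
  fixes G :: "real \<Rightarrow> complex"
  assumes "continuous_on {0..} G" "\<And>t. 0 \<le> t \<Longrightarrow> x t = c + integral {0..t} G" "0 \<le> t"
  shows "(x has_vector_derivative G t) (at t within {0..})"
proof -
  have "((\<lambda>s. integral {0..s} G) has_vector_derivative G t) (at t within {0..t+1})"
    by (rule integral_has_vector_derivative) (use assms in \<open>auto intro: continuous_on_subset\<close>)
  then have "((\<lambda>s. c + integral {0..s} G) has_vector_derivative G t) (at t within {0..t+1})"
    by (auto intro!: derivative_eq_intros)
  then have "(x has_vector_derivative G t) (at t within {0..t+1})"
    by (rule has_vector_derivative_transform[rotated 2]) (use assms in auto)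
  moreover have "at t within {0..t+1} = at t within {0..}"
    by (rule at_within_nhd[of _ "{t-1<..<t+1}"]) auto
  ultimately show ?thesis by simp
qed

text \<open>Picard iteration in the sup norm over the index set, with the Lipschitz hypothesis
  phrased coordinatewise so that no topology on the functions is involved. Differences of iterates
  are measured against exp(2 L t); in this weighted norm the iteration contracts by 1/2 on the whole
  half-line, and no restarting on short intervals occurs. The bound M makes every iterate Lipschitz
  in time, so that the integrands are continuous.\<close>

lemma picard_lindelof:
  fixes F :: "('i \<Rightarrow> complex) \<Rightarrow> 'i \<Rightarrow> complex"
  assumes lip: "\<And>x y B i. (\<And>j. cmod (x j - y j) \<le> B) \<Longrightarrow> cmod (F x i - F y i) \<le> L * B"
    and bd: "\<And>x i. cmod (F x i) \<le> M" and "L > 0"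
  shows "\<exists>x. x 0 = c \<and> (\<forall>t\<ge>0. \<forall>i. ((\<lambda>s. x s i) has_vector_derivative F (x t) i) (at t within {0..}))"
proof -
  have "M \<ge> 0" using bd[of undefined undefined] norm_ge_zero order_trans by blast
  define X where "X = rec_nat (\<lambda>t::real. c) (\<lambda>k x t i. c i + integral {0..t} (\<lambda>s. F (x s) i))"
  have X0: "X 0 t = c" for t by (simp add: X_def)
  have XS: "X (Suc k) t i = c i + integral {0..t} (\<lambda>s. F (X k s) i)" for k t i
    by (simp add: X_def)
  have cont_F: "continuous_on {0..} (\<lambda>s. F (y s) i)"
    if "\<And>s t j. 0 \<le> s \<Longrightarrow> s \<le> t \<Longrightarrow> cmod (y t j - y s j) \<le> M * (t - s)" for y i
  proof (rule lipschitz_on_continuous_on, rule lipschitz_onI)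
    fix s t :: real assume st: "s \<in> {0..}" "t \<in> {0..}"
    have "cmod (y s j - y t j) \<le> M * \<bar>s - t\<bar>" for j
      using that[of s t j] that[of t s j] st by (cases "s \<le> t") (auto simp: norm_minus_commute)
    then have "cmod (F (y s) i - F (y t) i) \<le> L * (M * \<bar>s - t\<bar>)" by (rule lip)
    then show "dist (F (y s) i) (F (y t) i) \<le> L * M * dist s t"
      by (simp add: dist_norm mult.assoc)
  qed (use \<open>L > 0\<close> \<open>M \<ge> 0\<close> in simp)
  have int_lip: "cmod (integral {0..t} g - integral {0..s} g) \<le> M * (t - s)"
    if "continuous_on {0..} g" "\<And>r. cmod (g r) \<le> M" "0 \<le> s" "s \<le> t" for g :: "real \<Rightarrow> complex" and s t
  proof -
    have i: "g integrable_on {0..t}" 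
      by (rule integrable_continuous_interval) (use that in \<open>auto intro: continuous_on_subset\<close>)
    have "integral {0..s} g + integral {s..t} g = integral {0..t} g"
      by (rule Henstock_Kurzweil_Integration.integral_combine) (use that i in auto)
    then have "integral {0..t} g - integral {0..s} g = integral {s..t} g" by (simp add: algebra_simps)
    moreover have "cmod (integral {s..t} g) \<le> M * (t - s)"
      by (rule integral_bound) (use that in \<open>auto intro: continuous_on_subset\<close>)
    ultimately show ?thesis by simp
  qed
  have Xlip: "cmod (X k t i - X k s i) \<le> M * (t - s)" if "0 \<le> s" "s \<le> t" for k s t i
    using that
  proof (induction k arbitrary: s t i)
    case 0 then show ?case using \<open>M \<ge> 0\<close> by (simp add: X0)
  next
    case (Suc k)
    then show ?case using int_lip[OF cont_F[of "X k"] bd] by (simp add: XS)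
  qed
  \<comment> \<open>The value for which M t <= D exp(2 L t), which is the bound on the first
    increment.\<close>
  define D where "D = M / (2 * L)"
  have "D \<ge> 0" using \<open>M \<ge> 0\<close> \<open>L > 0\<close> by (simp add: D_def)
  have exp_int: "((\<lambda>s. L * (B * exp (2 * L * s))) has_integral (B / 2 * exp (2 * L * t) - B / 2)) {0..t}"
    if "0 \<le> t" for t B
  proof -
    have "((\<lambda>s. L * (B * exp (2 * L * s))) has_integral (B / 2 * exp (2 * L * t) - B / 2 * exp (2 * L * 0))) {0..t}"
      by (rule fundamental_theorem_of_calculus)
         (use that in \<open>auto intro!: derivative_eq_intros simp: has_real_derivative_iff_has_vector_derivative[symmetric]\<close>)
    then show ?thesis by simp
  qed
  have diff_int: "cmod (integral {0..t} (\<lambda>s. F (y s) i) - integral {0..t} (\<lambda>s. F (z s) i)) \<le> B / 2 * exp (2 * L * t)"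
    if "\<And>s t j. 0 \<le> s \<Longrightarrow> s \<le> t \<Longrightarrow> cmod (y t j - y s j) \<le> M * (t - s)"
      "\<And>s t j. 0 \<le> s \<Longrightarrow> s \<le> t \<Longrightarrow> cmod (z t j - z s j) \<le> M * (t - s)"
      "\<And>s j. 0 \<le> s \<Longrightarrow> cmod (y s j - z s j) \<le> B * exp (2 * L * s)" "0 \<le> t" "B \<ge> 0"
    for y z t i B
  proof -
    have iy: "(\<lambda>s. F (y s) i) integrable_on {0..t}"
      by (rule integrable_continuous_interval) (rule continuous_on_subset[OF cont_F], use that in auto)
    have iz: "(\<lambda>s. F (z s) i) integrable_on {0..t}"
      by (rule integrable_continuous_interval) (rule continuous_on_subset[OF cont_F], use that in auto)
    have "integral {0..t} (\<lambda>s. F (y s) i) - integral {0..t} (\<lambda>s. F (z s) i)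
        = integral {0..t} (\<lambda>s. F (y s) i - F (z s) i)"
      by (rule Henstock_Kurzweil_Integration.integral_diff[symmetric]) (use iy iz in auto)
    also have "cmod \<dots> \<le> integral {0..t} (\<lambda>s. L * (B * exp (2 * L * s)))"
    proof (rule integral_norm_bound_integral)
      show "(\<lambda>s. F (y s) i - F (z s) i) integrable_on {0..t}"
        by (rule integrable_diff) (use iy iz in auto)
      show "(\<lambda>s. L * (B * exp (2 * L * s))) integrable_on {0..t}"
        using exp_int[OF \<open>0 \<le> t\<close>] by blast
      show "cmod (F (y s) i - F (z s) i) \<le> L * (B * exp (2 * L * s))" if "s \<in> {0..t}" for s
        by (rule lip, rule \<open>\<And>s j. 0 \<le> s \<Longrightarrow> cmod (y s j - z s j) \<le> B * exp (2 * L * s)\<close>)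
           (use that in auto)
    qed
    also have "\<dots> = B / 2 * exp (2 * L * t) - B / 2" using exp_int[OF \<open>0 \<le> t\<close>] by blast
    finally show ?thesis using \<open>B \<ge> 0\<close> by linarith
  qed
  have step: "cmod (X (Suc k) t i - X k t i) \<le> D * (1 / 2) ^ k * exp (2 * L * t)" if "0 \<le> t" for k t i
    using that
  proof (induction k arbitrary: t i)
    case 0
    have "cmod (X (Suc 0) t i - X (Suc 0) 0 i) \<le> M * (t - 0)" by (rule Xlip) (use 0 in auto)
    moreover have "X (Suc 0) 0 i = c i" by (simp add: XS)
    moreover have "M * t \<le> D * exp (2 * L * t)"
    proof -
      have "2 * L * t \<le> exp (2 * L * t)" using exp_ge_add_one_self[of "2 * L * t"] by linarith
      then have "D * (2 * L * t) \<le> D * exp (2 * L * t)" using \<open>D \<ge> 0\<close> by (rule mult_left_mono)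
      then show ?thesis using \<open>L > 0\<close> by (simp add: D_def)
    qed
    ultimately show ?case by (simp add: X0)
  next
    case (Suc k)
    have "cmod (integral {0..t} (\<lambda>s. F (X (Suc k) s) i) - integral {0..t} (\<lambda>s. F (X k s) i))
      \<le> D * (1 / 2) ^ k / 2 * exp (2 * L * t)"
      by (rule diff_int[OF Xlip Xlip Suc.IH]) (use Suc.prems \<open>D \<ge> 0\<close> in auto)
    then show ?case by (simp add: XS)
  qed
  define x where "x = (\<lambda>t i. lim (\<lambda>k. X k t i))"
  \<comment> \<open>The factor 1 - (1/2)^m is the exact partial geometric sum; the induction on m
    needs it although only its bound by 1 is used afterwards.\<close>
  have tail: "cmod (X k t i - X (k + m) t i) \<le> 2 * D * (1 / 2) ^ k * exp (2 * L * t) * (1 - (1 / 2) ^ m)"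
    if "0 \<le> t" for k m t i
  proof (induction m)
    case (Suc m)
    have "cmod (X k t i - X (k + Suc m) t i) \<le> cmod (X k t i - X (k + m) t i) + cmod (X (Suc (k + m)) t i - X (k + m) t i)"
      using norm_triangle_sub[of "X k t i - X (k + Suc m) t i" "X k t i - X (k + m) t i"]
      by (simp add: norm_minus_commute)
    also have "\<dots> \<le> 2 * D * (1 / 2) ^ k * exp (2 * L * t) * (1 - (1 / 2) ^ m) + D * (1 / 2) ^ (k + m) * exp (2 * L * t)"
      by (intro add_mono Suc.IH step that)
    also have "\<dots> = 2 * D * (1 / 2) ^ k * exp (2 * L * t) * (1 - (1 / 2) ^ Suc m)"
      by (simp add: power_add algebra_simps)
    finally show ?case .
  qed simp
  have tail': "cmod (X k t i - X m t i) \<le> 2 * D * exp (2 * L * t) * (1 / 2) ^ k" if "0 \<le> t" "k \<le> m" for k m t i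
  proof -
    have "2 * D * (1 / 2) ^ k * exp (2 * L * t) * (1 - (1 / 2) ^ (m - k)) \<le> 2 * D * (1 / 2) ^ k * exp (2 * L * t) * 1"
      using \<open>D \<ge> 0\<close> by (intro mult_left_mono) auto
    then show ?thesis using tail[of t k i "m - k"] that by (simp add: algebra_simps)
  qed
  have small: "(\<lambda>k. B * (1 / 2 :: real) ^ k) \<longlonglongrightarrow> 0" for B
    by (intro tendsto_mult_right_zero LIMSEQ_power_zero) auto
  have lim: "(\<lambda>k. X k t i) \<longlonglongrightarrow> x t i" if "0 \<le> t" for t i
  proof -
    have "Cauchy (\<lambda>k. X k t i)"
    proof (rule CauchyI')
      fix e :: real assume "e > 0"
      then obtain N where N: "\<And>k. k \<ge> N \<Longrightarrow> 2 * D * exp (2 * L * t) * (1 / 2) ^ k < e"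
        using order_tendstoD(2)[OF small[of "2 * D * exp (2 * L * t)"] \<open>e > 0\<close>] by (auto simp: eventually_sequentially)
      then show "\<exists>N. \<forall>k\<ge>N. \<forall>m>k. dist (X k t i) (X m t i) < e"
        unfolding dist_norm using tail'[OF that] by (meson less_imp_le order_le_less_trans)
    qed
    then show ?thesis unfolding x_def by (simp add: Cauchy_convergent_iff convergent_LIMSEQ_iff)
  qed
  have xX: "cmod (X k t i - x t i) \<le> (2 * D * (1 / 2) ^ k) * exp (2 * L * t)" if "0 \<le> t" for k t i
  proof (rule Lim_bounded)
    show "(\<lambda>m. cmod (X k t i - X m t i)) \<longlonglongrightarrow> cmod (X k t i - x t i)"
      by (intro tendsto_intros lim that)
    show "\<forall>m\<ge>k. cmod (X k t i - X m t i) \<le> (2 * D * (1 / 2) ^ k) * exp (2 * L * t)"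
      using tail'[OF that] by (simp add: algebra_simps)
  qed
  have xlip: "cmod (x t i - x s i) \<le> M * (t - s)" if "0 \<le> s" "s \<le> t" for s t i
  proof (rule Lim_bounded)
    show "(\<lambda>k. cmod (X k t i - X k s i)) \<longlonglongrightarrow> cmod (x t i - x s i)"
      by (intro tendsto_intros lim) (use that in auto)
    show "\<forall>k\<ge>0. cmod (X k t i - X k s i) \<le> M * (t - s)" using Xlip that by auto
  qed
  have eq: "x t i = c i + integral {0..t} (\<lambda>s. F (x s) i)" if "0 \<le> t" for t i
  proof (rule LIMSEQ_unique)
    show "(\<lambda>k. X (Suc k) t i) \<longlonglongrightarrow> x t i" using lim[OF that] by (rule LIMSEQ_Suc)
    show "(\<lambda>k. X (Suc k) t i) \<longlonglongrightarrow> c i + integral {0..t} (\<lambda>s. F (x s) i)"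
      unfolding XS
    proof (intro tendsto_add tendsto_const LIM_zero_cancel[where l = "integral {0..t} (\<lambda>s. F (x s) i)"]
        Lim_null_comparison[OF always_eventually small[of "D * exp (2 * L * t)"]] allI)
      fix k
      have "cmod (integral {0..t} (\<lambda>s. F (X k s) i) - integral {0..t} (\<lambda>s. F (x s) i))
        \<le> 2 * D * (1 / 2) ^ k / 2 * exp (2 * L * t)"
        by (rule diff_int[OF Xlip xlip xX that]) (use \<open>D \<ge> 0\<close> in auto)
      then show "cmod (integral {0..t} (\<lambda>s. F (X k s) i) - integral {0..t} (\<lambda>s. F (x s) i))
        \<le> D * exp (2 * L * t) * (1 / 2) ^ k" by (simp add: algebra_simps)
    qed
  qed
  have "((\<lambda>s. x s i) has_vector_derivative F (x t) i) (at t within {0..})" if "0 \<le> t" for t i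
    using cont_F[OF xlip] eq that by (rule integral_equation_has_vector_derivative)
  moreover have "x 0 = c" using eq[of 0] by auto
  ultimately show ?thesis by blast
qed

section \<open>The symmetrised energy flux\<close>

definition ramp :: "real \<Rightarrow> real \<Rightarrow> real" where
  "ramp R x = min 1 (\<bar>x\<bar> / R)"

text \<open>One family serves two purposes: at R = 1 it is n^6 on the integers, the H^3 weight; for
  large R it still equals n^6 above R, while on each fixed mode it is small. A bound with constants
  independent of R therefore controls the H^3 tails.\<close>

definition wt :: "real \<Rightarrow> real \<Rightarrow> real" where
  "wt R x = x ^ 6 * ramp R x"

lemma ramp_nonneg: "R > 0 \<Longrightarrow> 0 \<le> ramp R x" and ramp_le_1: "ramp R x \<le> 1"
  by (auto simp: ramp_def)

lemma ramp_1: "ramp 1 (real_of_int n) = (if n = 0 then 0 else 1)"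
proof (cases "n = 0")
  case False
  then have "1 \<le> \<bar>real_of_int n\<bar>" by linarith
  then show ?thesis using False by (simp add: ramp_def)
qed (simp add: ramp_def)

lemma wt_1: "wt 1 (real_of_int n) = real_of_int n ^ 6"
  by (simp add: wt_def ramp_1)

lemma wt_nonneg: "R > 0 \<Longrightarrow> 0 \<le> wt R x"
  by (simp add: wt_def ramp_nonneg)

lemma wt_minus: "wt R (- x) = wt R x"
  by (simp add: wt_def ramp_def)

lemma wt_abs: "wt R \<bar>x\<bar> = wt R x"
  by (simp add: wt_def ramp_def)

lemma wt_le: "wt R x \<le> x ^ 6"
  unfolding wt_def using ramp_le_1[of R x] by (simp add: mult_left_le)

lemma wt_large: "R > 0 \<Longrightarrow> R \<le> \<bar>x\<bar> \<Longrightarrow> wt R x = x ^ 6"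
  by (simp add: wt_def ramp_def)

lemma wt_mono:
  assumes "R > 0" "\<bar>x\<bar> \<le> \<bar>y\<bar>"
  shows "wt R x \<le> wt R y"
proof -
  have "\<bar>x\<bar> ^ 6 \<le> \<bar>y\<bar> ^ 6" using assms by (intro power_mono) auto
  moreover have "\<bar>x\<bar> / R \<le> \<bar>y\<bar> / R" using assms by (simp add: divide_right_mono)
  ultimately show ?thesis unfolding wt_def
    by (intro mult_mono) (use assms in \<open>auto simp: ramp_def power_even_abs intro: min.mono\<close>)
qed

text \<open>The sixth power costs 3^6 and the ramp at most 3, and 2187 = 3^7.\<close>

lemma wt_triple:
  assumes "R > 0" "\<bar>x\<bar> \<le> 3 * \<bar>y\<bar>"
  shows "wt R x \<le> 2187 * wt R y"
proof -
  have "wt R x \<le> wt R (3 * y)" using assms by (intro wt_mono) auto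
  also have "\<dots> = 729 * (y ^ 6 * ramp R (3 * y))" by (simp add: wt_def power_mult_distrib)
  also have "ramp R (3 * y) \<le> 3 * ramp R y" using assms by (auto simp: ramp_def abs_mult min_def field_simps)
  then have "729 * (y ^ 6 * ramp R (3 * y)) \<le> 729 * (y ^ 6 * (3 * ramp R y))"
    by (intro mult_left_mono) auto
  finally show ?thesis by (simp add: wt_def)
qed

text \<open>The proof uses only that \<open>ramp R\<close> is nondecreasing and \<open>ramp R x / x\<close> is nonincreasing.\<close>

lemma wt_increment:
  assumes "R > 0" "0 \<le> y" "y \<le> x"
  shows "x * wt R x - y * wt R y \<le> 8 * wt R x * (x - y)"
proof (cases "x = 0")
  case False
  then have "x > 0" using assms by simp
  define t where "t = y / x"
  have t: "0 \<le> t" "t \<le> 1" "y = t * x" using assms \<open>x > 0\<close> by (auto simp: t_def)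
  have w: "t * ramp R x \<le> ramp R y"
  proof (cases "x / R \<le> 1")
    case True
    then show ?thesis using t \<open>x > 0\<close> assms mult_mono[of t 1 "x / R" 1]
      by (auto simp: ramp_def abs_mult min_def field_simps)
  next
    case False
    then have "t * R \<le> t * x" using t assms by (intro mult_left_mono) (auto simp: field_simps)
    then show ?thesis using t False \<open>x > 0\<close> assms by (auto simp: ramp_def abs_mult min_def field_simps)
  qed
  \<comment> \<open>The exponent 8 counts six powers from the weight, one from the prefactor y and
    one given up in \<open>w\<close> when the two ramps are compared.\<close>
  have b: "1 - t ^ 8 \<le> 8 * (1 - t)"
    using Bernoulli_inequality[of "t - 1" 8] t by simp
  have "y * wt R y = x ^ 7 * t ^ 7 * ramp R y"
    by (simp add: wt_def t(3) power_mult_distrib eval_nat_numeral)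
  moreover have "x ^ 7 * t ^ 7 * (t * ramp R x) \<le> x ^ 7 * t ^ 7 * ramp R y"
    using w t \<open>x > 0\<close> by (intro mult_left_mono) auto
  moreover have "x * wt R x = x ^ 7 * ramp R x" by (simp add: wt_def eval_nat_numeral)
  moreover have "x ^ 7 * t ^ 7 * (t * ramp R x) = x ^ 7 * ramp R x * t ^ 8" by (simp add: eval_nat_numeral)
  ultimately have "x * wt R x - y * wt R y \<le> x ^ 7 * ramp R x * (1 - t ^ 8)"
    unfolding right_diff_distrib by linarith
  also have "\<dots> \<le> x ^ 7 * ramp R x * (8 * (1 - t))"
    using b \<open>x > 0\<close> ramp_nonneg[OF assms(1)] by (intro mult_left_mono) auto
  also have "\<dots> = 8 * wt R x * (x - y)"
    by (simp add: wt_def t(3) algebra_simps eval_nat_numeral)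
  finally show ?thesis .
qed (use assms in auto)

text \<open>The function x wt(x) is odd. For opposite signs the sum is therefore an increment
  between |y| and |x|, and \<open>wt_increment\<close> applies; for equal signs |x| + |y| = |x + y|
  and monotonicity of the weight suffices.\<close>

lemma wt_pair:
  assumes "R > 0" "\<bar>y\<bar> \<le> \<bar>x\<bar>"
  shows "\<bar>x * wt R x + y * wt R y\<bar> \<le> 8 * wt R x * \<bar>x + y\<bar>"
proof (cases "x * y \<ge> 0")
  case True
  then have "\<bar>x\<bar> + \<bar>y\<bar> = \<bar>x + y\<bar>" by (auto simp: zero_le_mult_iff)
  have "\<bar>x * wt R x + y * wt R y\<bar> \<le> \<bar>x\<bar> * wt R x + \<bar>y\<bar> * wt R y"
    using wt_nonneg[OF assms(1)] by (metis abs_mult abs_of_nonneg abs_triangle_ineq)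
  also have "\<bar>y\<bar> * wt R y \<le> \<bar>y\<bar> * wt R x" using assms by (intro mult_left_mono wt_mono) auto
  also have "\<bar>x\<bar> * wt R x + \<bar>y\<bar> * wt R x = wt R x * \<bar>x + y\<bar>"
    using \<open>\<bar>x\<bar> + \<bar>y\<bar> = \<bar>x + y\<bar>\<close> by (simp flip: distrib_right add: mult.commute)
  also have "\<dots> \<le> 8 * (wt R x * \<bar>x + y\<bar>)" using wt_nonneg[OF assms(1)] by simp
  finally show ?thesis by simp
next
  case False
  then have s: "\<bar>x + y\<bar> = \<bar>x\<bar> - \<bar>y\<bar>" using assms(2) by (auto simp: zero_le_mult_iff)
  have "\<bar>y\<bar> * wt R y \<le> \<bar>x\<bar> * wt R x" using assms by (intro mult_mono wt_mono wt_nonneg) auto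
  then have "\<bar>x * wt R x + y * wt R y\<bar> = \<bar>x\<bar> * wt R x - \<bar>y\<bar> * wt R y"
    using False by (cases "x \<ge> 0"; cases "y \<ge> 0") (auto simp: zero_le_mult_iff)
  also have "\<dots> \<le> 8 * wt R x * (\<bar>x\<bar> - \<bar>y\<bar>)"
    using wt_increment[OF assms(1), of "\<bar>y\<bar>" "\<bar>x\<bar>"] assms(2) by (simp add: wt_abs)
  finally show ?thesis using s by simp
qed

text \<open>The two largest frequencies are paired: their sum is -(x3 + x4), of size at most 2 |x3|,
  so the pair contributes 8 * 2 and the remaining two terms 1 each. The loose factor is |x3| and not
  |x1|, so no derivative is lost on the highest frequencies.\<close>

lemma flux_symbol_sorted:
  assumes "R > 0" "x1 + x2 + x3 + x4 = 0"
    and "\<bar>x2\<bar> \<le> \<bar>x1\<bar>" "\<bar>x3\<bar> \<le> \<bar>x2\<bar>" "\<bar>x4\<bar> \<le> \<bar>x3\<bar>"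
  shows "\<bar>x1 * wt R x1 + x2 * wt R x2 + x3 * wt R x3 + x4 * wt R x4\<bar> \<le> 18 * wt R x1 * \<bar>x3\<bar>"
proof -
  have "\<bar>x1 * wt R x1 + x2 * wt R x2\<bar> \<le> 8 * wt R x1 * \<bar>x1 + x2\<bar>"
    by (rule wt_pair) (use assms in auto)
  also have "\<dots> \<le> 8 * wt R x1 * (2 * \<bar>x3\<bar>)"
    using assms wt_nonneg[OF assms(1)] by (intro mult_left_mono) auto
  finally have 1: "\<bar>x1 * wt R x1 + x2 * wt R x2\<bar> \<le> 16 * wt R x1 * \<bar>x3\<bar>" by simp
  have 2: "\<bar>y * wt R y\<bar> \<le> wt R x1 * \<bar>x3\<bar>" if "\<bar>y\<bar> \<le> \<bar>x3\<bar>" for y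
  proof -
    have "\<bar>y\<bar> * wt R y \<le> \<bar>x3\<bar> * wt R x1"
      using assms that by (intro mult_mono wt_mono wt_nonneg) auto
    then show ?thesis using wt_nonneg[OF assms(1)] by (simp add: abs_mult mult.commute)
  qed
  show ?thesis using 1 2[of x3] 2[of x4] assms by linarith
qed

context
  fixes R :: real and b :: "int \<Rightarrow> real"
begin

text \<open>The majorant left once the two top modes are merged by Young's inequality: one frequency
  carries the weighted square, one a derivative, one nothing. All six assignments are added, which
  makes the bound independent of the order of the frequencies and its full sum a product of three
  single sums.\<close>

definition sym3 :: "int \<Rightarrow> int \<Rightarrow> int \<Rightarrow> real" where
  "sym3 x y z =
    (let e = (\<lambda>n. wt R (of_int n) * (b n)\<^sup>2); g = (\<lambda>n. \<bar>of_int n\<bar> * b n)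
     in e x * g y * b z + e x * g z * b y + e y * g x * b z + e y * g z * b x + e z * g x * b y + e z * g y * b x)"

text \<open>Each summand omits one of the four frequencies; a quadruple with zero sum is determined
  by the other three.\<close>

definition sym4 :: "int \<Rightarrow> int \<Rightarrow> int \<Rightarrow> int \<Rightarrow> real" where
  "sym4 p q r s = sym3 p q r + sym3 p q s + sym3 p r s + sym3 q r s"

definition flux4 :: "int \<Rightarrow> int \<Rightarrow> int \<Rightarrow> int \<Rightarrow> real" where
  "flux4 p q r s = \<bar>of_int p * wt R (of_int p) + of_int q * wt R (of_int q)
      + of_int r * wt R (of_int r) + of_int s * wt R (of_int s)\<bar> * (b p * b q * b r * b s)"

context
  assumes R: "R > 0" and b: "\<And>n. b n \<ge> 0"
begin

lemma sym3_nonneg: "sym3 x y z \<ge> 0"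
  unfolding sym3_def Let_def by (intro add_nonneg_nonneg mult_nonneg_nonneg wt_nonneg[OF R] b) auto

text \<open>As the sum is zero, |p| <= 3 |q|, so the weight at p is comparable to that at q. After 2
  b(p) b(q) <= b(p)^2 + b(q)^2 each square can thus carry the weight at its own frequency, with r
  taking the derivative and s bare. The constant is 9 * 2187 = 19683, rounded up.\<close>

lemma flux4_sorted:
  assumes "p + q + r + s = 0" "\<bar>q\<bar> \<le> \<bar>p\<bar>" "\<bar>r\<bar> \<le> \<bar>q\<bar>" "\<bar>s\<bar> \<le> \<bar>r\<bar>"
  shows "flux4 p q r s \<le> 20000 * sym4 p q r s"
proof -
  let ?x = "real_of_int"
  have 0: "?x p + ?x q + ?x r + ?x s = 0" using assms(1) by (metis of_int_0 of_int_add)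
  have le: "\<bar>?x q\<bar> \<le> \<bar>?x p\<bar>" "\<bar>?x r\<bar> \<le> \<bar>?x q\<bar>" "\<bar>?x s\<bar> \<le> \<bar>?x r\<bar>"
    using assms by (metis of_int_abs of_int_le_iff)+
  have "\<bar>?x p\<bar> \<le> 3 * \<bar>?x q\<bar>" using 0 le by linarith
  then have w: "wt R (?x p) \<le> 2187 * wt R (?x q)" by (rule wt_triple[OF R])
  have "flux4 p q r s \<le> (18 * wt R (?x p) * \<bar>?x r\<bar>) * (b p * b q * b r * b s)"
    unfolding flux4_def by (intro mult_right_mono flux_symbol_sorted R 0 le mult_nonneg_nonneg b)
  also have "\<dots> = 9 * (\<bar>?x r\<bar> * b r * b s) * (wt R (?x p) * (2 * b p * b q))" by simp
  also have "\<dots> \<le> 9 * (\<bar>?x r\<bar> * b r * b s) * (wt R (?x p) * ((b p)\<^sup>2 + (b q)\<^sup>2))"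
    using sum_squares_bound[of "b p" "b q"] by (intro mult_left_mono wt_nonneg R mult_nonneg_nonneg b) auto
  also have "\<dots> \<le> 9 * (\<bar>?x r\<bar> * b r * b s) * (2187 * (wt R (?x p) * (b p)\<^sup>2 + wt R (?x q) * (b q)\<^sup>2))"
  proof (intro mult_left_mono mult_nonneg_nonneg b)
    have "wt R (?x p) * (b q)\<^sup>2 \<le> 2187 * wt R (?x q) * (b q)\<^sup>2"
      using w by (intro mult_right_mono) auto
    moreover have "0 \<le> wt R (?x p) * (b p)\<^sup>2" using wt_nonneg[OF R] by simp
    ultimately show "wt R (?x p) * ((b p)\<^sup>2 + (b q)\<^sup>2) \<le> 2187 * (wt R (?x p) * (b p)\<^sup>2 + wt R (?x q) * (b q)\<^sup>2)"
      by (simp add: distrib_left)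
  qed auto
  also have "\<dots> = 19683 * (wt R (?x p) * (b p)\<^sup>2 * (\<bar>?x r\<bar> * b r) * b s + wt R (?x q) * (b q)\<^sup>2 * (\<bar>?x r\<bar> * b r) * b s)"
    by (simp add: algebra_simps)
  also have "\<dots> \<le> 20000 * (wt R (?x p) * (b p)\<^sup>2 * (\<bar>?x r\<bar> * b r) * b s + wt R (?x q) * (b q)\<^sup>2 * (\<bar>?x r\<bar> * b r) * b s)"
    by (intro mult_right_mono add_nonneg_nonneg mult_nonneg_nonneg b wt_nonneg R) auto
  also have "\<dots> \<le> 20000 * (sym3 p r s + sym3 q r s)"
  proof -
    have "wt R (?x n) * (b n)\<^sup>2 * (\<bar>?x r\<bar> * b r) * b s \<le> sym3 n r s" for n
    proof -
      have "0 \<le> wt R (?x k) * (b k)\<^sup>2 * (\<bar>?x l\<bar> * b l) * b m" for k l m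
        by (intro mult_nonneg_nonneg wt_nonneg[OF R] b) auto
      from this[of n s r] this[of r n s] this[of r s n] this[of s n r] this[of s r n]
      show ?thesis unfolding sym3_def Let_def by linarith
    qed
    then show ?thesis by (intro mult_left_mono add_mono) auto
  qed
  also have "\<dots> \<le> 20000 * sym4 p q r s"
    using sym3_nonneg[of p q r] sym3_nonneg[of p q s] by (simp add: sym4_def)
  finally show ?thesis .
qed

lemma sym3_swap: "sym3 y x z = sym3 x y z" "sym3 x z y = sym3 x y z"
  by (simp_all add: sym3_def Let_def)

lemma sym4_swap: "sym4 q p r s = sym4 p q r s" "sym4 p r q s = sym4 p q r s" "sym4 p q s r = sym4 p q r s"
  by (simp_all add: sym4_def sym3_swap)

lemma flux4_swap: "flux4 q p r s = flux4 p q r s" "flux4 p r q s = flux4 p q r s" "flux4 p q s r = flux4 p q r s"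
  by (simp_all add: flux4_def ac_simps)

text \<open>The three sorting steps below insert one entry at a time into a decreasing arrangement.\<close>

lemma flux4_bound:
  assumes "p + q + r + s = 0"
  shows "flux4 p q r s \<le> 20000 * sym4 p q r s"
proof -
  let ?G = "\<lambda>p q r s. flux4 p q r s \<le> 20000 * sym4 p q r s"
  have sw: "?G q p r s = ?G p q r s" "?G p r q s = ?G p q r s" "?G p q s r = ?G p q r s" for p q r s
    by (simp_all only: sym4_swap flux4_swap)
  have 3: "?G p q r s" if "p + q + r + s = 0" "\<bar>q\<bar> \<le> \<bar>p\<bar>" "\<bar>r\<bar> \<le> \<bar>q\<bar>" for p q r s
  proof -
    consider "\<bar>s\<bar> \<le> \<bar>r\<bar>" | "\<bar>r\<bar> \<le> \<bar>s\<bar>" "\<bar>s\<bar> \<le> \<bar>q\<bar>" | "\<bar>q\<bar> \<le> \<bar>s\<bar>" "\<bar>s\<bar> \<le> \<bar>p\<bar>" | "\<bar>p\<bar> \<le> \<bar>s\<bar>"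
      by linarith
    then show ?thesis
    proof cases
      case 1 then show ?thesis using that flux4_sorted[of p q r s] by simp
    next
      case 2 then show ?thesis using that flux4_sorted[of p q s r] sw by simp
    next
      case 3
      then have "?G p s q r" using that by (intro flux4_sorted) auto
      then show ?thesis using sw(2)[of p s q r] sw(3)[of p q s r] by simp
    next
      case 4
      then have "?G s p q r" using that by (intro flux4_sorted) auto
      then show ?thesis using sw(1)[of s p q r] sw(2)[of p s q r] sw(3)[of p q s r] by simp
    qed
  qed
  have 2: "?G p q r s" if "p + q + r + s = 0" "\<bar>q\<bar> \<le> \<bar>p\<bar>" for p q r s
  proof -
    consider "\<bar>r\<bar> \<le> \<bar>q\<bar>" | "\<bar>q\<bar> \<le> \<bar>r\<bar>" "\<bar>r\<bar> \<le> \<bar>p\<bar>" | "\<bar>p\<bar> \<le> \<bar>r\<bar>"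
      by linarith
    then show ?thesis
    proof cases
      case 1 then show ?thesis using that 3[of p q r s] by simp
    next
      case 2
      then have "?G p r q s" using that by (intro 3) auto
      then show ?thesis using sw(2)[of p r q s] by simp
    next
      case 3
      then have "?G r p q s" using that by (intro \<open>\<And>s r q p. p + q + r + s = 0 \<Longrightarrow> \<bar>q\<bar> \<le> \<bar>p\<bar> \<Longrightarrow> \<bar>r\<bar> \<le> \<bar>q\<bar> \<Longrightarrow> ?G p q r s\<close>) auto
      then show ?thesis using sw(1)[of r p q s] sw(2)[of p r q s] by simp
    qed
  qed
  show ?thesis
  proof (cases "\<bar>q\<bar> \<le> \<bar>p\<bar>")
    case False
    then have "?G q p r s" using assms by (intro 2) auto
    then show ?thesis using sw(1) by simp
  qed (use 2 assms in simp)
qed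

end
end

section \<open>Sums over frequency quadruples with zero sum\<close>

definition quads :: "int \<Rightarrow> (int \<times> int \<times> int \<times> int) set" where
  "quads N = {(p, q, r, s). p \<in> {-N..N} \<and> q \<in> {-N..N} \<and> r \<in> {-N..N} \<and> s \<in> {-N..N} \<and> p + q + r + s = 0}"

lemma sum_quads_swap:
  "(\<Sum>(p, q, r, s)\<in>quads N. f q p r s) = (\<Sum>(p, q, r, s)\<in>quads N. f p q r s)"
  "(\<Sum>(p, q, r, s)\<in>quads N. f p r q s) = (\<Sum>(p, q, r, s)\<in>quads N. f p q r s)"
  "(\<Sum>(p, q, r, s)\<in>quads N. f p q s r) = (\<Sum>(p, q, r, s)\<in>quads N. f p q r s)"
proof -
  show "(\<Sum>(p, q, r, s)\<in>quads N. f q p r s) = (\<Sum>(p, q, r, s)\<in>quads N. f p q r s)"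
    by (rule sum.reindex_bij_witness[where i = "\<lambda>(p, q, r, s). (q, p, r, s)" and j = "\<lambda>(p, q, r, s). (q, p, r, s)"])
       (auto simp: quads_def)
  show "(\<Sum>(p, q, r, s)\<in>quads N. f p r q s) = (\<Sum>(p, q, r, s)\<in>quads N. f p q r s)"
    by (rule sum.reindex_bij_witness[where i = "\<lambda>(p, q, r, s). (p, r, q, s)" and j = "\<lambda>(p, q, r, s). (p, r, q, s)"])
       (auto simp: quads_def)
  show "(\<Sum>(p, q, r, s)\<in>quads N. f p q s r) = (\<Sum>(p, q, r, s)\<in>quads N. f p q r s)"
    by (rule sum.reindex_bij_witness[where i = "\<lambda>(p, q, r, s). (p, q, s, r)" and j = "\<lambda>(p, q, r, s). (p, q, s, r)"])
       (auto simp: quads_def)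
qed

text \<open>The last entry is determined by the first three, so forgetting it is injective; its
  range constraint only removes nonnegative terms.\<close>

lemma sum_quads_le:
  fixes f :: "int \<Rightarrow> int \<Rightarrow> int \<Rightarrow> real"
  assumes "\<And>x y z. f x y z \<ge> 0"
  shows "(\<Sum>(p, q, r, s)\<in>quads N. f p q r) \<le> (\<Sum>x\<in>{-N..N}. \<Sum>y\<in>{-N..N}. \<Sum>z\<in>{-N..N}. f x y z)"
proof -
  let ?T = "(\<lambda>(p, q, r, s). (p, q, r)) ` quads N"
  have inj: "inj_on (\<lambda>(p, q, r, s). (p, q, r)) (quads N)" by (auto simp: inj_on_def quads_def)
  have "(\<Sum>(p, q, r, s)\<in>quads N. f p q r) = (\<Sum>(x, y, z)\<in>?T. f x y z)"
    unfolding sum.reindex[OF inj] by (auto intro!: sum.cong)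
  also have "\<dots> \<le> (\<Sum>(x, y, z)\<in>{-N..N} \<times> {-N..N} \<times> {-N..N}. f x y z)"
    by (rule sum_mono2) (use assms in \<open>auto simp: quads_def\<close>)
  finally show ?thesis by (simp add: sum.cartesian_product)
qed

lemma sum3_product:
  fixes f g h :: "int \<Rightarrow> 'a::comm_semiring_0"
  shows "(\<Sum>x\<in>A. \<Sum>y\<in>A. \<Sum>z\<in>A. f x * g y * h z) = sum f A * sum g A * sum h A"
  by (simp flip: sum_distrib_left sum_distrib_right)

lemma sum_sym3:
  "(\<Sum>x\<in>A. \<Sum>y\<in>A. \<Sum>z\<in>A. sym3 R b x y z)
    = 6 * ((\<Sum>n\<in>A. wt R (of_int n) * (b n)\<^sup>2) * (\<Sum>n\<in>A. \<bar>of_int n\<bar> * b n) * (\<Sum>n\<in>A. b n))"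
proof -
  define e where "e = (\<lambda>n::int. wt R (of_int n) * (b n)\<^sup>2)"
  define g where "g = (\<lambda>n::int. \<bar>of_int n\<bar> * b n)"
  have *: "sym3 R b x y z = e x * g y * b z + e x * b y * g z + g x * e y * b z + b x * e y * g z
      + g x * b y * e z + b x * g y * e z" for x y z
    by (simp add: sym3_def Let_def e_def g_def ac_simps)
  have "(\<Sum>x\<in>A. \<Sum>y\<in>A. \<Sum>z\<in>A. sym3 R b x y z) = 6 * (sum e A * sum g A * sum b A)"
    by (simp only: * sum.distrib sum3_product) (simp add: algebra_simps)
  then show ?thesis unfolding e_def g_def .
qed

text \<open>480000 = 20000 * 4 * 6: four choices of the omitted frequency and six assignments in
  \<open>sym3\<close>. The chain of swaps moves the omitted frequency into the last slot, where
  \<open>sum_quads_le\<close> discards it.\<close>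

lemma sum_flux4_le:
  assumes "R > 0" and b: "\<And>n. b n \<ge> 0"
  shows "(\<Sum>(p, q, r, s)\<in>quads N. flux4 R b p q r s)
    \<le> 480000 * ((\<Sum>n\<in>{-N..N}. wt R (of_int n) * (b n)\<^sup>2) * (\<Sum>n\<in>{-N..N}. \<bar>of_int n\<bar> * b n) * (\<Sum>n\<in>{-N..N}. b n))"
    (is "_ \<le> _ * ?B")
proof -
  let ?s = "sym3 R b"
  have "(\<Sum>(p, q, r, s)\<in>quads N. flux4 R b p q r s) \<le> (\<Sum>(p, q, r, s)\<in>quads N. 20000 * sym4 R b p q r s)"
    by (rule sum_mono) (use flux4_bound[OF assms] in \<open>auto simp: quads_def\<close>)
  also have "\<dots> = 20000 * ((\<Sum>(p, q, r, s)\<in>quads N. ?s p q r) + (\<Sum>(p, q, r, s)\<in>quads N. ?s p q s)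
      + (\<Sum>(p, q, r, s)\<in>quads N. ?s p r s) + (\<Sum>(p, q, r, s)\<in>quads N. ?s q r s))"
    by (simp add: sym4_def sum_distrib_left sum.distrib distrib_left split_def)
  also have "(\<Sum>(p, q, r, s)\<in>quads N. ?s p q s) = (\<Sum>(p, q, r, s)\<in>quads N. ?s p q r)"
    by (rule sum_quads_swap(3)[where f = "\<lambda>p q r s. ?s p q r"])
  also have "(\<Sum>(p, q, r, s)\<in>quads N. ?s p r s) = (\<Sum>(p, q, r, s)\<in>quads N. ?s p q s)"
    by (rule sum_quads_swap(2)[where f = "\<lambda>p q r s. ?s p q s"])
  also have "(\<Sum>(p, q, r, s)\<in>quads N. ?s p q s) = (\<Sum>(p, q, r, s)\<in>quads N. ?s p q r)"
    by (rule sum_quads_swap(3)[where f = "\<lambda>p q r s. ?s p q r"])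
  also have "(\<Sum>(p, q, r, s)\<in>quads N. ?s q r s) = (\<Sum>(p, q, r, s)\<in>quads N. ?s p r s)"
    by (rule sum_quads_swap(1)[where f = "\<lambda>p q r s. ?s p r s"])
  also have "(\<Sum>(p, q, r, s)\<in>quads N. ?s p r s) = (\<Sum>(p, q, r, s)\<in>quads N. ?s p q s)"
    by (rule sum_quads_swap(2)[where f = "\<lambda>p q r s. ?s p q s"])
  also have "(\<Sum>(p, q, r, s)\<in>quads N. ?s p q s) = (\<Sum>(p, q, r, s)\<in>quads N. ?s p q r)"
    by (rule sum_quads_swap(3)[where f = "\<lambda>p q r s. ?s p q r"])
  finally show ?thesis
    using sum_quads_le[of ?s N, OF sym3_nonneg[OF assms]] by (simp add: sum_sym3)
qed

text \<open>Only two indices are restricted to A. For coefficients supported in A the third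
  restriction is automatic, and this is the full cubic convolution.\<close>

definition conv3 :: "int set \<Rightarrow> (int \<Rightarrow> complex) \<Rightarrow> int \<Rightarrow> complex" where
  "conv3 A a n = (\<Sum>j\<in>A. \<Sum>k\<in>A. a j * a k * a (n - j - k))"

text \<open>Substituting p = -n turns each term into a product over a zero-sum quadruple with symbol
  -\<phi>(p), by oddness. The product and the index set are invariant under permutations, so \<phi>
  may sit at any of the four positions; adding the four versions gives the factor 4.\<close>

lemma flux_symmetrised:
  fixes a :: "int \<Rightarrow> complex" and \<phi> :: "int \<Rightarrow> complex"
  assumes supp: "\<And>n. n \<notin> {-N..N} \<Longrightarrow> a n = 0" and odd: "\<And>n. \<phi> (- n) = - \<phi> n"
  shows "4 * (\<Sum>n\<in>{-N..N}. \<phi> n * a (- n) * conv3 {-N..N} a n)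
    = - (\<Sum>(p, q, r, s)\<in>quads N. (\<phi> p + \<phi> q + \<phi> r + \<phi> s) * (a p * a q * a r * a s))"
proof -
  let ?I = "{-N..N}"
  let ?A = "\<lambda>p q r s. a p * a q * a r * a s"
  let ?S = "\<Sum>(p, q, r, s)\<in>quads N. \<phi> p * ?A p q r s"
  have supp': "- N \<le> n \<and> n \<le> N" if "a n \<noteq> 0" for n using supp[of n] that by auto
  have "(\<Sum>n\<in>?I. \<phi> n * a (- n) * conv3 ?I a n)
    = (\<Sum>(n, j, k)\<in>?I \<times> ?I \<times> ?I. \<phi> n * ?A (- n) j k (n - j - k))"
    by (simp add: conv3_def sum_distrib_left mult.assoc sum.cartesian_product split_def)
  also have "\<dots> = (\<Sum>(n, j, k)\<in>{(n, j, k). (n, j, k) \<in> ?I \<times> ?I \<times> ?I \<and> n - j - k \<in> ?I}. \<phi> n * ?A (- n) j k (n - j - k))"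
    by (rule sum.mono_neutral_right) (auto dest: supp')
  also have "\<dots> = (\<Sum>(p, q, r, s)\<in>quads N. - (\<phi> p * ?A p q r s))"
    by (rule sum.reindex_bij_witness[where i = "\<lambda>(p, q, r, s). (- p, q, r)" and j = "\<lambda>(n, j, k). (- n, j, k, n - j - k)"])
       (auto simp: quads_def odd)
  also have "\<dots> = - ?S" by (simp add: sum_negf split_def)
  finally have 1: "(\<Sum>n\<in>?I. \<phi> n * a (- n) * conv3 ?I a n) = - ?S" .
  have q: "(\<Sum>(p, q, r, s)\<in>quads N. \<phi> q * ?A p q r s) = ?S"
    using sum_quads_swap(1)[of "\<lambda>p q r s. \<phi> p * ?A p q r s" N] by (simp add: ac_simps)
  have r: "(\<Sum>(p, q, r, s)\<in>quads N. \<phi> r * ?A p q r s) = ?S"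
    using sum_quads_swap(2)[of "\<lambda>p q r s. \<phi> q * ?A p q r s" N] q by (simp add: ac_simps)
  have s: "(\<Sum>(p, q, r, s)\<in>quads N. \<phi> s * ?A p q r s) = ?S"
    using sum_quads_swap(3)[of "\<lambda>p q r s. \<phi> r * ?A p q r s" N] r by (simp add: ac_simps)
  have "(\<Sum>(p, q, r, s)\<in>quads N. (\<phi> p + \<phi> q + \<phi> r + \<phi> s) * ?A p q r s)
    = ?S + (\<Sum>(p, q, r, s)\<in>quads N. \<phi> q * ?A p q r s) + (\<Sum>(p, q, r, s)\<in>quads N. \<phi> r * ?A p q r s)
      + (\<Sum>(p, q, r, s)\<in>quads N. \<phi> s * ?A p q r s)"
    by (simp add: split_def distrib_right sum.distrib)
  then show ?thesis using 1 q r s by simp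
qed

text \<open>For the identity symbol the symmetrised symbol p + q + r + s is zero by the constraint,
  so the L^2 conservation law of the nonlinearity survives truncation exactly.\<close>

lemma flux_L2_zero:
  assumes "\<And>n. n \<notin> {-N..N} \<Longrightarrow> a n = 0"
  shows "(\<Sum>n\<in>{-N..N}. of_int n * a (- n) * conv3 {-N..N} a n) = 0"
proof -
  have "(\<Sum>(p, q, r, s)\<in>quads N. (of_int p + of_int q + of_int r + of_int s) * (a p * a q * a r * a s)) = 0"
    by (rule sum.neutral) (auto simp: quads_def simp flip: of_int_add)
  then show ?thesis using flux_symmetrised[of N a of_int] assms by simp
qed

lemma flux_wt_le:
  assumes "R > 0" "\<And>n. n \<notin> {-N..N} \<Longrightarrow> a n = 0"
  shows "cmod (\<Sum>n\<in>{-N..N}. complex_of_real (of_int n * wt R (of_int n)) * a (- n) * conv3 {-N..N} a n)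
    \<le> 120000 * ((\<Sum>n\<in>{-N..N}. wt R (of_int n) * (cmod (a n))\<^sup>2) * (\<Sum>n\<in>{-N..N}. \<bar>of_int n\<bar> * cmod (a n))
        * (\<Sum>n\<in>{-N..N}. cmod (a n)))"
    (is "cmod ?S \<le> _")
proof -
  let ?\<phi> = "\<lambda>n. complex_of_real (of_int n * wt R (of_int n))"
  have "cmod (4 * ?S) = cmod (\<Sum>(p, q, r, s)\<in>quads N. (?\<phi> p + ?\<phi> q + ?\<phi> r + ?\<phi> s) * (a p * a q * a r * a s))"
    using flux_symmetrised[of N a ?\<phi>] assms(2) by (simp add: wt_minus)
  also have "\<dots> \<le> (\<Sum>(p, q, r, s)\<in>quads N. flux4 R (\<lambda>n. cmod (a n)) p q r s)"
    by (rule order_trans[OF norm_sum], rule sum_mono)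
       (auto simp: flux4_def norm_mult simp flip: of_real_mult of_real_add simp del: of_real_mult of_real_add)
  also note sum_flux4_le[OF assms(1)]
  finally have "4 * cmod ?S \<le> 480000 * ((\<Sum>n\<in>{-N..N}. wt R (of_int n) * (cmod (a n))\<^sup>2)
      * (\<Sum>n\<in>{-N..N}. \<bar>of_int n\<bar> * cmod (a n)) * (\<Sum>n\<in>{-N..N}. cmod (a n)))"
    unfolding norm_mult by simp
  then show ?thesis by linarith
qed

section \<open>The Galerkin system\<close>

lemma cmod_divide_abs_int_le: "cmod (z / of_int \<bar>n\<bar>) \<le> cmod z"
proof (cases "n = 0")
  case False
  then have "real_of_int \<bar>n\<bar> \<ge> 1" by linarith
  then show ?thesis by (simp add: norm_divide divide_le_eq mult_le_cancel_left1)
qed simp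

text \<open>Poincare's inequality mode by mode: nonzero integers have modulus at least 1, and the
  zero mode is required to vanish.\<close>

lemma le_abs_int_power_mult:
  fixes x :: real
  assumes "x \<ge> 0" "n = 0 \<Longrightarrow> x = 0"
  shows "x \<le> \<bar>of_int n\<bar> ^ k * x"
proof (cases "n = 0")
  case False
  then have "1 \<le> \<bar>real_of_int n\<bar>" by linarith
  then have "1 \<le> \<bar>real_of_int n\<bar> ^ k" by (rule one_le_power)
  then have "1 * x \<le> \<bar>of_int n\<bar> ^ k * x" using assms(1) by (rule mult_right_mono)
  then show ?thesis by simp
qed (use assms in simp)

text \<open>The factor \<open>\<i> * of_int n / 3\<close> comes from writing u^2 u_x as one third of
  the derivative of u^3. At n = 0 the damping term is 0 because division by zero is, which is the
  convention of the multiplier \<open>1 / |n|\<close>.\<close>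

definition gal :: "int \<Rightarrow> (int \<Rightarrow> complex) \<Rightarrow> int \<Rightarrow> complex" where
  "gal N a n = (if n \<in> {-N..N} then - (\<i> * of_int n / 3) * conv3 {-N..N} a n - a n / of_int \<bar>n\<bar> else 0)"

lemma cmod_conv3_diff:
  fixes x y :: "int \<Rightarrow> complex" and r B :: real
  assumes "\<And>n. cmod (x n) \<le> r" "\<And>n. cmod (y n) \<le> r" "\<And>n. cmod (x n - y n) \<le> B" "finite A"
  shows "cmod (conv3 A x n - conv3 A y n) \<le> (card A)\<^sup>2 * (3 * r\<^sup>2 * B)"
proof -
  have r: "0 \<le> r" using assms(1)[of 0] norm_ge_zero order_trans by blast
  have B: "0 \<le> B" using assms(3)[of 0] norm_ge_zero order_trans by blast
  have 1: "cmod (x i * x j * x k - y i * y j * y k) \<le> 3 * r\<^sup>2 * B" for i j k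
  proof -
    have "x i * x j * x k - y i * y j * y k
      = (x i - y i) * x j * x k + y i * (x j - y j) * x k + y i * y j * (x k - y k)"
      by (simp add: algebra_simps)
    also have "cmod \<dots> \<le> cmod ((x i - y i) * x j * x k) + cmod (y i * (x j - y j) * x k) + cmod (y i * y j * (x k - y k))"
      by (intro order_trans[OF norm_triangle_ineq] add_right_mono norm_triangle_ineq)
    also have "\<dots> \<le> B * r * r + r * B * r + r * r * B"
      unfolding norm_mult by (intro add_mono mult_mono assms r B mult_nonneg_nonneg norm_ge_zero)
    finally show ?thesis by (simp add: power2_eq_square ac_simps)
  qed
  have "cmod (conv3 A x n - conv3 A y n) \<le> (\<Sum>j\<in>A. \<Sum>k\<in>A. 3 * r\<^sup>2 * B)"
    unfolding conv3_def sum_subtractf[symmetric]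
    by (intro order_trans[OF norm_sum] sum_mono 1)
  then show ?thesis by (simp add: power2_eq_square)
qed

lemma cmod_conv3:
  fixes x :: "int \<Rightarrow> complex" and r :: real
  assumes "\<And>n. cmod (x n) \<le> r" "finite A"
  shows "cmod (conv3 A x n) \<le> r * (\<Sum>j\<in>A. cmod (x j))\<^sup>2"
proof -
  have "cmod (conv3 A x n) \<le> (\<Sum>j\<in>A. \<Sum>k\<in>A. cmod (x j) * cmod (x k) * r)"
    unfolding conv3_def
    by (intro order_trans[OF norm_sum] sum_mono) (auto simp: norm_mult intro!: mult_mono assms)
  also have "\<dots> = r * (\<Sum>j\<in>A. cmod (x j))\<^sup>2"
    by (simp add: power2_eq_square sum_product sum_distrib_left ac_simps)
  finally show ?thesis .
qed

lemma conv3_cnj: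
  assumes "\<And>n. a (- n) = cnj (a n)"
  shows "conv3 {-N..N} a (- n) = cnj (conv3 {-N..N} a n)"
proof -
  have "conv3 {-N..N} a (- n) = (\<Sum>(j, k)\<in>{-N..N} \<times> {-N..N}. a j * a k * a (- j - k - n))"
  proof -
    have "- n - j - k = - j - k - n" for j k by simp
    then show ?thesis unfolding conv3_def by (simp only: sum.cartesian_product)
  qed
  also have "\<dots> = (\<Sum>(j, k)\<in>{-N..N} \<times> {-N..N}. a (- j) * a (- k) * a (j + k - n))"
    by (rule sum.reindex_bij_witness[where i = "\<lambda>(j, k). (- j, - k)" and j = "\<lambda>(j, k). (- j, - k)"])
       auto
  also have "a (j + k - n) = cnj (a (n - j - k))" for j k
    using assms[of "n - j - k"] by (simp add: algebra_simps)
  then have "(\<Sum>(j, k)\<in>{-N..N} \<times> {-N..N}. a (- j) * a (- k) * a (j + k - n)) = cnj (conv3 {-N..N} a n)"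
    by (simp add: assms conv3_def sum.cartesian_product split_def)
  finally show ?thesis .
qed

lemma gal_cnj: "(\<And>n. a (- n) = cnj (a n)) \<Longrightarrow> gal N a (- n) = cnj (gal N a n)"
  by (auto simp: gal_def conv3_cnj)

lemma energy_has_derivative:
  fixes a :: "real \<Rightarrow> int \<Rightarrow> complex" and w :: "int \<Rightarrow> real"
  assumes "\<And>n. ((\<lambda>s. a s n) has_vector_derivative f n) (at t within S)"
  shows "((\<lambda>s. \<Sum>n\<in>I. w n * (cmod (a s n))\<^sup>2) has_real_derivative (\<Sum>n\<in>I. w n * (2 * Re (cnj (a t n) * f n))))
    (at t within S)"
proof (rule DERIV_sum)
  fix n
  have "((\<lambda>s. (cmod (a s n))\<^sup>2) has_real_derivative 2 * Re (cnj (a t n) * f n)) (at t within S)"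
    unfolding power2_norm_eq_inner has_real_derivative_iff_has_vector_derivative has_vector_derivative_def
    using assms[of n, unfolded has_vector_derivative_def]
    by (auto intro!: derivative_eq_intros simp: inner_complex_def fun_eq_iff algebra_simps)
  then show "((\<lambda>s. w n * (cmod (a s n))\<^sup>2) has_real_derivative w n * (2 * Re (cnj (a t n) * f n))) (at t within S)"
    by (rule DERIV_cmult)
qed

text \<open>Reality of the function, cnj (a n) = a (-n), turns the cubic part into the flux of
  \<open>flux_symmetrised\<close> with symbol n w(n), odd for an even weight; the factor i is what
  makes its imaginary part appear.\<close>

lemma energy_rate:
  fixes w :: "int \<Rightarrow> real"
  assumes "\<And>n. a (- n) = cnj (a n)"
  shows "(\<Sum>n\<in>{-N..N}. w n * (2 * Re (cnj (a n) * gal N a n)))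
    = - 2 * (\<Sum>n\<in>{-N..N}. w n * (cmod (a n))\<^sup>2 / \<bar>of_int n\<bar>)
      + 2 / 3 * Im (\<Sum>n\<in>{-N..N}. complex_of_real (of_int n * w n) * a (- n) * conv3 {-N..N} a n)"
proof -
  have "w n * (2 * Re (cnj (a n) * gal N a n)) = - 2 * (w n * (cmod (a n))\<^sup>2 / \<bar>of_int n\<bar>)
    + 2 / 3 * Im (complex_of_real (of_int n * w n) * a (- n) * conv3 {-N..N} a n)" if "n \<in> {-N..N}" for n
  proof -
    let ?c = "conv3 {-N..N} a n"
    define v where "v = Im (a (- n) * ?c)"
    have "cnj (a n) * gal N a n = - (\<i> * of_int n / 3) * (a (- n) * ?c) - cnj (a n) * a n / of_int \<bar>n\<bar>"
      using that by (simp add: gal_def assms algebra_simps)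
    moreover have "cnj (a n) * a n = complex_of_real ((cmod (a n))\<^sup>2)"
      by (metis complex_norm_square mult.commute of_real_power)
    moreover have "Re (complex_of_real ((cmod (a n))\<^sup>2) / of_int \<bar>n\<bar>) = (cmod (a n))\<^sup>2 / \<bar>of_int n\<bar>"
      by (metis Re_complex_of_real of_int_abs of_real_divide of_real_of_int_eq)
    moreover have "Re (- (\<i> * of_int n / 3) * (a (- n) * ?c)) = of_int n / 3 * v"
    proof -
      have "Re (- (\<i> * of_int n / 3) * z) = of_int n / 3 * Im z" for z by (simp add: field_simps)
      then show ?thesis unfolding v_def .
    qed
    ultimately have "Re (cnj (a n) * gal N a n) = of_int n / 3 * v - (cmod (a n))\<^sup>2 / \<bar>of_int n\<bar>"
      by (simp only: minus_complex.sel)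
    moreover have "Im (complex_of_real (of_int n * w n) * a (- n) * ?c) = of_int n * w n * v"
      unfolding v_def by (simp only: mult.assoc[of "complex_of_real (of_int n * w n)"]) simp
    ultimately show ?thesis by (simp only:) (simp add: algebra_simps)
  qed
  then show ?thesis
    unfolding Im_sum sum_distrib_left sum.distrib[symmetric] by (intro sum.cong) auto
qed

lemma abs_Max_diff_le:
  fixes f g :: "'a \<Rightarrow> real"
  assumes "finite A" "A \<noteq> {}" "\<And>x. x \<in> A \<Longrightarrow> \<bar>f x - g x\<bar> \<le> B"
  shows "\<bar>Max (f ` A) - Max (g ` A)\<bar> \<le> B"
proof -
  have "Max (f ` A) \<le> Max (g ` A) + B" if "\<And>x. x \<in> A \<Longrightarrow> \<bar>f x - g x\<bar> \<le> B" for f g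
  proof -
    have "f x \<le> Max (g ` A) + B" if "x \<in> A" for x
    proof -
      have "g x \<le> Max (g ` A)" using that assms(1) by (intro Max_ge) auto
      then show ?thesis using \<open>\<And>x. x \<in> A \<Longrightarrow> \<bar>f x - g x\<bar> \<le> B\<close>[OF that] by linarith
    qed
    then show ?thesis using assms by (subst Max_le_iff) auto
  qed
  from this[of f g] this[of g f] assms(3) show ?thesis by (auto simp: abs_le_iff abs_minus_commute)
qed

text \<open>
  The vector field is precomposed with a radial retraction onto a sup-norm ball to make it globally
  Lipschitz. A retraction by a scalar keeps the \<open>L\<^sup>2\<close> balance, so the solution never leaves the ball.
\<close>

lemma galerkin_exists:
  fixes c :: "int \<Rightarrow> complex"
  assumes N: "N \<ge> 0" and c: "\<And>n. c (- n) = cnj (c n)" "c 0 = 0"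
  obtains a :: "real \<Rightarrow> int \<Rightarrow> complex"
  where "\<And>n. a 0 n = (if n \<in> {-N..N} then c n else 0)"
    and "\<And>t n. t \<ge> 0 \<Longrightarrow> a t (- n) = cnj (a t n)" and "\<And>t. t \<ge> 0 \<Longrightarrow> a t 0 = 0"
    and "\<And>t n. t \<ge> 0 \<Longrightarrow> n \<notin> {-N..N} \<Longrightarrow> a t n = 0"
    and "\<And>t n. t \<ge> 0 \<Longrightarrow> ((\<lambda>s. a s n) has_vector_derivative gal N (a t) n) (at t within {0..})"
proof -
  define I where "I = {-N..N}"
  have I: "finite I" "I \<noteq> {}" "0 \<in> I" "\<And>n. - n \<in> I \<longleftrightarrow> n \<in> I" using N by (auto simp: I_def)
  define y0 where "y0 = (\<Sum>n\<in>I. (cmod (c n))\<^sup>2)"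
  have "y0 \<ge> 0" by (simp add: y0_def sum_nonneg)
  \<comment> \<open>The sup norm is at most the square root of the conserved-or-damped L^2 sum, so a
    trajectory starting with sum y0 stays inside the ball of radius \<rho>, where the retraction is
    the identity.\<close>
  define \<rho> where "\<rho> = sqrt y0 + 1"
  have \<rho>: "\<rho> \<ge> 1" using \<open>y0 \<ge> 0\<close> by (simp add: \<rho>_def)
  \<comment> \<open>Projection onto sequences that are supported in I and conjugate symmetric. The
    energy balance holds only for such sequences, while the Lipschitz bound is wanted for
    all.\<close>
  define sy where "sy = (\<lambda>(a :: int \<Rightarrow> complex) n. if n \<in> I then (a n + cnj (a (- n))) / 2 else 0)"
  define r where "r = (\<lambda>x :: int \<Rightarrow> complex. max \<rho> (Max ((\<lambda>n. cmod (x n)) ` I)))"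
  define \<theta> where "\<theta> = (\<lambda>x. \<rho> / r x)"
  define F where "F = (\<lambda>a. gal N (\<lambda>n. of_real (\<theta> (sy a)) * sy a n))"
  have r: "r x \<ge> \<rho>" for x by (simp add: r_def)
  have \<theta>: "0 < \<theta> x" "\<theta> x \<le> 1" for x using r[of x] \<rho> by (auto simp: \<theta>_def)
  have sy0: "sy x n = 0" if "n \<notin> I" for x n using that by (simp add: sy_def)
  have sy_r: "cmod (sy x n) \<le> r (sy x)" for x n
  proof (cases "n \<in> I")
    case True
    then have "cmod (sy x n) \<le> Max ((\<lambda>n. cmod (sy x n)) ` I)" using I by (intro Max_ge) auto
    then show ?thesis by (simp add: r_def)
  next
    case False
    then show ?thesis using r[of "sy x"] \<rho> by (simp add: sy0)
  qed
  have ret_bd: "cmod (of_real (\<theta> (sy x)) * sy x n) \<le> \<rho>" for x n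
    using sy_r[of x n] r[of "sy x"] \<rho> by (simp add: \<theta>_def norm_mult norm_divide field_simps)
  have ret_lip: "cmod (of_real (\<theta> (sy x)) * sy x n - of_real (\<theta> (sy y)) * sy y n) \<le> 2 * B"
    if B: "\<And>j. cmod (x j - y j) \<le> B" for x y n B
  proof -
    have "0 \<le> B" using B[of 0] norm_ge_zero order_trans by blast
    have sB: "cmod (sy x m - sy y m) \<le> B" for m
    proof (cases "m \<in> I")
      case True
      have "sy x m - sy y m = ((x m - y m) + cnj (x (- m) - y (- m))) / 2"
        using True by (simp add: sy_def field_simps)
      then have "cmod (sy x m - sy y m) = cmod ((x m - y m) + cnj (x (- m) - y (- m))) / 2"
        by (simp only: norm_divide norm_numeral)
      also have "\<dots> \<le> (cmod (x m - y m) + cmod (x (- m) - y (- m))) / 2"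
        using norm_triangle_ineq[of "x m - y m" "cnj (x (- m) - y (- m))"] unfolding complex_mod_cnj
        by (rule divide_right_mono) simp
      also have "\<dots> \<le> B" using B[of m] B[of "- m"] by simp
      finally show ?thesis .
    qed (use \<open>0 \<le> B\<close> in \<open>simp add: sy0\<close>)
    have "\<bar>cmod (sy x m) - cmod (sy y m)\<bar> \<le> B" for m
      using norm_triangle_ineq3[of "sy x m" "sy y m"] sB[of m] by linarith
    then have "\<bar>Max ((\<lambda>n. cmod (sy x n)) ` I) - Max ((\<lambda>n. cmod (sy y n)) ` I)\<bar> \<le> B"
      by (intro abs_Max_diff_le I)
    then have rB: "\<bar>r (sy x) - r (sy y)\<bar> \<le> B" by (auto simp: r_def max_def)
    define p where "p = r (sy x)"
    define q where "q = r (sy y)"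
    have pq: "p \<ge> \<rho>" "q \<ge> \<rho>" "p > 0" "q > 0"
      using r[of "sy x"] r[of "sy y"] \<rho> by (auto simp: p_def q_def)
    \<comment> \<open>The change of the scaling factor is separated from the change of the point.
      The first is at most B because |sy x| <= p and |q - p| <= B; hence the Lipschitz constant
      2.\<close>
    have "of_real (\<theta> (sy x)) * sy x n - of_real (\<theta> (sy y)) * sy y n
      = of_real (\<rho> / q) * (of_real ((q - p) / p) * sy x n + (sy x n - sy y n))"
      using pq by (simp add: \<theta>_def p_def[symmetric] q_def[symmetric] field_simps)
    also have "cmod \<dots> = \<rho> / q * cmod (of_real ((q - p) / p) * sy x n + (sy x n - sy y n))"
      using pq \<rho> by (simp add: norm_mult norm_divide)
    also have "\<dots> \<le> 1 * (B + B)"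
    proof (intro mult_mono norm_triangle_le add_mono sB)
      have "\<bar>q - p\<bar> * (cmod (sy x n) / p) \<le> B * 1"
        using rB sy_r[of x n] pq \<open>0 \<le> B\<close> by (intro mult_mono) (auto simp: p_def q_def abs_minus_commute)
      then show "cmod (of_real ((q - p) / p) * sy x n) \<le> B"
        using pq unfolding norm_mult norm_of_real abs_divide by simp
    qed (use pq \<rho> in auto)
    finally show ?thesis by simp
  qed
  define L where "L = 2 * (of_int N * ((card I)\<^sup>2 * \<rho>\<^sup>2) + 1)"
  define M where "M = of_int N * (\<rho> * (\<Sum>j\<in>I. \<rho>)\<^sup>2) + \<rho>"
  have L: "L > 0" unfolding L_def using N by (simp add: add_nonneg_pos)
  have coef: "cmod (\<i> * of_int n / 3) \<le> of_int N / 3" if "n \<in> I" for n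
  proof -
    have "\<bar>n\<bar> \<le> N" using that by (auto simp: I_def)
    then have "real_of_int \<bar>n\<bar> \<le> of_int N" by linarith
    then show ?thesis by (simp add: norm_mult norm_divide)
  qed
  have gal_lip: "cmod (F x n - F y n) \<le> L * B" if B: "\<And>j. cmod (x j - y j) \<le> B" for x y n B
  proof -
    have "0 \<le> B" using B[of 0] norm_ge_zero order_trans by blast
    let ?u = "\<lambda>n. of_real (\<theta> (sy x)) * sy x n" and ?v = "\<lambda>n. of_real (\<theta> (sy y)) * sy y n"
    show ?thesis
    proof (cases "n \<in> I")
      case True
      have eq: "F x n - F y n = - (\<i> * of_int n / 3) * (conv3 I ?u n - conv3 I ?v n) - (?u n - ?v n) / of_int \<bar>n\<bar>"
        using True unfolding F_def gal_def I_def[symmetric] by (simp add: algebra_simps diff_divide_distrib)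
      have "cmod (F x n - F y n) \<le> cmod (\<i> * of_int n / 3) * cmod (conv3 I ?u n - conv3 I ?v n) + cmod ((?u n - ?v n) / of_int \<bar>n\<bar>)"
        unfolding eq by (rule order_trans[OF norm_triangle_ineq4]) (simp add: norm_mult)
      also have "\<dots> \<le> of_int N / 3 * ((card I)\<^sup>2 * (3 * \<rho>\<^sup>2 * (2 * B))) + 2 * B"
      proof (rule add_mono[OF mult_mono[OF coef[OF True]]])
        show "cmod (conv3 I ?u n - conv3 I ?v n) \<le> (card I)\<^sup>2 * (3 * \<rho>\<^sup>2 * (2 * B))"
        proof (rule cmod_conv3_diff)
          show "cmod (?u m) \<le> \<rho>" "cmod (?v m) \<le> \<rho>" for m using ret_bd by blast+
          show "cmod (?u m - ?v m) \<le> 2 * B" for m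
            by (rule ret_lip[of x y]) (rule B)
        qed (rule I(1))
        show "cmod ((?u n - ?v n) / of_int \<bar>n\<bar>) \<le> 2 * B"
          by (rule order_trans[OF cmod_divide_abs_int_le ret_lip[of x y]]) (rule B)
      qed (use N in auto)
      also have "\<dots> = L * B" by (simp add: L_def algebra_simps)
      finally show ?thesis .
    qed (use L \<open>0 \<le> B\<close> in \<open>auto simp: F_def gal_def I_def\<close>)
  qed
  have gal_bd: "cmod (F x n) \<le> M" for x n
  proof (cases "n \<in> I")
    case True
    let ?u = "\<lambda>n. of_real (\<theta> (sy x)) * sy x n"
    have "cmod (F x n) \<le> cmod (\<i> * of_int n / 3) * cmod (conv3 I ?u n) + cmod (?u n / of_int \<bar>n\<bar>)"
      using True unfolding F_def gal_def I_def[symmetric]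
      by (simp only: if_True) (rule order_trans[OF norm_triangle_ineq4], simp add: norm_mult)
    also have "\<dots> \<le> of_int N / 3 * (\<rho> * (\<Sum>j\<in>I. cmod (?u j))\<^sup>2) + \<rho>"
    proof (rule add_mono[OF mult_mono[OF coef[OF True]]])
      show "cmod (conv3 I ?u n) \<le> \<rho> * (\<Sum>j\<in>I. cmod (?u j))\<^sup>2"
        by (rule cmod_conv3) (use ret_bd I(1) in blast)+
      show "cmod (?u n / of_int \<bar>n\<bar>) \<le> \<rho>"
        using cmod_divide_abs_int_le[of "?u n" n] ret_bd[of x n] by (rule order_trans)
    qed (use N in auto)
    also have "\<dots> \<le> of_int N * (\<rho> * (\<Sum>j\<in>I. \<rho>)\<^sup>2) + \<rho>"
    proof (rule add_right_mono, rule mult_mono[OF _ mult_left_mono[OF power_mono]])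
      show "(\<Sum>j\<in>I. cmod (?u j)) \<le> (\<Sum>j\<in>I. \<rho>)" by (intro sum_mono ret_bd)
    qed (use N \<rho> in \<open>auto intro!: sum_nonneg\<close>)
    finally show ?thesis by (simp add: M_def)
  next
    case False
    then have "F x n = 0" by (auto simp: F_def gal_def I_def)
    moreover have "0 \<le> M" unfolding M_def using N \<rho> by (intro add_nonneg_nonneg mult_nonneg_nonneg) auto
    ultimately show ?thesis by simp
  qed
  obtain a where a0: "a 0 = (\<lambda>n. if n \<in> I then c n else 0)"
    and a': "\<And>t n. t \<ge> 0 \<Longrightarrow> ((\<lambda>s. a s n) has_vector_derivative F (a t) n) (at t within {0..})"
  proof -
    have "\<exists>a. a 0 = (\<lambda>n. if n \<in> I then c n else 0)
      \<and> (\<forall>t\<ge>0. \<forall>n. ((\<lambda>s. a s n) has_vector_derivative F (a t) n) (at t within {0..}))"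
    proof (rule picard_lindelof)
      show "cmod (F x n - F y n) \<le> L * B" if "\<And>j. cmod (x j - y j) \<le> B" for x y B n
        by (rule gal_lip) (rule that)
    qed (rule gal_bd, rule L)
    then show thesis using that by auto
  qed
  \<comment> \<open>Conjugate symmetry, support and zero mean are each propagated by exhibiting a
    quantity with zero time derivative.\<close>
  have const: "g t = g 0" if "\<And>s. s \<ge> 0 \<Longrightarrow> (g has_vector_derivative 0) (at s within {0..})" "t \<ge> 0"
    for g :: "real \<Rightarrow> complex" and t
    using has_vector_derivative_zero_constant[of "{0..}" g] that by (metis atLeast_iff convex_real_interval(1) order_refl)
  have sy_cnj: "sy x (- n) = cnj (sy x n)" for x n using I by (auto simp: sy_def add.commute)
  have F_cnj: "F x (- n) = cnj (F x n)" for x n unfolding F_def by (rule gal_cnj) (simp add: sy_cnj)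
  have a_cnj: "a t (- n) = cnj (a t n)" if "t \<ge> 0" for t n
  proof -
    have "((\<lambda>s. a s (- n) - cnj (a s n)) has_vector_derivative 0) (at s within {0..})" if "s \<ge> 0" for s
      using a'[OF that, of n] a'[OF that, of "- n"]
      by (auto intro!: derivative_eq_intros has_vector_derivative_cnj simp: F_cnj)
    from const[OF this \<open>t \<ge> 0\<close>] show ?thesis using c I by (auto simp: a0 split: if_splits)
  qed
  have a_out: "a t n = 0" if "t \<ge> 0" "n \<notin> I" for t n
  proof -
    have "((\<lambda>s. a s n) has_vector_derivative 0) (at s within {0..})" if "s \<ge> 0" for s
      using a'[OF that, of n] \<open>n \<notin> I\<close> by (auto simp: F_def gal_def I_def split: if_splits)
    from const[OF this \<open>t \<ge> 0\<close>] show ?thesis using that by (simp add: a0)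
  qed
  have F0: "F x 0 = 0" for x by (simp add: F_def gal_def)
  have a_0: "a t 0 = 0" if "t \<ge> 0" for t
  proof -
    have "((\<lambda>s. a s 0) has_vector_derivative 0) (at s within {0..})" if "s \<ge> 0" for s
      using a'[OF that, of 0] F0 by simp
    from const[OF this \<open>t \<ge> 0\<close>] show ?thesis by (simp add: a0 c)
  qed
  have sy_a: "sy (a t) = a t" if "t \<ge> 0" for t
    using a_cnj[OF that] a_out[OF that] by (auto simp: sy_def fun_eq_iff)
  have F_a: "F (a t) = gal N (\<lambda>n. of_real (\<theta> (a t)) * a t n)" if "t \<ge> 0" for t
    using sy_a[OF that] by (simp add: F_def)
  have y_le: "(\<Sum>n\<in>I. (cmod (a t n))\<^sup>2) \<le> y0" if "t \<ge> 0" for t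
  proof -
    have "(\<Sum>n\<in>I. 1 * (cmod (a t n))\<^sup>2) \<le> (\<Sum>n\<in>I. 1 * (cmod (a 0 n))\<^sup>2)"
    proof (rule nonincreasing_on_halfline[OF energy_has_derivative[OF a']])
      fix s :: real assume "0 \<le> s"
      let ?k = "\<theta> (a s)"
      let ?b = "\<lambda>n. of_real ?k * a s n"
      \<comment> \<open>Along the solution F is \<open>gal\<close> evaluated at b = \<theta> a.
        Multiplying the rate by the positive scalar \<theta> turns it into the L^2 balance of b,
        whose flux vanishes.\<close>
      have "?k * (\<Sum>n\<in>I. 1 * (2 * Re (cnj (a s n) * F (a s) n))) = (\<Sum>n\<in>I. 1 * (2 * Re (cnj (?b n) * gal N ?b n)))"
        using F_a[OF \<open>0 \<le> s\<close>] by (simp add: sum_distrib_left algebra_simps)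
      also have "\<dots> = - 2 * (\<Sum>n\<in>I. 1 * (cmod (?b n))\<^sup>2 / \<bar>of_int n\<bar>)
        + 2 / 3 * Im (\<Sum>n\<in>I. complex_of_real (of_int n * 1) * ?b (- n) * conv3 I ?b n)"
        unfolding I_def by (rule energy_rate) (simp add: a_cnj[OF \<open>0 \<le> s\<close>])
      also have "(\<Sum>n\<in>I. complex_of_real (of_int n * 1) * ?b (- n) * conv3 I ?b n) = 0"
        using flux_L2_zero[of N ?b] a_out[OF \<open>0 \<le> s\<close>] by (simp add: I_def)
      finally have "?k * (\<Sum>n\<in>I. 1 * (2 * Re (cnj (a s n) * F (a s) n))) \<le> 0"
        by (simp add: sum_nonneg)
      then show "(\<Sum>n\<in>I. 1 * (2 * Re (cnj (a s n) * F (a s) n))) \<le> 0"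
        using \<theta>(1)[of "a s"] by (simp add: mult_le_0_iff)
    qed (use that in auto)
    then show ?thesis by (simp add: a0 y0_def)
  qed
  have "\<theta> (a t) = 1" if "t \<ge> 0" for t
  proof -
    have "cmod (a t n) \<le> \<rho>" if "n \<in> I" for n
    proof -
      have "(cmod (a t n))\<^sup>2 \<le> (\<Sum>n\<in>I. (cmod (a t n))\<^sup>2)"
        using I that by (intro member_le_sum) auto
      then have "(cmod (a t n))\<^sup>2 \<le> y0" using y_le[OF \<open>t \<ge> 0\<close>] by linarith
      then have "cmod (a t n) \<le> sqrt y0" by (rule real_le_rsqrt)
      then show ?thesis by (simp add: \<rho>_def)
    qed
    then have "Max ((\<lambda>n. cmod (a t n)) ` I) \<le> \<rho>" using I by (subst Max_le_iff) auto
    then show ?thesis using \<rho> by (simp add: \<theta>_def r_def)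
  qed
  then have "((\<lambda>s. a s n) has_vector_derivative gal N (a t) n) (at t within {0..})" if "t \<ge> 0" for t n
    using a'[OF that, of n] F_a[OF that] that by simp
  with a0 a_cnj a_0 a_out show thesis
    by (intro that[of a]) (auto simp: I_def)
qed

section \<open>Estimates for Galerkin solutions, uniform in the truncation\<close>

lemma sum_inverse_squares_le: "(\<Sum>n\<in>{-N..N::int}. 1 / (real_of_int n)\<^sup>2) \<le> 4"
proof -
  \<comment> \<open>The correction 2 / m makes the induction telescope through 1 / (m + 1)^2 <= 1 /
    m - 1 / (m + 1). At m = 0 and at the mode n = 0 the quotients are 0, which is why the first step
    is treated separately.\<close>
  have "(\<Sum>n\<in>{-int m..int m}. 1 / (real_of_int n)\<^sup>2) \<le> 4 - 2 / m" for m :: nat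
  proof (induction m)
    case (Suc m)
    have "{-int (Suc m)..int (Suc m)} = insert (int (Suc m)) (insert (- int (Suc m)) {-int m..int m})"
      by auto
    then have eq: "(\<Sum>n\<in>{-int (Suc m)..int (Suc m)}. 1 / (real_of_int n)\<^sup>2)
      = 2 / (real (Suc m))\<^sup>2 + (\<Sum>n\<in>{-int m..int m}. 1 / (real_of_int n)\<^sup>2)"
      by (simp del: of_nat_Suc)
    show ?case
    proof (cases "m = 0")
      case True
      then show ?thesis using eq by simp
    next
      case False
      then have "1 / real m - 1 / real (Suc m) = 1 / (real m * real (Suc m))" by (simp add: field_simps)
      moreover have "1 / (real (Suc m))\<^sup>2 \<le> 1 / (real m * real (Suc m))"
        unfolding power2_eq_square by (intro divide_left_mono mult_right_mono) (use False in auto)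
      ultimately have "1 / (real (Suc m))\<^sup>2 \<le> 1 / real m - 1 / real (Suc m)" by simp
      then show ?thesis unfolding eq using Suc by simp
    qed
  qed simp
  from this[of "nat N"] show ?thesis
  proof (cases "N \<ge> 0")
    case True
    have "0 \<le> 2 / real_of_int N" using True by simp
    moreover have "(\<Sum>n\<in>{-N..N}. 1 / (real_of_int n)\<^sup>2) \<le> 4 - 2 / of_int N"
      using \<open>(\<Sum>n\<in>{-int (nat N)..int (nat N)}. _ n) \<le> _\<close> True by simp
    ultimately show ?thesis by linarith
  qed simp
qed

text \<open>Cauchy-Schwarz after writing |n| b(n) as (1 / |n|) (n^2 b(n)): the H^2 norm controls the
  absolute sum of the coefficients of the derivative.\<close>

lemma sum_abs_le_H2:
  fixes b :: "int \<Rightarrow> real"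
  shows "(\<Sum>n\<in>{-N..N}. \<bar>of_int n\<bar> * b n)\<^sup>2 \<le> 4 * (\<Sum>n\<in>{-N..N}. (of_int n) ^ 4 * (b n)\<^sup>2)"
proof -
  have "(\<Sum>n\<in>{-N..N}. \<bar>of_int n\<bar> * b n)\<^sup>2 = (\<Sum>n\<in>{-N..N}. 1 / \<bar>of_int n\<bar> * ((of_int n)\<^sup>2 * b n))\<^sup>2"
  proof -
    have "\<bar>of_int n\<bar> * b n = 1 / \<bar>of_int n\<bar> * ((of_int n)\<^sup>2 * b n)" for n :: int
      by (cases "n = 0") (simp_all add: power2_eq_square abs_if)
    then show ?thesis by simp
  qed
  also have "\<dots> \<le> (\<Sum>n\<in>{-N..N}. (1 / \<bar>of_int n\<bar>)\<^sup>2) * (\<Sum>n\<in>{-N..N}. ((of_int n)\<^sup>2 * b n)\<^sup>2)"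
    by (rule Cauchy_Schwarz_ineq_sum)
  also have "\<dots> = (\<Sum>n\<in>{-N..N}. 1 / (of_int n)\<^sup>2) * (\<Sum>n\<in>{-N..N}. (of_int n) ^ 4 * (b n)\<^sup>2)"
    by (simp add: power_divide power_mult_distrib)
  also have "\<dots> \<le> 4 * (\<Sum>n\<in>{-N..N}. (of_int n) ^ 4 * (b n)\<^sup>2)"
    by (intro mult_right_mono sum_inverse_squares_le sum_nonneg) auto
  finally show ?thesis .
qed

text \<open>The pointwise comparison of weights is requested only where x n is nonzero. The zero
  mode, where \<open>1 / |n|\<close> evaluates to 0, thus drops out.\<close>

lemma sum_interpolate:
  fixes w v u x :: "int \<Rightarrow> real"
  assumes "\<And>n. n \<in> I \<Longrightarrow> x n \<noteq> 0 \<Longrightarrow> w n \<le> A * v n + B * u n" "\<And>n. x n \<ge> 0"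
  shows "(\<Sum>n\<in>I. w n * x n) \<le> A * (\<Sum>n\<in>I. v n * x n) + B * (\<Sum>n\<in>I. u n * x n)"
proof -
  have "w n * x n \<le> A * (v n * x n) + B * (u n * x n)" if "n \<in> I" for n
  proof (cases "x n = 0")
    case False
    then have "w n * x n \<le> (A * v n + B * u n) * x n" using assms that by (intro mult_right_mono) auto
    then show ?thesis by (simp add: algebra_simps)
  qed simp
  then show ?thesis unfolding sum_distrib_left sum.distrib[symmetric] by (intro sum_mono)
qed

text \<open>The bound in \<open>small\<close> is half of the bootstrap threshold \<open>d0\<close>;
  the other half pays for the growth factor exp(1/2).\<close>

locale galerkin =
  fixes N :: int and a :: "real \<Rightarrow> int \<Rightarrow> complex"
  assumes cnj: "\<And>t n. t \<ge> 0 \<Longrightarrow> a t (- n) = cnj (a t n)" and a_zero: "\<And>t. t \<ge> 0 \<Longrightarrow> a t 0 = 0"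
    and supp: "\<And>t n. t \<ge> 0 \<Longrightarrow> n \<notin> {-N..N} \<Longrightarrow> a t n = 0"
    and deriv: "\<And>t n. t \<ge> 0 \<Longrightarrow> ((\<lambda>s. a s n) has_vector_derivative gal N (a t) n) (at t within {0..})"
    and small: "(\<Sum>n\<in>{-N..N}. (of_int n) ^ 6 * (cmod (a 0 n))\<^sup>2) \<le> 1 / (2 * 10 ^ 10)"
begin

definition en :: "(int \<Rightarrow> real) \<Rightarrow> real \<Rightarrow> real" where
  "en w t = (\<Sum>n\<in>{-N..N}. w n * (cmod (a t n))\<^sup>2)"

definition rate :: "(int \<Rightarrow> real) \<Rightarrow> real \<Rightarrow> real" where
  "rate w t = (\<Sum>n\<in>{-N..N}. w n * (2 * Re (cnj (a t n) * gal N (a t) n)))"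

lemma en_deriv: "t \<ge> 0 \<Longrightarrow> (en w has_real_derivative rate w t) (at t within {0..})"
  unfolding en_def rate_def by (rule energy_has_derivative[OF deriv])

lemma en_nonneg: "(\<And>n. w n \<ge> 0) \<Longrightarrow> en w t \<ge> 0"
  unfolding en_def by (intro sum_nonneg mult_nonneg_nonneg) auto

lemma rate_L2:
  assumes "t \<ge> 0"
  shows "rate (\<lambda>_. 1) t = - 2 * en (\<lambda>n. 1 / \<bar>of_int n\<bar>) t"
proof -
  have "(\<Sum>n\<in>{-N..N}. complex_of_real (of_int n * 1) * a t (- n) * conv3 {-N..N} (a t) n) = 0"
    using flux_L2_zero[where a = "a t" and N = N] supp[OF assms] by simp
  moreover have "rate (\<lambda>_. 1) t = - 2 * (\<Sum>n\<in>{-N..N}. 1 * (cmod (a t n))\<^sup>2 / \<bar>of_int n\<bar>)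
      + 2 / 3 * Im (\<Sum>n\<in>{-N..N}. complex_of_real (of_int n * 1) * a t (- n) * conv3 {-N..N} (a t) n)"
    unfolding rate_def by (rule energy_rate) (rule cnj[OF assms])
  ultimately show ?thesis by (simp only: en_def) simp
qed

lemma sum_cmod_le:
  assumes "t \<ge> 0"
  shows "(\<Sum>n\<in>{-N..N}. cmod (a t n)) \<le> (\<Sum>n\<in>{-N..N}. \<bar>of_int n\<bar> * cmod (a t n))"
  using le_abs_int_power_mult[of "cmod (a t n)" n 1 for n] by (intro sum_mono) (simp add: a_zero assms)

text \<open>The damping has a favourable sign for every nonnegative weight and is dropped. Without
  zero mode the plain coefficient sum is at most the sum with a factor |n|, whose square is at most
  four times the H^2 energy; so 320000 = (2/3) * 120000 * 4.\<close>

lemma rate_wt: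
  assumes "t \<ge> 0" "R > 0"
  shows "rate (\<lambda>n. wt R n) t \<le> 320000 * en (\<lambda>n. (of_int n) ^ 4) t * en (\<lambda>n. wt R n) t"
proof -
  let ?I = "{-N..N}"
  let ?S = "\<Sum>n\<in>?I. complex_of_real (of_int n * wt R n) * a t (- n) * conv3 ?I (a t) n"
  let ?A = "\<Sum>n\<in>?I. \<bar>of_int n\<bar> * cmod (a t n)" and ?B = "\<Sum>n\<in>?I. cmod (a t n)"
  have E: "en (\<lambda>n. wt R n) t \<ge> 0" by (intro en_nonneg wt_nonneg assms)
  have "rate (\<lambda>n. wt R n) t = - 2 * (\<Sum>n\<in>?I. wt R n * (cmod (a t n))\<^sup>2 / \<bar>of_int n\<bar>) + 2 / 3 * Im ?S"
    unfolding rate_def by (rule energy_rate) (use cnj assms in auto)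
  also have "\<dots> \<le> 2 / 3 * Im ?S"
    using wt_nonneg[OF assms(2)] by (simp add: sum_nonneg)
  also have "\<dots> \<le> 2 / 3 * cmod ?S" by (rule mult_left_mono[OF order_trans[OF abs_ge_self abs_Im_le_cmod]]) simp
  also have "\<dots> \<le> 2 / 3 * (120000 * (en (\<lambda>n. wt R n) t * ?A * ?B))"
    unfolding en_def by (intro mult_left_mono flux_wt_le supp assms) auto
  also have "\<dots> = 80000 * en (\<lambda>n. wt R n) t * (?A * ?B)" by simp
  also have "\<dots> \<le> 80000 * en (\<lambda>n. wt R n) t * (4 * en (\<lambda>n. (of_int n) ^ 4) t)"
  proof (intro mult_left_mono)
    have "?B \<le> ?A" by (rule sum_cmod_le[OF assms(1)])
    then have "?A * ?B \<le> ?A\<^sup>2" unfolding power2_eq_square by (intro mult_left_mono sum_nonneg) auto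
    also have "\<dots> \<le> 4 * en (\<lambda>n. (of_int n) ^ 4) t" unfolding en_def by (rule sum_abs_le_H2)
    finally show "?A * ?B \<le> 4 * en (\<lambda>n. (of_int n) ^ 4) t" .
  qed (use E in auto)
  finally show ?thesis by (simp add: mult.commute mult.left_commute)
qed

abbreviation "d0 \<equiv> 1 / 10 ^ 10 :: real"
abbreviation "L2e \<equiv> en (\<lambda>_. 1)"
abbreviation "H2e \<equiv> en (\<lambda>n. (of_int n) ^ 4)"
abbreviation "H3e \<equiv> en (\<lambda>n. (of_int n) ^ 6)"

lemma L2e_le_H3e: "t \<ge> 0 \<Longrightarrow> L2e t \<le> H3e t"
  using le_abs_int_power_mult[of "(cmod (a t n))\<^sup>2" n 6 for n]
  unfolding en_def by (intro sum_mono) (simp add: a_zero power_even_abs)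

lemma L2_decay_conditional:
  assumes "0 \<le> T" "\<And>s. 0 \<le> s \<Longrightarrow> s \<le> T \<Longrightarrow> H3e s \<le> d0"
  shows "L2e T \<le> 13000 * d0 / (1 + T) ^ 6"
proof (rule power_decay[OF en_deriv])
  fix t assume t: "0 \<le> t" "t \<le> T"
  \<comment> \<open>Chosen so that 2 / \<rho> = 7 / (1 + t). A damping coefficient above 6 is what
    the decay (1 + t)^-6 requires, and with 7 the forcing of order (1 + t)^-7 integrates exactly as
    in \<open>power_decay\<close>.\<close>
  define \<rho> where "\<rho> = 2 / 7 * (1 + t)"
  have \<rho>: "\<rho> > 0" using t by (simp add: \<rho>_def)
  have "L2e t \<le> \<rho> * en (\<lambda>n. 1 / \<bar>of_int n\<bar>) t + (1 / \<rho> ^ 6) * H3e t"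
    unfolding en_def
  proof (rule sum_interpolate)
    fix n assume "(cmod (a t n))\<^sup>2 \<noteq> 0"
    then have "n \<noteq> 0" using a_zero t by auto
    show "1 \<le> \<rho> * (1 / \<bar>of_int n\<bar>) + (1 / \<rho> ^ 6) * of_int n ^ 6"
    proof (cases "\<bar>of_int n\<bar> \<le> \<rho>")
      case True
      then have "1 \<le> \<rho> * (1 / \<bar>of_int n\<bar>)" using \<open>n \<noteq> 0\<close> by simp
      then show ?thesis using \<rho> by (simp add: add_increasing2)
    next
      case False
      then have "\<rho> ^ 6 \<le> \<bar>of_int n\<bar> ^ 6" using \<rho> by (intro power_mono) auto
      then have "1 \<le> (1 / \<rho> ^ 6) * of_int n ^ 6" using \<rho> by (simp add: power_even_abs)
      then show ?thesis using \<rho> by (simp add: add_increasing)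
    qed
  qed auto
  also have "\<dots> \<le> \<rho> * en (\<lambda>n. 1 / \<bar>of_int n\<bar>) t + (1 / \<rho> ^ 6) * d0"
    using assms(2) t \<rho> by (intro add_left_mono mult_left_mono) auto
  finally have "2 / \<rho> * L2e t \<le> 2 / \<rho> * (\<rho> * en (\<lambda>n. 1 / \<bar>of_int n\<bar>) t + (1 / \<rho> ^ 6) * d0)"
    using \<rho> by (intro mult_left_mono) auto
  also have "\<dots> = 2 * en (\<lambda>n. 1 / \<bar>of_int n\<bar>) t + 2 * d0 / \<rho> ^ 7"
  proof -
    have "\<rho> ^ 7 = \<rho> * \<rho> ^ 6" by (simp add: eval_nat_numeral)
    then show ?thesis using \<rho> by (simp add: distrib_left)
  qed
  also have "2 * d0 / \<rho> ^ 7 = 2 * d0 / (2 / 7) ^ 7 / (1 + t) ^ 7"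
    by (simp only: \<rho>_def power_mult_distrib) simp
  \<comment> \<open>2 * (7/2)^7 is about 12868.\<close>
  also have "\<dots> \<le> 13000 * d0 / (1 + t) ^ 7"
    using t by (intro divide_right_mono) (auto simp: power_divide)
  finally have "2 / \<rho> * L2e t \<le> 2 * en (\<lambda>n. 1 / \<bar>of_int n\<bar>) t + 13000 * d0 / (1 + t) ^ 7" by simp
  moreover have "2 / \<rho> = 7 / (1 + t)" using t by (simp add: \<rho>_def field_simps)
  ultimately show "rate (\<lambda>_. 1) t \<le> - 7 / (1 + t) * L2e t + 13000 * d0 / (1 + t) ^ 7"
    using rate_L2 t by simp
next
  show "L2e 0 \<le> 13000 * d0" using L2e_le_H3e[of 0] assms(2)[of 0] assms(1) by simp
qed (use assms in auto)

text \<open>Frequencies are split at 1 + T. Below, n^4 <= (1 + T)^4 meets the decay (1 + T)^-6 of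
  the L^2 energy; above, n^4 <= n^6 / (1 + T)^2 meets the bounded H^3 energy. Both give (1 + T)^-2,
  and 13001 = 13000 + 1.\<close>

lemma H2_decay_conditional:
  assumes "0 \<le> T" "\<And>s. 0 \<le> s \<Longrightarrow> s \<le> T \<Longrightarrow> H3e s \<le> d0"
  shows "H2e T \<le> 13001 * d0 / (1 + T)\<^sup>2"
proof -
  define \<rho> where "\<rho> = 1 + T"
  have \<rho>: "\<rho> > 0" using assms by (simp add: \<rho>_def)
  have "H2e T \<le> \<rho> ^ 4 * L2e T + (1 / \<rho>\<^sup>2) * H3e T"
    unfolding en_def
  proof (rule sum_interpolate)
    fix n :: int
    show "of_int n ^ 4 \<le> \<rho> ^ 4 * 1 + (1 / \<rho>\<^sup>2) * of_int n ^ 6"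
    proof (cases "\<bar>of_int n\<bar> \<le> \<rho>")
      case True
      then have "\<bar>of_int n\<bar> ^ 4 \<le> \<rho> ^ 4" by (intro power_mono) auto
      then show ?thesis using \<rho> by (simp add: power_even_abs add_increasing2)
    next
      case False
      then have "\<rho>\<^sup>2 \<le> \<bar>of_int n\<bar>\<^sup>2" using \<rho> by (intro power_mono) auto
      then have "of_int n ^ 4 * \<rho>\<^sup>2 \<le> of_int n ^ 4 * (of_int n)\<^sup>2" by (intro mult_left_mono) auto
      then have "of_int n ^ 4 \<le> (1 / \<rho>\<^sup>2) * of_int n ^ 6" using \<rho> by (simp add: field_simps flip: power_add)
      then show ?thesis using \<rho> by (simp add: add_increasing)
    qed
  qed auto
  also have "\<dots> \<le> \<rho> ^ 4 * (13000 * d0 / \<rho> ^ 6) + (1 / \<rho>\<^sup>2) * d0"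
    using L2_decay_conditional[OF assms] assms \<rho>
    by (intro add_mono mult_left_mono) (auto simp: \<rho>_def)
  also have "\<rho> ^ 4 * (13000 * d0 / \<rho> ^ 6) = 13000 * d0 / \<rho>\<^sup>2"
    using \<rho> by (simp add: eval_nat_numeral field_simps)
  finally show ?thesis by (simp add: \<rho>_def)
qed

lemma wt_gronwall_conditional:
  assumes "0 \<le> T" "\<And>s. 0 \<le> s \<Longrightarrow> s \<le> T \<Longrightarrow> H3e s \<le> d0" "R > 0"
  shows "en (\<lambda>n. wt R n) T \<le> exp (1 / 2) * en (\<lambda>n. wt R n) 0"
proof (rule gronwall_inverse_square[OF en_deriv])
  fix t assume t: "0 \<le> t" "t \<le> T"
  have "rate (\<lambda>n. wt R n) t \<le> 320000 * H2e t * en (\<lambda>n. wt R n) t"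
    by (rule rate_wt) (use t assms in auto)
  also have "\<dots> \<le> (1 / 2) / (1 + t)\<^sup>2 * en (\<lambda>n. wt R n) t"
  proof (intro mult_right_mono en_nonneg wt_nonneg assms)
    \<comment> \<open>Here the size of \<open>d0\<close> is decided: 320000 * 13001 = 4160320000 is
      less than 10^10 / 2.\<close>
    have "320000 * H2e t \<le> 320000 * (13001 * d0 / (1 + t)\<^sup>2)"
      using H2_decay_conditional[of t] t assms by (intro mult_left_mono) auto
    also have "\<dots> \<le> (1 / 2) / (1 + t)\<^sup>2" using t by (simp add: field_simps)
    finally show "320000 * H2e t \<le> (1 / 2) / (1 + t)\<^sup>2" .
  qed
  finally show "rate (\<lambda>n. wt R n) t \<le> (1 / 2) / (1 + t)\<^sup>2 * en (\<lambda>n. wt R n) t" .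
qed (use assms in \<open>auto intro: en_nonneg wt_nonneg\<close>)

lemma exp_half_less: "exp (1 / 2) < (2 :: real)"
proof -
  have "exp (1 / 2 :: real) \<le> 1 + 1 / 2 + (1 / 2)\<^sup>2" by (rule exp_bound) auto
  then show ?thesis by (simp add: power2_eq_square)
qed

text \<open>At R = 1 the weighted energy is the H^3 energy, so the conditional growth bound improves
  H3e <= d0 to H3e <= exp(1/2) * d0 / 2 < d0, and the bootstrap closes.\<close>

lemma H3_bound:
  assumes "t \<ge> 0"
  shows "H3e t \<le> d0"
proof -
  have "H3e t < d0"
  proof (rule continuous_bootstrap[OF _ _ _ assms])
    show "continuous_on {0..} H3e" by (rule DERIV_continuous_on, rule en_deriv) simp
    show "H3e 0 < d0" using small by (simp add: en_def)
    fix t assume "0 \<le> t" "\<And>s. 0 \<le> s \<Longrightarrow> s \<le> t \<Longrightarrow> H3e s \<le> d0"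
    from wt_gronwall_conditional[OF this, of 1] have "H3e t \<le> exp (1 / 2) * H3e 0" by (simp add: wt_1)
    also have "\<dots> \<le> exp (1 / 2) * (1 / (2 * 10 ^ 10))" using small by (intro mult_left_mono) (auto simp: en_def)
    also have "\<dots> < d0" using exp_half_less by simp
    finally show "H3e t < d0" .
  qed
  then show ?thesis by simp
qed

lemma wt_bound:
  assumes "t \<ge> 0" "R > 0"
  shows "en (\<lambda>n. wt R n) t \<le> 2 * en (\<lambda>n. wt R n) 0"
proof -
  have "en (\<lambda>n. wt R n) t \<le> exp (1 / 2) * en (\<lambda>n. wt R n) 0"
    by (rule wt_gronwall_conditional) (use assms H3_bound in auto)
  also have "\<dots> \<le> 2 * en (\<lambda>n. wt R n) 0"
    using exp_half_less by (intro mult_right_mono en_nonneg wt_nonneg assms) auto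
  finally show ?thesis .
qed

lemma L2_decay:
  assumes "t \<ge> 0"
  shows "L2e t \<le> 1 / (1 + t) ^ 6"
proof -
  have "L2e t \<le> 13000 * d0 / (1 + t) ^ 6"
    by (rule L2_decay_conditional) (use assms H3_bound in auto)
  also have "\<dots> \<le> 1 / (1 + t) ^ 6" using assms by (intro divide_right_mono) auto
  finally show ?thesis .
qed

lemma coeff_bound:
  assumes "t \<ge> 0"
  shows "\<bar>of_int n\<bar> ^ 3 * cmod (a t n) \<le> 1"
proof (cases "n \<in> {-N..N}")
  case True
  have "(\<bar>of_int n\<bar> ^ 3 * cmod (a t n))\<^sup>2 = of_int n ^ 6 * (cmod (a t n))\<^sup>2"
    by (simp add: power_mult_distrib flip: power_mult)
  also have "\<dots> \<le> H3e t" unfolding en_def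
    by (rule member_le_sum[of n "{-N..N}" "\<lambda>n. of_int n ^ 6 * (cmod (a t n))\<^sup>2"]) (use True in auto)
  also have "\<dots> \<le> 1\<^sup>2" using H3_bound[OF assms] by (rule order_trans) simp
  finally show ?thesis by (rule power2_le_imp_le) simp
qed (use supp assms in simp)

text \<open>The bound is independent of N: for each fixed mode the approximations are equi-Lipschitz
  in time, which provides both compactness and the majorant for the limit of the integrated
  equation.\<close>

lemma deriv_bound:
  assumes "t \<ge> 0"
  shows "cmod (gal N (a t) n) \<le> \<bar>of_int n\<bar> + 1"
proof (cases "n \<in> {-N..N}")
  case True
  have le1: "cmod (a t n) \<le> 1" for n
    using le_abs_int_power_mult[of "cmod (a t n)" n 3] coeff_bound[OF assms, of n] a_zero[OF assms] by force
  have "(\<Sum>n\<in>{-N..N}. cmod (a t n)) \<le> (\<Sum>n\<in>{-N..N}. \<bar>of_int n\<bar> * cmod (a t n))"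
    by (rule sum_cmod_le[OF assms])
  then have "(\<Sum>n\<in>{-N..N}. cmod (a t n))\<^sup>2 \<le> (\<Sum>n\<in>{-N..N}. \<bar>of_int n\<bar> * cmod (a t n))\<^sup>2"
    by (intro power_mono sum_nonneg) auto
  also have "\<dots> \<le> 4 * H2e t" unfolding en_def by (rule sum_abs_le_H2)
  also have "\<dots> \<le> 4 * (13001 * d0 / (1 + t)\<^sup>2)" using H2_decay_conditional[OF assms H3_bound] by simp
  also have "\<dots> \<le> 4 * (13001 * d0 / 1)"
    using assms by (intro mult_left_mono divide_left_mono) (auto simp: one_le_power)
  also have "\<dots> \<le> 1" by simp
  finally have B: "(\<Sum>n\<in>{-N..N}. cmod (a t n))\<^sup>2 \<le> 1" .
  have "cmod (gal N (a t) n) \<le> cmod (\<i> * of_int n / 3) * cmod (conv3 {-N..N} (a t) n) + cmod (a t n / of_int \<bar>n\<bar>)"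
    using True unfolding gal_def
    by (simp only: if_True) (rule order_trans[OF norm_triangle_ineq4], simp add: norm_mult)
  also have "\<dots> \<le> \<bar>of_int n\<bar> * 1 + 1"
  proof (intro add_mono mult_mono)
    show "cmod (\<i> * of_int n / 3) \<le> \<bar>of_int n\<bar>" by (simp add: norm_mult norm_divide)
    show "cmod (conv3 {-N..N} (a t) n) \<le> 1"
      using cmod_conv3[of "a t" 1 "{-N..N}" n] le1 B by simp
    show "cmod (a t n / of_int \<bar>n\<bar>) \<le> 1" by (rule order_trans[OF cmod_divide_abs_int_le le1])
  qed auto
  finally show ?thesis by simp
qed (auto simp: gal_def)

end

section \<open>Passage to the limit\<close>

text \<open>By the M-test the finite partial sums converge uniformly on the parameters where the
  majorant holds, so the two limits may be exchanged. A general filter allows use both along a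
  sequence of approximations and as time varies.\<close>

lemma infsum_dominated:
  fixes f :: "'i \<Rightarrow> 'n \<Rightarrow> complex"
  assumes lim: "\<And>x. x \<in> X \<Longrightarrow> (f x \<longlongrightarrow> g x) F"
    and bd: "\<forall>\<^sub>F n in F. \<forall>x\<in>X. cmod (f x n) \<le> M x" and M: "M summable_on X" and "F \<noteq> bot"
  shows "((\<lambda>n. \<Sum>\<^sub>\<infinity>x\<in>X. f x n) \<longlongrightarrow> (\<Sum>\<^sub>\<infinity>x\<in>X. g x)) F"
proof (rule swap_uniform_limit')
  let ?Y = "{n. \<forall>x\<in>X. cmod (f x n) \<le> M x}"
  show "uniform_limit ?Y (\<lambda>Z n. \<Sum>x\<in>Z. f x n) (\<lambda>n. \<Sum>\<^sub>\<infinity>x\<in>X. f x n) (finite_subsets_at_top X)"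
    by (rule Weierstrass_m_test_general[OF _ M]) auto
  show "\<forall>\<^sub>F n in F. n \<in> ?Y" using bd by simp
  have "cmod (g x) \<le> M x" if "x \<in> X" for x
  proof (rule tendsto_upperbound)
    show "((\<lambda>n. cmod (f x n)) \<longlongrightarrow> cmod (g x)) F" by (intro tendsto_norm lim that)
    show "\<forall>\<^sub>F n in F. cmod (f x n) \<le> M x" using bd by eventually_elim (use that in auto)
  qed (rule \<open>F \<noteq> bot\<close>)
  then have "(\<lambda>x. cmod (g x)) summable_on X"
    by (intro summable_on_comparison_test[OF M]) auto
  then have "g summable_on X" by (rule abs_summable_summable)
  then show "((\<lambda>Z. \<Sum>x\<in>Z. g x) \<longlongrightarrow> (\<Sum>\<^sub>\<infinity>x\<in>X. g x)) (finite_subsets_at_top X)"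
    using has_sum_infsum unfolding has_sum_def by blast
  show "\<forall>\<^sub>F Z in finite_subsets_at_top X. ((\<lambda>n. \<Sum>x\<in>Z. f x n) \<longlongrightarrow> (\<Sum>x\<in>Z. g x)) F"
    unfolding eventually_finite_subsets_at_top by (auto intro!: exI[of _ "{}"] tendsto_sum lim)
qed simp

lemma summable_inverse_squares: "(\<lambda>n::int. 1 / (real_of_int n)\<^sup>2) summable_on UNIV"
proof (rule nonneg_bdd_above_summable_on)
  show "bdd_above (sum (\<lambda>n. 1 / (real_of_int n)\<^sup>2) ` {F. F \<subseteq> UNIV \<and> finite F})"
  proof (rule bdd_aboveI[of _ 4], clarify)
    fix F :: "int set" assume F: "finite F"
    define N where "N = Max (insert 0 (abs ` F))"
    have "\<bar>n\<bar> \<le> N" if "n \<in> F" for n unfolding N_def using F that by (intro Max_ge) auto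
    then have "F \<subseteq> {-N..N}" by (auto simp: abs_le_iff minus_le_iff)
    then have "sum (\<lambda>n. 1 / (real_of_int n)\<^sup>2) F \<le> (\<Sum>n\<in>{-N..N}. 1 / (real_of_int n)\<^sup>2)"
      by (intro sum_mono2) auto
    also have "\<dots> \<le> 4" by (rule sum_inverse_squares_le)
    finally show "sum (\<lambda>n. 1 / (real_of_int n)\<^sup>2) F \<le> 4" .
  qed
qed auto

text \<open>The pointwise consequence of the H^3 bound. Its value at n = 0 is 0 by division by zero,
  so domination by it also encodes zero mean.\<close>

definition cube_decay :: "int \<Rightarrow> real" where
  "cube_decay n = 1 / \<bar>of_int n\<bar> ^ 3"

lemma cube_decay_nonneg: "0 \<le> cube_decay n"
  by (simp add: cube_decay_def)

lemma abs_times_cube_decay: "\<bar>of_int n\<bar> * cube_decay n = 1 / (of_int n)\<^sup>2"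
  by (cases "n = 0") (simp_all add: cube_decay_def power3_eq_cube power2_eq_square abs_if)

lemma cube_decay_le: "cube_decay n \<le> 1 / (of_int n)\<^sup>2"
proof (cases "n = 0")
  case False
  then have "1 \<le> \<bar>real_of_int n\<bar>" by linarith
  then have "1 * cube_decay n \<le> \<bar>of_int n\<bar> * cube_decay n"
    by (intro mult_right_mono cube_decay_nonneg) auto
  then show ?thesis by (simp add: abs_times_cube_decay)
qed (simp add: cube_decay_def)

lemma cube_decay_le_1: "cube_decay n \<le> 1"
proof (cases "n = 0")
  case False
  then have "1 \<le> \<bar>real_of_int n\<bar>" by linarith
  then have "1 \<le> \<bar>real_of_int n\<bar> ^ 3" by (rule one_le_power)
  then show ?thesis using False by (simp add: cube_decay_def divide_le_eq_1)
qed (simp add: cube_decay_def)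

lemma summable_cube_decay: "cube_decay summable_on UNIV"
  by (rule summable_on_comparison_test[OF summable_inverse_squares]) (auto simp: cube_decay_le cube_decay_nonneg)

lemma summable_on_product_nonneg:
  fixes f :: "'a \<Rightarrow> real" and g :: "'b \<Rightarrow> real"
  assumes "f summable_on UNIV" "g summable_on UNIV" "\<And>x. f x \<ge> 0" "\<And>y. g y \<ge> 0"
  shows "(\<lambda>(x, y). f x * g y) summable_on UNIV"
proof -
  have "(\<lambda>(x, y). f x * g y) summable_on (UNIV \<times> UNIV)"
  proof (rule summable_on_SigmaI)
    show "((\<lambda>y. (\<lambda>(x, y). f x * g y) (x, y)) has_sum f x * infsum g UNIV) UNIV" for x
      using has_sum_cmult_right[OF has_sum_infsum[OF assms(2)], of "f x"] by simp
    show "(\<lambda>x. f x * infsum g UNIV) summable_on UNIV" by (intro summable_on_cmult_left assms)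
  qed (use assms in auto)
  then show ?thesis by simp
qed

definition cconv :: "(int \<Rightarrow> complex) \<Rightarrow> int \<Rightarrow> complex" where
  "cconv b n = (\<Sum>\<^sub>\<infinity>(j, k)\<in>UNIV. b j * b k * b (n - j - k))"

lemma cmod_le_cube_decay:
  assumes "\<bar>of_int n\<bar> ^ 3 * cmod z \<le> 1" "n = 0 \<Longrightarrow> z = 0"
  shows "cmod z \<le> cube_decay n"
  using assms by (cases "n = 0") (auto simp: cube_decay_def field_simps)

text \<open>Two of the factors supply a summable majorant on the pairs (j, k); the third is only
  bounded by 1.\<close>

lemma cconv_tendsto:
  assumes "\<And>n. ((\<lambda>m. b m n) \<longlongrightarrow> c n) F" "\<forall>\<^sub>F m in F. \<forall>n. cmod (b m n) \<le> cube_decay n" "F \<noteq> bot"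
  shows "((\<lambda>m. cconv (b m) n) \<longlongrightarrow> cconv c n) F"
  unfolding cconv_def
proof (rule infsum_dominated)
  show "((\<lambda>m. case x of (j, k) \<Rightarrow> b m j * b m k * b m (n - j - k)) \<longlongrightarrow>
      (case x of (j, k) \<Rightarrow> c j * c k * c (n - j - k))) F" for x
    by (auto split: prod.split intro!: tendsto_intros assms)
  show "\<forall>\<^sub>F m in F. \<forall>x\<in>UNIV. cmod (case x of (j, k) \<Rightarrow> b m j * b m k * b m (n - j - k))
      \<le> (\<lambda>(j, k). cube_decay j * cube_decay k) x"
    using assms(2)
  proof eventually_elim
    case (elim m)
    have "cmod (b m j * b m k * b m (n - j - k)) \<le> cube_decay j * cube_decay k * 1" for j k
      unfolding norm_mult
      by (intro mult_mono elim[rule_format] order_trans[OF elim[rule_format] cube_decay_le_1] mult_nonneg_nonneg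
          norm_ge_zero cube_decay_nonneg)
    then show ?case by auto
  qed
  show "(\<lambda>(j, k). cube_decay j * cube_decay k) summable_on UNIV"
    by (intro summable_on_product_nonneg summable_cube_decay cube_decay_nonneg)
qed fact

lemma conv3_eq_cconv:
  assumes "\<And>n. n \<notin> {-N..N} \<Longrightarrow> b n = 0"
  shows "conv3 {-N..N} b n = cconv b n"
proof -
  have supp': "- N \<le> n \<and> n \<le> N" if "b n \<noteq> 0" for n using assms[of n] that by auto
  have "cconv b n = (\<Sum>\<^sub>\<infinity>(j, k)\<in>{-N..N} \<times> {-N..N}. b j * b k * b (n - j - k))"
    unfolding cconv_def by (rule infsum_cong_neutral) (auto dest: supp')
  then show ?thesis by (simp add: conv3_def sum.cartesian_product)
qed

section \<open>Compactness of the approximations and the limit equation\<close>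

context galerkin
begin

lemma coeff_le_cube_decay: "t \<ge> 0 \<Longrightarrow> cmod (a t n) \<le> cube_decay n"
  using coeff_bound a_zero by (intro cmod_le_cube_decay) auto

lemma coeff_lipschitz:
  assumes "0 \<le> s" "0 \<le> t"
  shows "cmod (a t n - a s n) \<le> (\<bar>of_int n\<bar> + 1) * \<bar>t - s\<bar>"
proof -
  have "norm (a t n - a s n) \<le> (\<bar>of_int n\<bar> + 1) * norm (t - s)"
  proof (rule differentiable_bound[where S = "{0..}" and f' = "\<lambda>t h. h *\<^sub>R gal N (a t) n"])
    show "((\<lambda>s. a s n) has_derivative (\<lambda>h. h *\<^sub>R gal N (a t) n)) (at t within {0..})" if "t \<in> {0..}" for t
      using deriv[of t n] that by (simp add: has_vector_derivative_def)
    show "onorm (\<lambda>h. h *\<^sub>R gal N (a t) n) \<le> \<bar>of_int n\<bar> + 1" if "t \<in> {0..}" for t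
      using deriv_bound[of t n] that
      by (intro onorm_bound) (auto simp: mult.commute intro!: mult_left_mono)
  qed (use assms in auto)
  then show ?thesis by simp
qed

lemma partial_sum_le_en:
  assumes "finite F" "t \<ge> 0" "\<And>n. w n \<ge> 0"
  shows "(\<Sum>n\<in>F. w n * (cmod (a t n))\<^sup>2) \<le> en w t"
proof -
  have "(\<Sum>n\<in>F. w n * (cmod (a t n))\<^sup>2) = (\<Sum>n\<in>F \<inter> {-N..N}. w n * (cmod (a t n))\<^sup>2)"
    by (rule sum.mono_neutral_right) (use assms supp in auto)
  also have "\<dots> \<le> en w t" unfolding en_def by (rule sum_mono2) (use assms in auto)
  finally show ?thesis .
qed

lemma integral_equation:
  assumes "t \<ge> 0"
  shows "(\<lambda>s. gal N (a s) n) integrable_on {0..t}" "a t n = a 0 n + integral {0..t} (\<lambda>s. gal N (a s) n)"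
proof -
  have "((\<lambda>s. gal N (a s) n) has_integral (a t n - a 0 n)) {0..t}"
  proof (rule fundamental_theorem_of_calculus)
    show "((\<lambda>s. a s n) has_vector_derivative gal N (a s) n) (at s within {0..t})" if "s \<in> {0..t}" for s
      using deriv[of s n] that by (auto intro: has_vector_derivative_within_subset)
  qed fact
  then show "(\<lambda>s. gal N (a s) n) integrable_on {0..t}" "a t n = a 0 n + integral {0..t} (\<lambda>s. gal N (a s) n)"
    by (auto simp: integral_unique)
qed

end

text \<open>Arzela-Ascoli for countably many coordinates: a diagonal subsequence converges at every
  mode and every nonnegative rational time, and the Lipschitz bounds, uniform in m, carry
  convergence to all times with an e/3 argument.\<close>

lemma pointwise_limit_of_lipschitz:
  fixes A :: "nat \<Rightarrow> real \<Rightarrow> int \<Rightarrow> complex"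
  assumes lip: "\<And>m s t n. 0 \<le> s \<Longrightarrow> 0 \<le> t \<Longrightarrow> cmod (A m t n - A m s n) \<le> L n * \<bar>t - s\<bar>"
    and bd: "\<And>m t n. 0 \<le> t \<Longrightarrow> cmod (A m t n) \<le> 1" and L: "\<And>n. L n > 0"
  obtains k a where "strict_mono (k :: nat \<Rightarrow> nat)" "\<And>t n. 0 \<le> t \<Longrightarrow> (\<lambda>m. A (k m) t n) \<longlonglongrightarrow> a t n"
proof -
  let ?S = "UNIV \<times> (\<rat> \<inter> {0..}) :: (int \<times> real) set"
  have "countable ?S" using countable_rat by auto
  then obtain k where k: "strict_mono (k :: nat \<Rightarrow> nat)"
    and lim: "\<And>x. x \<in> ?S \<Longrightarrow> \<exists>l. (\<lambda>m. A (k m) (snd x) (fst x)) \<longlonglongrightarrow> l"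
    by (rule function_convergent_subsequence[where f = "\<lambda>m x. A m (snd x) (fst x)" and M = 1]) (auto simp: bd)
  have "convergent (\<lambda>m. A (k m) t n)" if t: "0 \<le> t" for t n
  proof (rule Cauchy_convergent, rule CauchyI')
    fix e :: real assume "e > 0"
    define d where "d = e / (3 * L n)"
    have "d > 0" using \<open>e > 0\<close> L by (simp add: d_def)
    then obtain q where q: "q \<in> \<rat>" "t < q" "q < t + d" using Rats_dense_in_real[of t "t + d"] by auto
    have Lq: "cmod (A m t n - A m q n) < e / 3" for m
    proof -
      have "cmod (A m t n - A m q n) \<le> L n * \<bar>t - q\<bar>" using lip[of q t] q t by auto
      also have "\<dots> < L n * d" using q L by (intro mult_strict_left_mono) auto
      also have "\<dots> = e / 3" using L[of n] by (simp add: d_def field_simps)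
      finally show ?thesis .
    qed
    obtain l where "(\<lambda>m. A (k m) q n) \<longlonglongrightarrow> l" using lim[of "(n, q)"] q t by auto
    then have "Cauchy (\<lambda>m. A (k m) q n)" by (rule LIMSEQ_imp_Cauchy)
    then obtain M where M: "\<And>i j. i \<ge> M \<Longrightarrow> j \<ge> M \<Longrightarrow> cmod (A (k i) q n - A (k j) q n) < e / 3"
      using CauchyD[of _ "e / 3"] \<open>e > 0\<close> by (metis zero_less_divide_iff zero_less_numeral)
    have "dist (A (k i) t n) (A (k j) t n) < e" if "i \<ge> M" "j > i" for i j
    proof -
      have "A (k i) t n - A (k j) t n = (A (k i) t n - A (k i) q n) + (A (k i) q n - A (k j) q n) - (A (k j) t n - A (k j) q n)"
        by simp
      also have "cmod \<dots> \<le> cmod (A (k i) t n - A (k i) q n) + cmod (A (k i) q n - A (k j) q n) + cmod (A (k j) t n - A (k j) q n)"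
        by (intro order_trans[OF norm_triangle_ineq4] add_right_mono norm_triangle_ineq)
      finally show ?thesis using Lq[of "k i"] Lq[of "k j"] M[of i j] that by (simp add: dist_norm)
    qed
    then show "\<exists>M. \<forall>i\<ge>M. \<forall>j>i. dist (A (k i) t n) (A (k j) t n) < e" by blast
  qed
  then have "(\<lambda>m. A (k m) t n) \<longlonglongrightarrow> lim (\<lambda>m. A (k m) t n)" if "0 \<le> t" for t n
    using that by (simp add: convergent_LIMSEQ_iff)
  with k show thesis by (rule that)
qed

text \<open>All energy bounds concern finite partial sums with right-hand sides free of the
  truncation, so each is a closed condition on finitely many coefficients and survives the limit.
  The clause on \<open>wt R\<close> compares with the initial energy for the same R, uniformly in t;
  the smallness of tails is read off from it.\<close>

theorem fourier_flow_exists: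
  fixes c :: "int \<Rightarrow> complex"
  assumes c_cnj: "\<And>n. c (- n) = cnj (c n)" and c0: "c 0 = 0"
    and small: "\<And>F. finite F \<Longrightarrow> (\<Sum>n\<in>F. (of_int n) ^ 6 * (cmod (c n))\<^sup>2) \<le> 1 / (2 * 10 ^ 10)"
  obtains a :: "real \<Rightarrow> int \<Rightarrow> complex"
  where "a 0 = c" and "\<And>t n. t \<ge> 0 \<Longrightarrow> a t (- n) = cnj (a t n)"
    and "\<And>t n. t \<ge> 0 \<Longrightarrow> cmod (a t n) \<le> cube_decay n"
    and "\<And>t n. t \<ge> 0 \<Longrightarrow>
      ((\<lambda>s. a s n) has_vector_derivative - (\<i> * of_int n / 3) * cconv (a t) n - a t n / of_int \<bar>n\<bar>) (at t within {0..})"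
    and "\<And>t F. t \<ge> 0 \<Longrightarrow> finite F \<Longrightarrow> (\<Sum>n\<in>F. (cmod (a t n))\<^sup>2) \<le> 1 / (1 + t) ^ 6"
    and "\<And>t R F G. t \<ge> 0 \<Longrightarrow> R > 0 \<Longrightarrow> finite F \<Longrightarrow> (\<And>H. finite H \<Longrightarrow> (\<Sum>n\<in>H. wt R n * (cmod (c n))\<^sup>2) \<le> G) \<Longrightarrow>
      (\<Sum>n\<in>F. wt R n * (cmod (a t n))\<^sup>2) \<le> 2 * G"
proof -
  have "\<exists>a. galerkin (int N) a \<and> (\<forall>n. a 0 n = (if n \<in> {-int N..int N} then c n else 0))" for N
  proof -
    obtain a where a: "\<And>n. a 0 n = (if n \<in> {-int N..int N} then c n else 0)"
      "\<And>t n. t \<ge> 0 \<Longrightarrow> a t (- n) = cnj (a t n)" "\<And>t. t \<ge> 0 \<Longrightarrow> a t 0 = 0"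
      "\<And>t n. t \<ge> 0 \<Longrightarrow> n \<notin> {-int N..int N} \<Longrightarrow> a t n = 0"
      "\<And>t n. t \<ge> 0 \<Longrightarrow> ((\<lambda>s. a s n) has_vector_derivative gal (int N) (a t) n) (at t within {0..})"
      using galerkin_exists[of "int N" c] c_cnj c0 by auto
    have "galerkin (int N) a"
    proof
      have "(\<Sum>n\<in>{-int N..int N}. (of_int n) ^ 6 * (cmod (a 0 n))\<^sup>2) = (\<Sum>n\<in>{-int N..int N}. (of_int n) ^ 6 * (cmod (c n))\<^sup>2)"
        by (rule sum.cong) (auto simp: a(1))
      also have "\<dots> \<le> 1 / (2 * 10 ^ 10)" by (rule small) simp
      finally show "(\<Sum>n\<in>{-int N..int N}. (of_int n) ^ 6 * (cmod (a 0 n))\<^sup>2) \<le> 1 / (2 * 10 ^ 10)" .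
    qed (use a in auto)
    then show ?thesis using a(1) by blast
  qed
  then obtain A where gal: "\<And>N. galerkin (int N) (A N)"
    and A0: "\<And>N n. A N 0 n = (if n \<in> {-int N..int N} then c n else 0)" by metis
  note A_bd = galerkin.coeff_le_cube_decay[OF gal] and A_lip = galerkin.coeff_lipschitz[OF gal]
  obtain k a where k: "strict_mono (k :: nat \<Rightarrow> nat)" and lim: "\<And>t n. 0 \<le> t \<Longrightarrow> (\<lambda>m. A (k m) t n) \<longlonglongrightarrow> a t n"
    using pointwise_limit_of_lipschitz[of A "\<lambda>n. \<bar>of_int n\<bar> + 1"] A_lip
      order_trans[OF A_bd cube_decay_le_1] by (smt (verit) abs_ge_zero)
  have a_bd: "cmod (a t n) \<le> cube_decay n" if "t \<ge> 0" for t n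
    by (rule Lim_bounded[OF tendsto_norm[OF lim[OF that]], of 0]) (use A_bd that in auto)
  have a_lip: "cmod (a t n - a s n) \<le> (\<bar>of_int n\<bar> + 1) * \<bar>t - s\<bar>" if "0 \<le> s" "0 \<le> t" for s t n
    by (rule Lim_bounded[OF tendsto_norm[OF tendsto_diff[OF lim lim]], of _ _ 0]) (use A_lip that in auto)
  have a_cont: "((\<lambda>s. a s n) \<longlongrightarrow> a t n) (at t within {0..})" if "0 \<le> t" for t n
  proof -
    have "continuous_on {0..} (\<lambda>s. a s n)"
      by (rule lipschitz_on_continuous_on[of "\<bar>of_int n\<bar> + 1"], rule lipschitz_onI)
         (use a_lip in \<open>auto simp: dist_norm\<close>)
    then show ?thesis using that by (simp add: continuous_on_def)
  qed
  have ev_n: "\<forall>\<^sub>F m in sequentially. n \<in> {- int (k m)..int (k m)}" for n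
  proof -
    have "nat \<bar>n\<bar> \<le> k m" if "nat \<bar>n\<bar> \<le> m" for m using seq_suble[OF k, of m] that by simp
    then have "n \<in> {- int (k m)..int (k m)}" if "nat \<bar>n\<bar> \<le> m" for m using that by fastforce
    then show ?thesis by (rule eventually_sequentiallyI)
  qed
  let ?G = "\<lambda>n t. - (\<i> * of_int n / 3) * cconv (a t) n - a t n / of_int \<bar>n\<bar>"
  have gal_lim: "(\<lambda>m. gal (int (k m)) (A (k m) t) n) \<longlonglongrightarrow> ?G n t" if "0 \<le> t" for t n
  proof -
    have "(\<lambda>m. - (\<i> * of_int n / 3) * cconv (A (k m) t) n - A (k m) t n / of_int \<bar>n\<bar>) \<longlonglongrightarrow> ?G n t"
    proof (cases "n = 0")
      case False
      then show ?thesis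
        by (intro tendsto_intros cconv_tendsto lim that always_eventually) (use A_bd that in auto)
    qed simp
    moreover have conv: "conv3 {- int (k m)..int (k m)} (A (k m) t) n = cconv (A (k m) t) n" for m
      by (rule conv3_eq_cconv) (rule galerkin.supp[OF gal that])
    moreover have "\<forall>\<^sub>F m in sequentially. - (\<i> * of_int n / 3) * cconv (A (k m) t) n - A (k m) t n / of_int \<bar>n\<bar>
        = gal (int (k m)) (A (k m) t) n"
      using ev_n[of n]
      by eventually_elim (auto simp: gal_def conv)
    ultimately show ?thesis by (auto intro: Lim_transform_eventually)
  qed
  have a0: "a 0 = c"
  proof
    fix n
    have "(\<lambda>m. A (k m) 0 n) \<longlonglongrightarrow> c n"
      by (rule tendsto_eventually) (use ev_n[of n] in \<open>eventually_elim, simp add: A0\<close>)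
    then show "a 0 n = c n" using lim[of 0 n] LIMSEQ_unique by blast
  qed
  \<comment> \<open>Coefficients converge only pointwise in time, with no information on their
    derivatives, so the limit is taken in the integrated equation. Differentiability comes back from
    the continuity of the integrand.\<close>
  have eq: "a t n = c n + integral {0..t} (?G n)" if "0 \<le> t" for t n
  proof -
    have "(\<lambda>m. integral {0..t} (\<lambda>s. gal (int (k m)) (A (k m) s) n)) \<longlonglongrightarrow> integral {0..t} (?G n)"
    proof (rule dominated_convergence(2)[where h = "\<lambda>_. \<bar>of_int n\<bar> + 1"])
      show "(\<lambda>s. gal (int (k m)) (A (k m) s) n) integrable_on {0..t}" for m
        by (rule galerkin.integral_equation[OF gal that])
      show "norm (gal (int (k m)) (A (k m) s) n) \<le> \<bar>of_int n\<bar> + 1" if "s \<in> {0..t}" for m s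
        using galerkin.deriv_bound[OF gal] that by simp
    qed (use gal_lim in auto)
    then have "(\<lambda>m. A (k m) 0 n + integral {0..t} (\<lambda>s. gal (int (k m)) (A (k m) s) n)) \<longlonglongrightarrow> c n + integral {0..t} (?G n)"
      using lim[of 0 n] by (intro tendsto_add) (simp_all add: a0)
    then have "(\<lambda>m. A (k m) t n) \<longlonglongrightarrow> c n + integral {0..t} (?G n)"
      using galerkin.integral_equation(2)[OF gal that] by simp
    then show ?thesis using lim[OF that, of n] LIMSEQ_unique by blast
  qed
  have cont: "continuous_on {0..} (?G n)" for n
    unfolding continuous_on_def
  proof
    fix t :: real assume t: "t \<in> {0..}"
    have "{t<..} \<subseteq> {0..}" using t by auto
    then have "at_right t \<le> at t within {0..}" by (rule at_le)
    then have nontriv: "at t within {0..} \<noteq> bot" using trivial_limit_at_right_real[of t] by (auto simp: bot_unique)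
    have "((\<lambda>s. cconv (a s) n) \<longlongrightarrow> cconv (a t) n) (at t within {0..})"
      by (rule cconv_tendsto[OF a_cont _ nontriv]) (use t a_bd in \<open>auto simp: eventually_at_filter\<close>)
    then show "(?G n \<longlongrightarrow> ?G n t) (at t within {0..})"
      using a_cont[of t n] t by (cases "n = 0") (auto intro!: tendsto_intros)
  qed
  have sums: "(\<Sum>n\<in>F. w n * (cmod (a t n))\<^sup>2) \<le> B"
    if "finite F" "t \<ge> 0" "\<And>n. w n \<ge> 0" "\<And>m. galerkin.en (int m) (A m) w t \<le> B" for F t w B
  proof (rule Lim_bounded[of _ _ 0])
    show "(\<lambda>m. \<Sum>n\<in>F. w n * (cmod (A (k m) t n))\<^sup>2) \<longlonglongrightarrow> (\<Sum>n\<in>F. w n * (cmod (a t n))\<^sup>2)"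
      by (intro tendsto_intros lim that)
    show "\<forall>m\<ge>0. (\<Sum>n\<in>F. w n * (cmod (A (k m) t n))\<^sup>2) \<le> B"
      by (intro allI impI) (rule order_trans[OF galerkin.partial_sum_le_en[OF gal that(1-3)] that(4)])
  qed
  show thesis
  proof (rule that[of a])
    show "a 0 = c" by (rule a0)
    show "a t (- n) = cnj (a t n)" if "t \<ge> 0" for t n
      using LIMSEQ_unique[OF lim[OF that, of "- n"]] tendsto_cnj[OF lim[OF that, of n]] galerkin.cnj[OF gal that] by simp
    show "cmod (a t n) \<le> cube_decay n" if "t \<ge> 0" for t n by (rule a_bd[OF that])
    show "((\<lambda>s. a s n) has_vector_derivative ?G n t) (at t within {0..})" if "t \<ge> 0" for t n
      using cont eq that by (rule integral_equation_has_vector_derivative)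
    show "(\<Sum>n\<in>F. (cmod (a t n))\<^sup>2) \<le> 1 / (1 + t) ^ 6" if "t \<ge> 0" "finite F" for t F
      using sums[OF that(2,1), of "\<lambda>_. 1"] galerkin.L2_decay[OF gal that(1)] by simp
    show "(\<Sum>n\<in>F. wt R n * (cmod (a t n))\<^sup>2) \<le> 2 * G"
      if t: "t \<ge> 0" "R > 0" "finite F" and G: "\<And>H. finite H \<Longrightarrow> (\<Sum>n\<in>H. wt R n * (cmod (c n))\<^sup>2) \<le> G" for t R F G
    proof (rule sums[OF t(3,1)])
      fix m
      have "galerkin.en (int m) (A m) (\<lambda>n. wt R n) 0 = (\<Sum>n\<in>{-int m..int m}. wt R n * (cmod (c n))\<^sup>2)"
        unfolding galerkin.en_def[OF gal] by (rule sum.cong) (auto simp: A0)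
      also have "\<dots> \<le> G" by (rule G) simp
      finally show "galerkin.en (int m) (A m) (\<lambda>n. wt R n) t \<le> 2 * G"
        using galerkin.wt_bound[OF gal t(1,2), of m] by linarith
    qed (rule wt_nonneg[OF t(2)])
  qed
qed

section \<open>Fourier series of square integrable functions\<close>

lemma finite_measure_circ: "finite_measure circ"
  by (rule finite_measure_lebesgue_on) simp

lemma integrable_circ_continuous:
  fixes f :: "real \<Rightarrow> 'b::euclidean_space"
  shows "continuous_on UNIV f \<Longrightarrow> integrable circ f"
  by (rule continuous_imp_integrable_real) (auto intro: continuous_on_subset)

lemma borel_measurable_circ_continuous:
  fixes f :: "real \<Rightarrow> 'b::euclidean_space"
  shows "continuous_on UNIV f \<Longrightarrow> f \<in> borel_measurable circ"
  by (rule borel_measurable_integrable[OF integrable_circ_continuous])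

lemma integrable_circ_mult_bounded:
  fixes f g :: "real \<Rightarrow> complex"
  assumes "integrable circ f" "g \<in> borel_measurable circ" "\<And>x. cmod (g x) \<le> B"
  shows "integrable circ (\<lambda>x. f x * g x)"
proof (rule Bochner_Integration.integrable_bound)
  show "integrable circ (\<lambda>x. B * cmod (f x))" using assms by (intro integrable_mult_right integrable_norm)
  show "AE x in circ. cmod (f x * g x) \<le> norm (B * cmod (f x))"
  proof (rule AE_I2)
    fix x
    have "0 \<le> B" using assms(3)[of 0] norm_ge_zero order_trans by blast
    then show "cmod (f x * g x) \<le> norm (B * cmod (f x))"
      using mult_left_mono[OF assms(3)[of x], of "cmod (f x)"] by (simp add: norm_mult mult.commute)
  qed
qed (use assms in measurable)

lemma continuous_cis_mult: "continuous_on S (\<lambda>x. cis (c * x))"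
  by (intro continuous_intros)

lemma integrable_circ_mult_cis:
  assumes "integrable circ f"
  shows "integrable circ (\<lambda>x. f x * cis (c * x))"
  by (rule integrable_circ_mult_bounded[where B = 1])
     (use assms in \<open>auto intro: borel_measurable_circ_continuous continuous_cis_mult\<close>)

lemma integral_cis: "(\<integral>x. cis (of_int n * x) \<partial>circ) = (if n = 0 then 2 * pi else 0)"
proof (cases "n = 0")
  case True
  have "(\<integral>x. (1::complex) \<partial>circ) = 2 * pi"
    by (simp add: measure_restrict_space scaleR_conv_of_real)
  then show ?thesis using True by simp
next
  case False
  have "((\<lambda>x. cis (of_int n * x)) has_integral (cis (of_int n * pi) / (\<i> * of_int n) - cis (of_int n * (- pi)) / (\<i> * of_int n)))
      {- pi..pi}"
  proof (rule fundamental_theorem_of_calculus)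
    show "((\<lambda>x. cis (of_int n * x) / (\<i> * of_int n)) has_vector_derivative cis (of_int n * x)) (at x within {- pi..pi})" for x
    proof -
      have "((\<lambda>z. exp (\<i> * of_int n * z) / (\<i> * of_int n)) has_field_derivative exp (\<i> * of_int n * of_real x)) (at (of_real x))"
        using False by (auto intro!: derivative_eq_intros)
      from has_vector_derivative_real_field[OF this] show ?thesis
        by (simp add: cis_conv_exp mult.assoc)
    qed
  qed simp
  moreover have "cis (of_int n * pi) = cis (of_int n * (- pi))"
    by (auto simp: complex_eq_iff sin_times_pi_eq_0)
  ultimately have "((\<lambda>x. cis (of_int n * x)) has_integral 0) {- pi..pi}" by simp
  then have "integral {- pi..pi} (\<lambda>x. cis (of_int n * x)) = 0" by (rule integral_unique)
  then show ?thesis using False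
    by (subst lebesgue_integral_eq_integral)
       (auto intro: integrable_circ_continuous continuous_cis_mult)
qed

definition trig :: "(int \<Rightarrow> complex) \<Rightarrow> int set \<Rightarrow> real \<Rightarrow> complex" where
  "trig c F x = (\<Sum>n\<in>F. c n * cis (of_int n * x))"

lemma continuous_trig: "continuous_on S (trig c F)"
  unfolding trig_def by (intro continuous_intros continuous_cis_mult)

lemma integral_mult_trig:
  assumes "integrable circ f" "finite F"
  shows "(\<integral>x. f x * cnj (trig c F x) \<partial>circ) = (\<Sum>n\<in>F. cnj (c n) * (\<integral>x. f x * cis (- (of_int n * x)) \<partial>circ))"
proof -
  have "f x * cnj (trig c F x) = (\<Sum>n\<in>F. cnj (c n) * (f x * cis ((- of_int n) * x)))" for x
    by (simp add: trig_def sum_distrib_left cis_cnj ac_simps)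
  then have "(\<integral>x. f x * cnj (trig c F x) \<partial>circ) = (\<Sum>n\<in>F. \<integral>x. cnj (c n) * (f x * cis ((- of_int n) * x)) \<partial>circ)"
    by (simp only:) (intro Bochner_Integration.integral_sum integrable_mult_right integrable_circ_mult_cis assms)
  then show ?thesis by simp
qed

lemma integral_trig_cis:
  assumes "finite F"
  shows "(\<integral>x. trig c F x * cis (- (of_int n * x)) \<partial>circ) = (if n \<in> F then complex_of_real (2 * pi) * c n else 0)"
proof -
  have "trig c F x * cis (- (of_int n * x)) = (\<Sum>m\<in>F. c m * cis (of_int (m - n) * x))" for x
    by (simp only: trig_def sum_distrib_right mult.assoc cis_mult) (simp add: algebra_simps)
  then have "(\<integral>x. trig c F x * cis (- (of_int n * x)) \<partial>circ) = (\<Sum>m\<in>F. \<integral>x. c m * cis (of_int (m - n) * x) \<partial>circ)"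
    by (simp only:) (intro Bochner_Integration.integral_sum integrable_mult_right integrable_circ_continuous continuous_cis_mult)
  also have "\<dots> = (\<Sum>m\<in>F. if m = n then complex_of_real (2 * pi) * c n else 0)"
    by (rule sum.cong[OF refl], simp only: integral_mult_right_zero integral_cis) (auto simp: mult.commute)
  also have "\<dots> = (if n \<in> F then complex_of_real (2 * pi) * c n else 0)" using assms by simp
  finally show ?thesis .
qed

lemma cnj_mult_norm: "cnj z * (complex_of_real k * z) = complex_of_real (k * (cmod z)\<^sup>2)"
  by (simp only: of_real_mult complex_norm_square) (simp add: ac_simps)

lemma integral_norm_trig:
  assumes "finite F"
  shows "(\<integral>x. (cmod (trig c F x))\<^sup>2 \<partial>circ) = 2 * pi * (\<Sum>n\<in>F. (cmod (c n))\<^sup>2)"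
proof -
  have "complex_of_real (\<integral>x. (cmod (trig c F x))\<^sup>2 \<partial>circ) = (\<integral>x. trig c F x * cnj (trig c F x) \<partial>circ)"
    by (simp only: integral_complex_of_real[symmetric] complex_norm_square)
  also have "\<dots> = (\<Sum>n\<in>F. cnj (c n) * (complex_of_real (2 * pi) * c n))"
    using assms by (simp add: integral_mult_trig integrable_circ_continuous continuous_trig integral_trig_cis)
  also have "\<dots> = of_real (2 * pi * (\<Sum>n\<in>F. (cmod (c n))\<^sup>2))"
    by (simp only: cnj_mult_norm sum_distrib_left of_real_sum)
  finally show ?thesis by (simp only: of_real_eq_iff)
qed

lemma L2_integrable: "f \<in> L2 \<Longrightarrow> integrable circ f"
proof (rule Bochner_Integration.integrable_bound)
  assume f: "f \<in> L2"
  show "integrable circ (\<lambda>x. 1 + (f x)\<^sup>2)"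
    using f by (auto simp: L2_def intro!: Bochner_Integration.integrable_add finite_measure.integrable_const[OF finite_measure_circ])
  show "AE x in circ. norm (f x) \<le> norm (1 + (f x)\<^sup>2)"
  proof (rule AE_I2)
    fix x
    have "0 \<le> (\<bar>f x\<bar> - 1)\<^sup>2" by simp
    then have "2 * \<bar>f x\<bar> \<le> 1 + (f x)\<^sup>2" by (simp add: power2_diff)
    then have "\<bar>f x\<bar> \<le> 1 + (f x)\<^sup>2" using abs_ge_zero[of "f x"] by linarith
    then show "norm (f x) \<le> norm (1 + (f x)\<^sup>2)" by simp
  qed
qed (simp add: L2_def)

lemma fourier_coeff_integral:
  "(\<integral>x. complex_of_real (f x) * cis (- (of_int n * x)) \<partial>circ) = 2 * pi * fourier_coeff f n"
  by (simp add: fourier_coeff_def)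

lemma bessel:
  assumes "f \<in> L2" "finite F"
  shows "2 * pi * (\<Sum>n\<in>F. (cmod (fourier_coeff f n))\<^sup>2) \<le> (L2_norm f)\<^sup>2"
proof -
  let ?c = "fourier_coeff f" and ?p = "trig (fourier_coeff f) F"
  have f: "integrable circ (\<lambda>x. complex_of_real (f x))" using L2_integrable[OF assms(1)] by simp
  have i1: "integrable circ (\<lambda>x. (f x)\<^sup>2)" using assms by (simp add: L2_def)
  have ip: "integrable circ (\<lambda>x. complex_of_real (f x) * cnj (?p x))"
  proof -
    have "complex_of_real (f x) * cnj (?p x) = (\<Sum>n\<in>F. cnj (?c n) * (complex_of_real (f x) * cis ((- of_int n) * x)))" for x
      by (simp add: trig_def sum_distrib_left cis_cnj ac_simps)
    then show ?thesis
      by (simp only:) (intro Bochner_Integration.integrable_sum integrable_mult_right integrable_circ_mult_cis f)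
  qed
  have i2: "integrable circ (\<lambda>x. 2 * Re (complex_of_real (f x) * cnj (?p x)))"
    by (intro integrable_mult_right integrable_Re ip)
  have i3: "integrable circ (\<lambda>x. (cmod (?p x))\<^sup>2)"
    by (intro integrable_circ_continuous continuous_intros continuous_trig)
  have "(\<integral>x. Re (complex_of_real (f x) * cnj (?p x)) \<partial>circ) = Re (\<integral>x. complex_of_real (f x) * cnj (?p x) \<partial>circ)"
    by (rule integral_Re[OF ip])
  also have "\<dots> = Re (\<Sum>n\<in>F. cnj (?c n) * (complex_of_real (2 * pi) * ?c n))"
    by (simp only: integral_mult_trig[OF f assms(2)] fourier_coeff_integral)
  also have "\<dots> = Re (of_real (2 * pi * (\<Sum>n\<in>F. (cmod (?c n))\<^sup>2)))"
    by (simp only: cnj_mult_norm sum_distrib_left of_real_sum)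
  finally have cross: "(\<integral>x. Re (complex_of_real (f x) * cnj (?p x)) \<partial>circ) = 2 * pi * (\<Sum>n\<in>F. (cmod (?c n))\<^sup>2)"
    by simp
  have "0 \<le> (\<integral>x. (cmod (complex_of_real (f x) - ?p x))\<^sup>2 \<partial>circ)" by simp
  also have "(\<lambda>x. (cmod (complex_of_real (f x) - ?p x))\<^sup>2)
      = (\<lambda>x. (f x)\<^sup>2 - 2 * Re (complex_of_real (f x) * cnj (?p x)) + (cmod (?p x))\<^sup>2)"
    by (simp only: cmod_power2 fun_eq_iff) (simp add: power2_eq_square algebra_simps)
  also have "(\<integral>x. (f x)\<^sup>2 - 2 * Re (complex_of_real (f x) * cnj (?p x)) + (cmod (?p x))\<^sup>2 \<partial>circ)
      = (\<integral>x. (f x)\<^sup>2 \<partial>circ) - 2 * (\<integral>x. Re (complex_of_real (f x) * cnj (?p x)) \<partial>circ) + (\<integral>x. (cmod (?p x))\<^sup>2 \<partial>circ)"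
    using i1 i2 i3 by (simp only: Bochner_Integration.integral_add Bochner_Integration.integral_diff
        Bochner_Integration.integrable_diff integral_mult_right_zero)
  also have "\<dots> = (L2_norm f)\<^sup>2 - 2 * pi * (\<Sum>n\<in>F. (cmod (?c n))\<^sup>2)"
    using cross integral_norm_trig[OF assms(2)] by (simp add: L2_norm_def)
  finally show ?thesis by simp
qed

section \<open>Uniqueness of Fourier coefficients\<close>

definition zero_coeffs :: "(real \<Rightarrow> complex) \<Rightarrow> bool" where
  "zero_coeffs g \<longleftrightarrow> integrable circ g \<and> (\<forall>n. (\<integral>x. g x * cis (of_int n * x) \<partial>circ) = 0)"

lemma zero_coeffs_integral: "zero_coeffs g \<Longrightarrow> (\<integral>x. g x \<partial>circ) = 0"
  by (auto simp: zero_coeffs_def dest!: spec[of _ 0])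

lemma borel_measurable_circ_comp_cis:
  assumes "continuous_on UNIV (p :: complex \<Rightarrow> 'a::euclidean_space)"
  shows "(\<lambda>x. p (cis x)) \<in> borel_measurable circ"
  by (rule borel_measurable_circ_continuous, rule continuous_on_compose2[OF assms])
     (auto intro!: continuous_intros)

text \<open>
  Functions with vanishing Fourier coefficients form a module over the polynomials in \<open>cos\<close> and
  \<open>sin\<close>; this makes the induction over polynomials work.
\<close>

lemma zero_coeffs_mult_polynomial:
  assumes "real_polynomial_function p" "zero_coeffs g"
  shows "zero_coeffs (\<lambda>x. g x * complex_of_real (p (cis x)))"
  using assms
proof (induction p arbitrary: g rule: real_polynomial_function.induct)
  case (linear p)
  interpret p: bounded_linear p by fact
  \<comment> \<open>A real-linear function on the unit circle is a combination of cis x and cis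
    (-x); multiplying by it shifts the index of a coefficient by one in either direction.\<close>
  define \<alpha> where "\<alpha> = (p 1 - \<i> * p \<i>) / 2"
  define \<beta> where "\<beta> = (p 1 + \<i> * p \<i>) / 2"
  have p: "complex_of_real (p (cis x)) = \<alpha> * cis x + \<beta> * cis (- x)" for x
  proof -
    have "cis x = cos x *\<^sub>R 1 + sin x *\<^sub>R \<i>" by (simp add: complex_eq_iff)
    then have "p (cis x) = cos x * p 1 + sin x * p \<i>" by (simp only: p.add p.scaleR) simp
    then show ?thesis by (simp add: \<alpha>_def \<beta>_def complex_eq_iff field_simps)
  qed
  have g: "integrable circ g" "\<And>n. (\<integral>x. g x * cis (of_int n * x) \<partial>circ) = 0"
    using linear by (auto simp: zero_coeffs_def)
  have eq: "g x * complex_of_real (p (cis x)) * cis (of_int n * x)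
      = \<alpha> * (g x * cis (of_int (n + 1) * x)) + \<beta> * (g x * cis (of_int (n - 1) * x))" for n x
  proof -
    have "cis x * cis (of_int n * x) = cis (of_int (n + 1) * x)"
         "cis (- x) * cis (of_int n * x) = cis (of_int (n - 1) * x)"
      by (simp_all add: cis_mult algebra_simps)
    then show ?thesis unfolding p by (simp add: algebra_simps)
  qed
  have "integrable circ (\<lambda>x. g x * complex_of_real (p (cis x)) * cis (of_int n * x))" for n
    unfolding eq by (intro Bochner_Integration.integrable_add integrable_mult_right integrable_circ_mult_cis g)
  from this[of 0] have "integrable circ (\<lambda>x. g x * complex_of_real (p (cis x)))" by simp
  moreover have "(\<integral>x. g x * complex_of_real (p (cis x)) * cis (of_int n * x) \<partial>circ) = 0" for n
    unfolding eq
    by (subst Bochner_Integration.integral_add) (auto simp only: integral_mult_right_zero g intro!: integrable_mult_right integrable_circ_mult_cis g, simp)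
  ultimately show ?case by (simp add: zero_coeffs_def)
next
  case (const c)
  then show ?case
    by (simp add: zero_coeffs_def mult.assoc mult.left_commute[of _ "complex_of_real c"] mult.commute[of _ "complex_of_real c"])
next
  case (add p q)
  have "zero_coeffs (\<lambda>x. g x * complex_of_real (p (cis x)) + g x * complex_of_real (q (cis x)))"
    using add.IH(1)[OF add.prems] add.IH(2)[OF add.prems]
    by (auto simp: zero_coeffs_def distrib_right integrable_circ_mult_cis)
  then show ?case by (simp add: distrib_left)
next
  case (mult p q)
  show ?case using mult.IH(2)[OF mult.IH(1)[OF mult.prems]] by (simp add: mult.assoc)
qed

text \<open>Stone-Weierstrass on the unit circle: polynomials integrate to zero against g, and the
  error is at most e times the L^1 norm M. The tolerance is divided by M + 1 so that M = 0 needs no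
  separate case.\<close>

lemma zero_coeffs_continuous:
  assumes "zero_coeffs g" "continuous_on UNIV (\<phi> :: complex \<Rightarrow> real)" "\<And>z. \<bar>\<phi> z\<bar> \<le> 1"
  shows "(\<integral>x. g x * complex_of_real (\<phi> (cis x)) \<partial>circ) = 0"
proof (rule ccontr)
  let ?I = "\<integral>x. g x * complex_of_real (\<phi> (cis x)) \<partial>circ"
  assume "?I \<noteq> 0"
  then have I: "cmod ?I > 0" by simp
  have g: "integrable circ g" using assms by (simp add: zero_coeffs_def)
  define M where "M = (\<integral>x. cmod (g x) \<partial>circ)"
  have "M \<ge> 0" by (simp add: M_def)
  define e where "e = cmod ?I / 2 / (M + 1)"
  have "e > 0" using I \<open>M \<ge> 0\<close> by (simp add: e_def)
  obtain p where p: "real_polynomial_function p" "\<And>z. z \<in> sphere 0 1 \<Longrightarrow> \<bar>\<phi> z - p z\<bar> < e"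
    using Stone_Weierstrass_real_polynomial_function[of "sphere (0::complex) 1" \<phi> e] \<open>e > 0\<close>
      continuous_on_subset[OF assms(2)] by auto
  have zp: "zero_coeffs (\<lambda>x. g x * complex_of_real (p (cis x)))"
    by (rule zero_coeffs_mult_polynomial[OF p(1) assms(1)])
  then have p0: "(\<integral>x. g x * complex_of_real (p (cis x)) \<partial>circ) = 0"
    by (rule zero_coeffs_integral)
  have ip: "integrable circ (\<lambda>x. g x * complex_of_real (p (cis x)))" using zp by (simp add: zero_coeffs_def)
  have i\<phi>: "integrable circ (\<lambda>x. g x * complex_of_real (\<phi> (cis x)))"
    by (rule integrable_circ_mult_bounded[OF g, where B = 1])
       (use borel_measurable_circ_comp_cis[OF assms(2)] assms(3) in auto)
  have "?I = (\<integral>x. g x * complex_of_real (\<phi> (cis x)) - g x * complex_of_real (p (cis x)) \<partial>circ)"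
    using p0 by (simp add: Bochner_Integration.integral_diff[OF i\<phi> ip])
  also have "cmod \<dots> \<le> (\<integral>x. e * cmod (g x) \<partial>circ)"
  proof (rule order_trans[OF Bochner_Integration.integral_norm_bound], rule integral_mono)
    show "integrable circ (\<lambda>x. cmod (g x * complex_of_real (\<phi> (cis x)) - g x * complex_of_real (p (cis x))))"
      by (intro integrable_norm Bochner_Integration.integrable_diff i\<phi> ip)
    show "integrable circ (\<lambda>x. e * cmod (g x))" using g by simp
    show "cmod (g x * complex_of_real (\<phi> (cis x)) - g x * complex_of_real (p (cis x))) \<le> e * cmod (g x)" for x
    proof -
      have "cmod (g x * complex_of_real (\<phi> (cis x)) - g x * complex_of_real (p (cis x))) = cmod (g x) * \<bar>\<phi> (cis x) - p (cis x)\<bar>"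
        by (metis norm_mult norm_of_real of_real_diff right_diff_distrib)
      also have "\<dots> \<le> cmod (g x) * e" using p(2)[of "cis x"] by (intro mult_left_mono) auto
      finally show ?thesis by (simp add: mult.commute)
    qed
  qed
  also have "\<dots> = e * M" by (simp add: M_def)
  also have "\<dots> < cmod ?I"
  proof -
    have "e * M \<le> e * (M + 1)" using \<open>e > 0\<close> by simp
    also have "\<dots> = cmod ?I / 2"
    proof -
      have "M + 1 \<noteq> 0" using \<open>M \<ge> 0\<close> by linarith
      then show ?thesis by (rule iffD1[OF nonzero_eq_divide_eq e_def])
    qed
    also have "\<dots> < cmod ?I" using I by linarith
    finally show ?thesis .
  qed
  finally show False by simp
qed

text \<open>The truncated multiples of the distance to K are continuous, bounded by 1 and increase
  to the indicator of the complement. Nonemptiness matters because the distance to the empty set is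
  0 by convention.\<close>

lemma zero_coeffs_closed:
  assumes "zero_coeffs g" "closed K" "K \<noteq> {}"
  shows "(\<integral>x. g x * indicator (- K) (cis x) \<partial>circ) = 0"
proof -
  define \<phi> where "\<phi> = (\<lambda>k z. min 1 (real k * infdist z K))"
  have c: "continuous_on UNIV (\<phi> k)" for k unfolding \<phi>_def by (intro continuous_intros)
  have b: "\<bar>\<phi> k z\<bar> \<le> 1" for k z unfolding \<phi>_def using infdist_nonneg[of z K] by (auto simp: abs_le_iff)
  have g: "integrable circ g" using assms by (simp add: zero_coeffs_def)
  have pt: "(\<lambda>k. \<phi> k z) \<longlonglongrightarrow> indicator (- K) z" for z
  proof (cases "z \<in> K")
    case True
    then show ?thesis by (simp add: \<phi>_def)
  next
    case False
    then have "infdist z K > 0" using assms by (simp add: infdist_pos_not_in_closed)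
    then obtain k0 where k0: "1 < real k0 * infdist z K" using reals_Archimedean3 by blast
    have "\<phi> k z = 1" if "k \<ge> k0" for k
    proof -
      have "real k0 * infdist z K \<le> real k * infdist z K" using that infdist_nonneg by (intro mult_right_mono) auto
      then show ?thesis using k0 by (simp add: \<phi>_def)
    qed
    then have "\<forall>\<^sub>F k in sequentially. \<phi> k z = indicator (- K) z"
      using False by (auto simp: eventually_sequentially)
    then show ?thesis by (rule tendsto_eventually)
  qed
  have ptc: "(\<lambda>k. complex_of_real (\<phi> k z)) \<longlonglongrightarrow> indicator (- K) z" for z
    using tendsto_of_real[OF pt[of z], where 'a = complex] by (cases "z \<in> K") auto
  have mk: "(\<lambda>x. complex_of_real (\<phi> k (cis x))) \<in> borel_measurable circ" for k
    using borel_measurable_circ_comp_cis[OF c] by simp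
  have m: "(\<lambda>x. indicator (- K) (cis x) :: complex) \<in> borel_measurable circ"
    by (rule borel_measurable_LIMSEQ_metric[OF mk]) (rule ptc)
  have "(\<lambda>k. \<integral>x. g x * complex_of_real (\<phi> k (cis x)) \<partial>circ) \<longlonglongrightarrow> (\<integral>x. g x * indicator (- K) (cis x) \<partial>circ)"
  proof (rule integral_dominated_convergence[where w = "\<lambda>x. cmod (g x)"])
    show "(\<lambda>x. g x * indicator (- K) (cis x)) \<in> borel_measurable circ" using g m by auto
    show "(\<lambda>x. g x * complex_of_real (\<phi> k (cis x))) \<in> borel_measurable circ" for k using g mk by auto
    show "AE x in circ. (\<lambda>k. g x * complex_of_real (\<phi> k (cis x))) \<longlonglongrightarrow> g x * indicator (- K) (cis x)"
      by (intro AE_I2 tendsto_intros ptc)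
    show "AE x in circ. cmod (g x * complex_of_real (\<phi> k (cis x))) \<le> cmod (g x)" for k
      using b by (intro AE_I2) (simp add: norm_mult mult_left_le)
  qed (use g in simp)
  moreover have "(\<integral>x. g x * complex_of_real (\<phi> k (cis x)) \<partial>circ) = 0" for k
    by (rule zero_coeffs_continuous[OF assms(1) c b])
  ultimately have "(\<lambda>k::nat. 0) \<longlonglongrightarrow> (\<integral>x. g x * indicator (- K) (cis x) \<partial>circ)" by (simp only:)
  then show ?thesis by (simp add: LIMSEQ_const_iff)
qed

text \<open>If f were positive on a set of positive measure, inner regularity would give a closed T
  of positive measure inside it. The image of T on the circle is closed, so the integral of f over T
  is zero, although f is positive there.\<close>

lemma zero_coeffs_nonpos:
  assumes f: "integrable circ f" and z: "zero_coeffs (\<lambda>x. complex_of_real (f x))"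
  shows "AE x in circ. f x \<le> 0"
proof -
  \<comment> \<open>The endpoints have the same image on the circle; without them \<open>Arg\<close>
    inverts \<open>cis\<close>, and membership in T can be read off from the image.\<close>
  define A where "A = {x \<in> {- pi<..<pi}. 0 < f x}"
  have "{x \<in> space circ. 0 < f x} \<in> sets circ"
    using borel_measurable_integrable[OF f] by measurable
  then have "{x \<in> {- pi..pi}. 0 < f x} \<in> sets lebesgue" by (simp add: sets_restrict_space_iff)
  moreover have "A = {x \<in> {- pi..pi}. 0 < f x} \<inter> {- pi<..<pi}" by (auto simp: A_def)
  ultimately have A: "A \<in> sets lebesgue" by auto
  have compact_null: "emeasure lebesgue T = 0" if T: "closed T" "T \<subseteq> A" for T
  proof (cases "T = {}")
    case False
    have "bounded T" by (rule bounded_subset[of "{- pi..pi}"]) (use T in \<open>auto simp: A_def\<close>)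
    then have "compact T" using T compact_eq_bounded_closed by blast
    then have "closed (cis ` T)" by (intro compact_imp_closed compact_continuous_image continuous_intros)
    have mem: "cis x \<in> cis ` T \<longleftrightarrow> x \<in> T" if "x \<in> {- pi..pi}" for x
    proof
      assume "cis x \<in> cis ` T"
      then obtain y where y: "y \<in> T" "cis x = cis y" by auto
      have "y \<in> {- pi<..<pi}" using y T by (auto simp: A_def)
      have "x \<noteq> - pi"
      proof
        assume "x = - pi"
        then have "cis y = cis pi" using y(2) by (simp add: complex_eq_iff)
        moreover have "Arg (cis y) = y" "Arg (cis pi) = pi"
          using \<open>y \<in> {- pi<..<pi}\<close> by (intro Arg_cis; simp)+
        ultimately show False using \<open>y \<in> {- pi<..<pi}\<close> by simp
      qed
      then have "Arg (cis x) = x" "Arg (cis y) = y" using that \<open>y \<in> {- pi<..<pi}\<close> by (auto intro!: Arg_cis)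
      then have "x = y" using y(2) by metis
      then show "x \<in> T" using y(1) by simp
    qed (rule imageI)
    have "integrable circ (\<lambda>x. complex_of_real (f x))" using f by simp
    have "T \<in> sets lebesgue" using T(1) by simp
    then have Ts: "T \<in> sets circ" using T by (auto simp: sets_restrict_space_iff A_def)
    have iT: "integrable circ (\<lambda>x. f x * indicator T x)" using integrable_mult_indicator[OF Ts f] by (simp add: mult.commute)
    have "(\<integral>x. complex_of_real (f x) \<partial>circ) = 0"
      by (rule zero_coeffs_integral[OF z])
    then have f0: "(\<integral>x. f x \<partial>circ) = 0" by simp
    have "(\<integral>x. complex_of_real (f x) * indicator (- cis ` T) (cis x) \<partial>circ) = (\<integral>x. complex_of_real (f x - f x * indicator T x) \<partial>circ)"
      by (rule Bochner_Integration.integral_cong) (use mem in \<open>auto simp: indicator_def\<close>)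
    then have "(\<integral>x. complex_of_real (f x - f x * indicator T x) \<partial>circ) = 0"
      using zero_coeffs_closed[OF z \<open>closed (cis ` T)\<close>] False by simp
    then have "(\<integral>x. f x - f x * indicator T x \<partial>circ) = 0" by (simp only: integral_complex_of_real of_real_eq_0_iff)
    then have "(\<integral>x. f x * indicator T x \<partial>circ) = 0" using f iT f0 by simp
    then have "AE x in circ. f x * indicator T x = 0"
    proof (subst (asm) integral_nonneg_eq_0_iff_AE[OF iT])
      have "0 \<le> f x * indicator T x" for x using T(2) by (auto simp: A_def indicator_def less_imp_le)
      then show "AE x in circ. 0 \<le> f x * indicator T x" by simp
    qed
    then have "AE x in circ. x \<notin> T"
      by eventually_elim (use T in \<open>auto simp: A_def indicator_def split: if_splits\<close>)
    moreover have "{x \<in> space circ. \<not> x \<notin> T} = T" using T by (auto simp: A_def)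
    ultimately have "T \<in> null_sets circ" using AE_iff_null[of circ "\<lambda>x. x \<notin> T"] Ts by simp
    then have "emeasure circ T = 0" by auto
    moreover have "T \<subseteq> {- pi..pi}" using T by (auto simp: A_def)
    ultimately show ?thesis using emeasure_restrict_space[of "{- pi..pi}" lebesgue T] by simp
  qed simp
  have "emeasure lebesgue A = 0"
  proof (rule ccontr)
    assume "emeasure lebesgue A \<noteq> 0"
    moreover have "emeasure lebesgue A \<le> emeasure lebesgue {- pi..pi}" by (rule emeasure_mono) (auto simp: A_def)
    then have fin: "emeasure lebesgue A < \<infinity>" by (rule le_less_trans) simp
    ultimately obtain e where e: "e > 0" "ennreal e = emeasure lebesgue A"
      by (cases "emeasure lebesgue A") (auto simp: top_unique zero_less_iff_neq_zero)
    \<comment> \<open>The tolerance is the measure of A itself: a null set T would leave A - T with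
      that full measure, against the strict bound.\<close>
    then obtain T where T: "closed T" "T \<subseteq> A" "A - T \<in> lmeasurable" "emeasure lebesgue (A - T) < ennreal e"
      using sets_lebesgue_inner_closed[OF A] by metis
    have "emeasure lebesgue A = emeasure lebesgue T + emeasure lebesgue (A - T)"
      using plus_emeasure[of T lebesgue "A - T"] T A by (simp add: Un_absorb1)
    then show False using compact_null[OF T(1,2)] T(4) e by simp
  qed
  then have "AE x in lebesgue. x \<notin> A" using A by (intro AE_not_in) (auto simp: null_sets_def)
  moreover have "AE x in lebesgue. x \<notin> {- pi, pi}"
    by (intro AE_not_in) (auto intro: null_sets_completionI finite_imp_null_set_lborel)
  ultimately have "AE x in lebesgue. x \<in> {- pi..pi} \<longrightarrow> f x \<le> 0"
    by eventually_elim (auto simp: A_def)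
  then show ?thesis by (subst AE_restrict_space_iff) auto
qed

theorem fourier_coeff_unique:
  assumes f: "integrable circ f" and z: "\<And>n. fourier_coeff f n = 0"
  shows "AE x in circ. f x = 0"
proof -
  have zc: "zero_coeffs (\<lambda>x. complex_of_real (f x))"
    unfolding zero_coeffs_def
  proof (intro conjI allI)
    fix n
    show "(\<integral>x. complex_of_real (f x) * cis (of_int n * x) \<partial>circ) = 0"
      using fourier_coeff_integral[of f "- n"] z[of "- n"] by simp
  qed (use f in simp)
  have "zero_coeffs (\<lambda>x. complex_of_real (- f x))"
    using zc by (simp add: zero_coeffs_def)
  then have "AE x in circ. - f x \<le> 0" using f by (intro zero_coeffs_nonpos) auto
  moreover have "AE x in circ. f x \<le> 0" using zero_coeffs_nonpos[OF f zc] .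
  ultimately show ?thesis by eventually_elim auto
qed

section \<open>The Riesz-Fischer theorem and the upper half of Parseval's identity\<close>

lemma fatou_bound:
  fixes f :: "nat \<Rightarrow> 'a \<Rightarrow> real"
  assumes f: "\<And>k. integrable M (f k)" "\<And>k x. x \<in> space M \<Longrightarrow> 0 \<le> f k x" "\<And>k. (\<integral>x. f k x \<partial>M) \<le> C"
    and lim: "AE x in M. (\<lambda>k. f k x) \<longlonglongrightarrow> g x" and g: "g \<in> borel_measurable M"
  shows "integrable M g" "(\<integral>x. g x \<partial>M) \<le> C"
proof -
  have C: "0 \<le> C" using f(3)[of 0] Bochner_Integration.integral_nonneg[of M "f 0"] f(2) by fastforce
  have nonneg: "AE x in M. 0 \<le> g x"
    using lim AE_space
  proof eventually_elim
    case (elim x)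
    then show ?case using f(2) by (intro LIMSEQ_le_const[OF elim(1)]) auto
  qed
  have "(\<integral>\<^sup>+x. ennreal (g x) \<partial>M) = (\<integral>\<^sup>+x. liminf (\<lambda>k. ennreal (f k x)) \<partial>M)"
  proof (rule nn_integral_cong_AE)
    show "AE x in M. ennreal (g x) = liminf (\<lambda>k. ennreal (f k x))"
      using lim
    proof eventually_elim
      case (elim x)
      then have "(\<lambda>k. ennreal (f k x)) \<longlonglongrightarrow> ennreal (g x)" by (rule tendsto_ennrealI)
      then show ?case by (intro lim_imp_Liminf[symmetric]) auto
    qed
  qed
  also have "\<dots> \<le> liminf (\<lambda>k. \<integral>\<^sup>+x. ennreal (f k x) \<partial>M)"
    by (rule nn_integral_liminf) (use f(1) in auto)
  also have "\<dots> \<le> ennreal C"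
  proof (rule Liminf_le)
    have "(\<integral>\<^sup>+x. ennreal (f k x) \<partial>M) \<le> ennreal C" for k
      using f by (subst nn_integral_eq_integral) (auto intro!: ennreal_leI)
    then show "\<forall>\<^sub>F k in sequentially. (\<integral>\<^sup>+x. ennreal (f k x) \<partial>M) \<le> ennreal C" by simp
  qed simp
  finally have le: "(\<integral>\<^sup>+x. ennreal (g x) \<partial>M) \<le> ennreal C" .
  then show int: "integrable M g"
    using le_less_trans[OF le ennreal_less_top] by (intro integrableI_nonneg g nonneg) simp
  have "ennreal (\<integral>x. g x \<partial>M) \<le> ennreal C"
    using le by (simp add: nn_integral_eq_integral[OF int nonneg])
  then show "(\<integral>x. g x \<partial>M) \<le> C" using C by (simp add: ennreal_le_iff)
qed

lemma summable_small_tail: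
  fixes w :: "int \<Rightarrow> real"
  assumes w: "\<And>n. w n \<ge> 0" and bd: "\<And>F. finite F \<Longrightarrow> sum w F \<le> B" and "e > 0"
  obtains N :: nat where "\<And>F. finite F \<Longrightarrow> F \<inter> {- int N..int N} = {} \<Longrightarrow> sum w F \<le> e"
proof -
  define s where "s = (SUP F\<in>{F. finite F}. sum w F)"
  have bdd: "bdd_above (sum w ` {F. finite F})" by (rule bdd_aboveI2[of _ _ B]) (use bd in auto)
  have "s - e < s" using \<open>e > 0\<close> by simp
  then have "\<exists>X\<in>{F. finite F}. s - e < sum w X"
    unfolding s_def by (subst (asm) less_cSUP_iff[OF _ bdd]) auto
  then obtain X where X: "finite X" "s - e < sum w X" by auto
  define N where "N = nat (Max (insert 0 (abs ` X)))"
  have "\<bar>n\<bar> \<le> int N" if "n \<in> X" for n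
  proof -
    have "\<bar>n\<bar> \<le> Max (insert 0 (abs ` X))" using X(1) that by (intro Max_ge) auto
    moreover have "0 \<le> Max (insert 0 (abs ` X))" using X(1) by (intro Max_ge) auto
    ultimately show ?thesis by (simp add: N_def)
  qed
  then have XN: "X \<subseteq> {- int N..int N}" by (auto simp: abs_le_iff minus_le_iff)
  have "sum w F \<le> e" if "finite F" "F \<inter> {- int N..int N} = {}" for F
  proof -
    have "sum w (X \<union> F) \<le> s" unfolding s_def by (rule cSUP_upper) (use X that bdd in auto)
    moreover have "sum w (X \<union> F) = sum w X + sum w F"
      by (rule sum.union_disjoint) (use X that XN in auto)
    ultimately show ?thesis using X(2) by linarith
  qed
  then show thesis by (rule that)
qed

text \<open>Elements of \<open>L2\<close> are periodic at every point, whereas limits are obtained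
  almost everywhere on one period. This is the periodic extension of the values on the half-open
  period from -\<pi>, so at \<pi> it takes the value at -\<pi>.\<close>

definition periodize :: "(real \<Rightarrow> real) \<Rightarrow> real \<Rightarrow> real" where
  "periodize h x = h (x - 2 * pi * of_int \<lfloor>(x + pi) / (2 * pi)\<rfloor>)"

lemma periodize_periodic: "periodize h (x + 2 * pi) = periodize h x"
proof -
  have "(x + 2 * pi + pi) / (2 * pi) = (x + pi) / (2 * pi) + 1" by (simp add: field_simps)
  then have "\<lfloor>(x + 2 * pi + pi) / (2 * pi)\<rfloor> = \<lfloor>(x + pi) / (2 * pi)\<rfloor> + 1" by simp
  then show ?thesis unfolding periodize_def by (simp add: algebra_simps)
qed

lemma periodize_eq:
  assumes "x \<in> {- pi..pi}" "x \<noteq> pi"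
  shows "periodize h x = h x"
proof -
  have "\<lfloor>(x + pi) / (2 * pi)\<rfloor> = 0" using assms by (intro floor_unique) (auto simp: field_simps)
  then show ?thesis by (simp add: periodize_def)
qed

lemma AE_circ_neq: "AE x in circ. x \<noteq> a"
proof -
  have "AE x in lebesgue. x \<notin> {a}"
    by (intro AE_not_in) (auto intro: null_sets_completionI finite_imp_null_set_lborel)
  then show ?thesis by (subst AE_restrict_space_iff) auto
qed

lemma AE_circ_periodize: "AE x in circ. periodize h x = h x"
  using AE_circ_neq[of pi] AE_space by eventually_elim (auto intro: periodize_eq)

lemma borel_measurable_circ_periodize:
  assumes "h \<in> borel_measurable circ"
  shows "periodize h \<in> borel_measurable circ"
proof -
  have "{x \<in> space circ. x = pi} = {pi}" by auto
  then have "{x \<in> space circ. x = pi} \<in> sets circ" by (simp add: sets_restrict_space_iff)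
  then have "(\<lambda>x. if x = pi then h (- pi) else h x) \<in> borel_measurable circ"
    using assms by (intro measurable_If) auto
  also have "?this \<longleftrightarrow> periodize h \<in> borel_measurable circ"
    by (rule measurable_cong) (auto simp: periodize_eq, simp add: periodize_def)
  finally show ?thesis .
qed

text \<open>Partial sums are taken along windows with L^2 tails of size 4^-k, so that the L^1 norms
  of consecutive blocks are summable and the block series converges absolutely almost everywhere.
  Dominated convergence identifies the coefficients of the limit, and Fatou bounds its L^2
  norm.\<close>

theorem riesz_fischer:
  fixes c :: "int \<Rightarrow> complex"
  assumes c: "\<And>n. c (- n) = cnj (c n)" and bd: "\<And>F. finite F \<Longrightarrow> (\<Sum>n\<in>F. (cmod (c n))\<^sup>2) \<le> B"
  obtains g where "g \<in> L2" "\<And>n. fourier_coeff g n = c n" "(L2_norm g)\<^sup>2 \<le> 2 * pi * B"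
proof -
  have "\<exists>N::nat. \<forall>F. finite F \<longrightarrow> F \<inter> {- int N..int N} = {} \<longrightarrow> (\<Sum>n\<in>F. (cmod (c n))\<^sup>2) \<le> (1 / 4) ^ k" for k
    using summable_small_tail[of "\<lambda>n. (cmod (c n))\<^sup>2" B "(1 / 4) ^ k"] bd by (metis zero_le_power2 zero_less_divide_1_iff zero_less_numeral zero_less_power)
  then obtain N0 :: "nat \<Rightarrow> nat" where N0: "\<And>k F. finite F \<Longrightarrow> F \<inter> {- int (N0 k)..int (N0 k)} = {} \<Longrightarrow> (\<Sum>n\<in>F. (cmod (c n))\<^sup>2) \<le> (1 / 4) ^ k"
    by metis
  \<comment> \<open>The sum makes the windows increase and pass N0 k; the summand k makes them
    exhaust the integers.\<close>
  define M where "M k = k + (\<Sum>i\<le>k. N0 i)" for k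
  have M_mono: "M k \<le> M (Suc k)" and M_N0: "N0 k \<le> M k" and M_ge: "k \<le> M k" for k
    by (auto simp: M_def intro!: trans_le_add2 member_le_sum)
  define I where "I k = {- int (M k)..int (M k)}" for k
  define S where "S k = trig c (I k)" for k
  define D where "D k = trig c (I (Suc k) - I k)" for k
  have I: "finite (I k)" "I k \<subseteq> I (Suc k)" for k using M_mono[of k] by (auto simp: I_def)
  have SD: "S (Suc k) x - S k x = D k x" for k x
    unfolding S_def D_def trig_def using sum_diff[OF I(1) I(2), of "\<lambda>n. c n * cis (of_int n * x)" k] by simp
  have S_sum: "(\<Sum>k<K. D k x) = S K x - S 0 x" for K x
    using sum_lessThan_telescope[of "\<lambda>k. S k x" K] by (simp add: SD)
  have D_int: "integrable circ (D k)" "integrable circ (\<lambda>x. (cmod (D k x))\<^sup>2)" for k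
    unfolding D_def by (intro integrable_circ_continuous continuous_intros continuous_trig)+
  have S_int: "integrable circ (S k)" "integrable circ (\<lambda>x. (cmod (S k x))\<^sup>2)" for k
    unfolding S_def by (intro integrable_circ_continuous continuous_intros continuous_trig)+
  have D2: "(\<integral>x. (cmod (D k x))\<^sup>2 \<partial>circ) \<le> 2 * pi * (1 / 4) ^ k" for k
    unfolding D_def using I M_N0[of k]
    by (subst integral_norm_trig) (auto intro!: mult_left_mono N0 simp: I_def)
  have D1: "(\<integral>x. cmod (D k x) \<partial>circ) \<le> 2 * pi * (1 / 2) ^ k" for k
  proof -
    \<comment> \<open>Weight in |D| <= q / 2 + |D|^2 / (2 q), balanced so that both terms integrate
      to at most \<pi> q.\<close>
    define q :: real where "q = (1 / 2) ^ k"
    have q: "q > 0" "q\<^sup>2 = (1 / 4) ^ k" by (auto simp: q_def power2_eq_square simp flip: power_mult_distrib)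
    have "cmod (D k x) \<le> 1 / 2 * q + (1 / (2 * q)) * (cmod (D k x))\<^sup>2" for x
    proof -
      have "0 \<le> (cmod (D k x) - q)\<^sup>2" by simp
      then have "2 * cmod (D k x) * q \<le> q\<^sup>2 + (cmod (D k x))\<^sup>2" by (simp add: power2_diff)
      then show ?thesis using q(1) by (simp add: field_simps power2_eq_square)
    qed
    then have "(\<integral>x. cmod (D k x) \<partial>circ) \<le> (\<integral>x. 1 / 2 * q + (1 / (2 * q)) * (cmod (D k x))\<^sup>2 \<partial>circ)"
      using D_int finite_measure.integrable_const[OF finite_measure_circ]
      by (intro integral_mono Bochner_Integration.integrable_add integrable_mult_right integrable_norm)
    also have "\<dots> = pi * q + (1 / (2 * q)) * (\<integral>x. (cmod (D k x))\<^sup>2 \<partial>circ)"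
      using D_int(2) finite_measure.integrable_const[OF finite_measure_circ]
      by (subst Bochner_Integration.integral_add) (auto simp: measure_restrict_space)
    also have "\<dots> \<le> pi * q + (1 / (2 * q)) * (2 * pi * q\<^sup>2)"
      using D2[of k] q by (intro add_left_mono mult_left_mono) auto
    also have "\<dots> = 2 * pi * q" using q(1) by (simp add: power2_eq_square)
    finally show ?thesis by (simp add: q_def)
  qed
  have geo: "summable (\<lambda>k. 2 * pi * (1 / 2) ^ k)" by (intro summable_mult summable_geometric) simp
  have sum_int: "summable (\<lambda>k. \<integral>x. cmod (D k x) \<partial>circ)"
    by (rule summable_comparison_test[OF _ geo]) (use D1 in auto)
  have AE_sum: "AE x in circ. summable (\<lambda>k. cmod (D k x))"
  proof -
    have "(\<integral>\<^sup>+x. (\<Sum>k. ennreal (cmod (D k x))) \<partial>circ) = (\<Sum>k. \<integral>\<^sup>+x. ennreal (cmod (D k x)) \<partial>circ)"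
      by (rule nn_integral_suminf) (use D_int(1) in auto)
    also have "\<dots> = (\<Sum>k. ennreal (\<integral>x. cmod (D k x) \<partial>circ))"
      using D_int(1) by (subst nn_integral_eq_integral) auto
    also have "\<dots> \<noteq> top" using sum_int by (rule ennreal_suminf_neq_top) simp
    finally have "AE x in circ. (\<Sum>k. ennreal (cmod (D k x))) \<noteq> \<infinity>"
      by (intro nn_integral_PInf_AE) (use D_int(1) in auto)
    then show ?thesis
      by eventually_elim (auto intro: summable_suminf_not_top)
  qed
  define H where "H x = S 0 x + (\<Sum>k. D k x)" for x
  have S_lim: "AE x in circ. (\<lambda>k. S k x) \<longlonglongrightarrow> H x"
    using AE_sum
  proof eventually_elim
    case (elim x)
    then have "summable (\<lambda>k. D k x)" by (rule summable_norm_cancel)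
    then have "(\<lambda>K. \<Sum>k<K. D k x) \<longlonglongrightarrow> (\<Sum>k. D k x)" by (rule summable_LIMSEQ)
    then have "(\<lambda>K. S 0 x + (\<Sum>k<K. D k x)) \<longlonglongrightarrow> H x" unfolding H_def by (intro tendsto_intros)
    then show ?case by (simp add: S_sum)
  qed
  have H_int: "integrable circ H"
    unfolding H_def by (intro Bochner_Integration.integrable_add S_int integrable_suminf D_int AE_sum sum_int)
  have w_int: "integrable circ (\<lambda>x. cmod (S 0 x) + (\<Sum>k. cmod (D k x)))"
    using D_int S_int AE_sum sum_int
    by (intro Bochner_Integration.integrable_add integrable_norm integrable_suminf) auto
  have H_coeff: "(\<integral>x. H x * cis (- (of_int n * x)) \<partial>circ) = complex_of_real (2 * pi) * c n" for n
  proof (rule LIMSEQ_unique)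
    have mc: "(\<lambda>x. cis (- (of_int n * x))) \<in> borel_measurable circ"
      by (intro borel_measurable_circ_continuous continuous_intros)
    show "(\<lambda>k. \<integral>x. S k x * cis (- (of_int n * x)) \<partial>circ) \<longlonglongrightarrow> (\<integral>x. H x * cis (- (of_int n * x)) \<partial>circ)"
    proof (rule integral_dominated_convergence[OF _ _ w_int])
      show "AE x in circ. (\<lambda>k. S k x * cis (- (of_int n * x))) \<longlonglongrightarrow> H x * cis (- (of_int n * x))"
        using S_lim by eventually_elim (intro tendsto_intros)
      show "AE x in circ. norm (S K x * cis (- (of_int n * x))) \<le> cmod (S 0 x) + (\<Sum>k. cmod (D k x))" for K
        using AE_sum
      proof eventually_elim
        case (elim x)
        have "S K x = S 0 x + (\<Sum>k<K. D k x)" by (simp add: S_sum)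
        then have "cmod (S K x) \<le> cmod (S 0 x) + (\<Sum>k<K. cmod (D k x))"
          by (metis norm_triangle_le norm_sum add_left_mono)
        also have "\<dots> \<le> cmod (S 0 x) + (\<Sum>k. cmod (D k x))"
          using elim by (intro add_left_mono sum_le_suminf) auto
        finally show ?case by (simp add: norm_mult)
      qed
    qed (use H_int S_int mc in auto)
    show "(\<lambda>k. \<integral>x. S k x * cis (- (of_int n * x)) \<partial>circ) \<longlonglongrightarrow> complex_of_real (2 * pi) * c n"
    proof (rule tendsto_eventually, rule eventually_sequentiallyI)
      fix k assume "nat \<bar>n\<bar> \<le> k"
      then have "n \<in> I k" using M_ge[of k] by (auto simp: I_def)
      then show "(\<integral>x. S k x * cis (- (of_int n * x)) \<partial>circ) = complex_of_real (2 * pi) * c n"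
        unfolding S_def integral_trig_cis[OF I(1)] by simp
    qed
  qed
  have H2: "integrable circ (\<lambda>x. (cmod (H x))\<^sup>2)" "(\<integral>x. (cmod (H x))\<^sup>2 \<partial>circ) \<le> 2 * pi * B"
  proof -
    have 1: "(\<integral>x. (cmod (S k x))\<^sup>2 \<partial>circ) \<le> 2 * pi * B" for k
      unfolding S_def integral_norm_trig[OF I(1)] by (intro mult_left_mono bd I) simp
    have 2: "AE x in circ. (\<lambda>k. (cmod (S k x))\<^sup>2) \<longlonglongrightarrow> (cmod (H x))\<^sup>2"
      using S_lim by eventually_elim (intro tendsto_intros)
    have 3: "(\<lambda>x. (cmod (H x))\<^sup>2) \<in> borel_measurable circ" using H_int by measurable
    note fatou = fatou_bound[OF S_int(2) _ 1 2 3]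
    show "integrable circ (\<lambda>x. (cmod (H x))\<^sup>2)" "(\<integral>x. (cmod (H x))\<^sup>2 \<partial>circ) \<le> 2 * pi * B"
      by (rule fatou, simp)+
  qed
  define g where "g = periodize (\<lambda>x. Re (H x))"
  have gH: "AE x in circ. g x = Re (H x)" unfolding g_def by (rule AE_circ_periodize)
  have mRe: "(\<lambda>x. Re (H x)) \<in> borel_measurable circ" using H_int by measurable
  have gm: "g \<in> borel_measurable circ" unfolding g_def by (rule borel_measurable_circ_periodize[OF mRe])
  have g2: "AE x in circ. (g x)\<^sup>2 \<le> (cmod (H x))\<^sup>2"
    using gH by eventually_elim (metis abs_Re_le_cmod abs_ge_zero power2_abs power_mono)
  have gi: "integrable circ (\<lambda>x. (g x)\<^sup>2)"
    by (rule Bochner_Integration.integrable_bound[OF H2(1)]) (use gm g2 in auto)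
  have gL2: "g \<in> L2" unfolding L2_def using gm gi by (auto simp: g_def periodize_periodic)
  show thesis
  proof (rule that[OF gL2])
    show "(L2_norm g)\<^sup>2 \<le> 2 * pi * B"
    proof -
      have "(\<integral>x. (g x)\<^sup>2 \<partial>circ) \<le> (\<integral>x. (cmod (H x))\<^sup>2 \<partial>circ)" by (rule integral_mono_AE[OF gi H2(1) g2])
      then show ?thesis using H2(2) by (simp add: L2_norm_def)
    qed
    fix n
    have Hc: "integrable circ (\<lambda>x. H x * cis (of_int m * x))" for m by (intro integrable_circ_mult_cis H_int)
    have Hcc: "integrable circ (\<lambda>x. cnj (H x * cis (of_int m * x)))" for m
      by (rule integrable_bounded_linear[OF bounded_linear_cnj Hc])
    \<comment> \<open>Passing to the real part replaces c n by (c n + cnj (c (-n))) / 2, which is c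
      n again by the symmetry of c.\<close>
    have "(\<integral>x. complex_of_real (g x) * cis (- (of_int n * x)) \<partial>circ)
        = (\<integral>x. (H x * cis (of_int (- n) * x) + cnj (H x * cis (of_int n * x))) / 2 \<partial>circ)"
    proof (rule integral_cong_AE)
      show "AE x in circ. complex_of_real (g x) * cis (- (of_int n * x))
          = (H x * cis (of_int (- n) * x) + cnj (H x * cis (of_int n * x))) / 2"
        using gH
      proof eventually_elim
        case (elim x)
        have "complex_of_real (Re z) * w = (z * w + cnj z * w) / 2" for z w
        proof -
          have "complex_of_real (Re z) = (z + cnj z) / 2" by (simp add: complex_eq_iff)
          then show ?thesis by (simp only: times_divide_eq_left distrib_right)
        qed
        from this[of "H x" "cis (- (of_int n * x))"] show ?case unfolding elim by (simp add: cis_cnj)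
      qed
      show "(\<lambda>x. complex_of_real (g x) * cis (- (of_int n * x))) \<in> borel_measurable circ"
      proof (rule borel_measurable_times)
        show "(\<lambda>x. complex_of_real (g x)) \<in> borel_measurable circ" using gm by measurable
      qed (intro borel_measurable_circ_continuous continuous_intros)
      show "(\<lambda>x. (H x * cis (of_int (- n) * x) + cnj (H x * cis (of_int n * x))) / 2) \<in> borel_measurable circ"
        by (intro borel_measurable_integrable integrable_divide_zero Bochner_Integration.integrable_add Hc Hcc)
    qed
    also have "\<dots> = ((\<integral>x. H x * cis (of_int (- n) * x) \<partial>circ) + cnj (\<integral>x. H x * cis (of_int n * x) \<partial>circ)) / 2"
      by (simp only: integral_divide_zero Bochner_Integration.integral_add[OF Hc Hcc] Bochner_Integration.integral_cnj)
    also have "\<dots> = complex_of_real (2 * pi) * c n"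
      using H_coeff[of n] H_coeff[of "- n"] by (simp add: c)
    finally show "fourier_coeff g n = c n" by (simp add: fourier_coeff_def)
  qed
qed

lemma fourier_coeff_minus: "fourier_coeff f (- n) = cnj (fourier_coeff f n)"
proof -
  have "(\<integral>x. cnj (complex_of_real (f x) * cis (- (of_int n * x))) \<partial>circ)
    = cnj (\<integral>x. complex_of_real (f x) * cis (- (of_int n * x)) \<partial>circ)" by (rule Bochner_Integration.integral_cnj)
  then show ?thesis by (simp add: fourier_coeff_def cis_cnj)
qed

lemma fourier_coeff_diff:
  assumes "integrable circ f" "integrable circ g"
  shows "fourier_coeff (\<lambda>x. f x - g x) n = fourier_coeff f n - fourier_coeff g n"
proof -
  have "(\<integral>x. complex_of_real (f x - g x) * cis (- of_int n * x) \<partial>circ)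
    = (\<integral>x. complex_of_real (f x) * cis (- of_int n * x) \<partial>circ) - (\<integral>x. complex_of_real (g x) * cis (- of_int n * x) \<partial>circ)"
    unfolding of_real_diff left_diff_distrib
    using assms by (intro Bochner_Integration.integral_diff integrable_circ_mult_cis) auto
  then show ?thesis by (simp add: fourier_coeff_def diff_divide_distrib)
qed

text \<open>Converse to \<open>bessel\<close>: the Riesz-Fischer function with the same coefficients
  satisfies the bound and, by uniqueness, equals f almost everywhere.\<close>

lemma L2_norm_le_coeffs:
  assumes f: "f \<in> L2" and bd: "\<And>F. finite F \<Longrightarrow> (\<Sum>n\<in>F. (cmod (fourier_coeff f n))\<^sup>2) \<le> B"
  shows "(L2_norm f)\<^sup>2 \<le> 2 * pi * B"
proof -
  obtain g where g: "g \<in> L2" "\<And>n. fourier_coeff g n = fourier_coeff f n" "(L2_norm g)\<^sup>2 \<le> 2 * pi * B"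
    using riesz_fischer[of "fourier_coeff f" B] fourier_coeff_minus bd by auto
  have i: "integrable circ f" "integrable circ g" using f g(1) L2_integrable by auto
  have "AE x in circ. f x - g x = 0"
    by (rule fourier_coeff_unique) (use i g(2) in \<open>auto simp: fourier_coeff_diff\<close>)
  then have "AE x in circ. (f x)\<^sup>2 = (g x)\<^sup>2" by eventually_elim simp
  then have "(\<integral>x. (f x)\<^sup>2 \<partial>circ) = (\<integral>x. (g x)\<^sup>2 \<partial>circ)"
    using f g(1) by (intro integral_cong_AE) (auto simp: L2_def)
  then show ?thesis using g(3) by (simp add: L2_norm_def)
qed

section \<open>The logarithmic kernel\<close>

text \<open>Abel regularisation, for r < 1, of the logarithmic kernel in \<open>Lambda_inv\<close>,
  which is the case r = 1.\<close>

definition log_kernel :: "real \<Rightarrow> real \<Rightarrow> real \<Rightarrow> real" where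
  "log_kernel \<alpha> r \<beta> = ln ((cmod (1 - of_real r * cis (\<alpha> - \<beta>)))\<^sup>2)"

lemma cmod_one_minus_cis: "(cmod (1 - cis x))\<^sup>2 = 4 * (sin (x / 2))\<^sup>2"
proof -
  have "(cmod (1 - cis x))\<^sup>2 = (1 - cos x)\<^sup>2 + (sin x)\<^sup>2" by (simp add: cmod_power2)
  also have "\<dots> = 2 - 2 * cos x" using sin_cos_squared_add[of x] by (simp add: power2_eq_square algebra_simps)
  also have "cos x = 1 - 2 * (sin (x / 2))\<^sup>2" using cos_double_sin[of "x / 2"] by simp
  finally show ?thesis by simp
qed

lemma log_kernel_1: "log_kernel \<alpha> 1 \<beta> = ln (4 * (sin ((\<alpha> - \<beta>) / 2))\<^sup>2)"
  by (simp add: log_kernel_def cmod_one_minus_cis)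

text \<open>Twice the real part of the power series of Ln (1 - w) at w = r cis (\<alpha> - \<beta>).
  The term k = 0 is zero through division by zero.\<close>

lemma log_kernel_sums:
  assumes "0 \<le> r" "r < 1"
  shows "(\<lambda>k. - 2 * r ^ k / real k * cos (real k * (\<alpha> - \<beta>))) sums log_kernel \<alpha> r \<beta>"
proof -
  define w where "w = of_real r * cis (\<alpha> - \<beta>)"
  have w: "cmod w < 1" using assms by (simp add: w_def norm_mult)
  then have "1 - w \<noteq> 0" by auto
  have "(\<lambda>n. - (w ^ n) / of_nat n) sums ln (1 - w)" using Ln_series'[of "- w"] w by simp
  then have "(\<lambda>n. 2 * Re (- (w ^ n) / of_nat n)) sums (2 * Re (ln (1 - w)))" by (intro sums_mult sums_Re)
  moreover have "2 * Re (- (w ^ n) / of_nat n) = - 2 * r ^ n / real n * cos (real n * (\<alpha> - \<beta>))" for n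
  proof -
    have "w ^ n = of_real (r ^ n) * cis (real n * (\<alpha> - \<beta>))"
      by (simp only: w_def power_mult_distrib of_real_power Complex.DeMoivre)
    moreover have "Re (z / of_nat n) = Re z / real n" for z
      by (metis Re_divide_of_real of_real_of_nat_eq)
    ultimately show ?thesis by simp
  qed
  moreover have "2 * Re (ln (1 - w)) = log_kernel \<alpha> r \<beta>"
    using \<open>1 - w \<noteq> 0\<close> by (simp add: log_kernel_def w_def ln_realpow)
  ultimately show ?thesis by (simp only:)
qed

lemma integral_cos_cis:
  assumes "k \<noteq> 0"
  shows "(\<integral>\<beta>. complex_of_real (cos (real k * (\<alpha> - \<beta>))) * cis (of_int n * \<beta>) \<partial>circ)
    = (if int k = \<bar>n\<bar> then complex_of_real pi * cis (of_int n * \<alpha>) else 0)"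
proof -
  have "complex_of_real (cos (real k * (\<alpha> - \<beta>))) * cis (of_int n * \<beta>)
    = cis (real k * \<alpha>) / 2 * cis (of_int (n - int k) * \<beta>) + cis (- (real k * \<alpha>)) / 2 * cis (of_int (n + int k) * \<beta>)" for \<beta>
  proof -
    have "complex_of_real (cos y) = (cis y + cis (- y)) / 2" for y by (simp add: complex_eq_iff)
    then have "complex_of_real (cos (real k * (\<alpha> - \<beta>))) * cis (of_int n * \<beta>)
      = (cis (real k * (\<alpha> - \<beta>)) * cis (of_int n * \<beta>) + cis (- (real k * (\<alpha> - \<beta>))) * cis (of_int n * \<beta>)) / 2"
      by (simp only: times_divide_eq_left distrib_right)
    also have "cis (real k * (\<alpha> - \<beta>)) * cis (of_int n * \<beta>) = cis (real k * \<alpha>) * cis (of_int (n - int k) * \<beta>)"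
      by (simp only: cis_mult) (simp add: algebra_simps)
    also have "cis (- (real k * (\<alpha> - \<beta>))) * cis (of_int n * \<beta>) = cis (- (real k * \<alpha>)) * cis (of_int (n + int k) * \<beta>)"
      by (simp only: cis_mult) (simp add: algebra_simps)
    finally show ?thesis by (simp add: add_divide_distrib)
  qed
  then have "(\<integral>\<beta>. complex_of_real (cos (real k * (\<alpha> - \<beta>))) * cis (of_int n * \<beta>) \<partial>circ)
    = cis (real k * \<alpha>) / 2 * (\<integral>\<beta>. cis (of_int (n - int k) * \<beta>) \<partial>circ)
      + cis (- (real k * \<alpha>)) / 2 * (\<integral>\<beta>. cis (of_int (n + int k) * \<beta>) \<partial>circ)"
    by (simp only: Bochner_Integration.integral_add[OF integrable_mult_right[OF integrable_circ_continuous[OF continuous_cis_mult]]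
          integrable_mult_right[OF integrable_circ_continuous[OF continuous_cis_mult]]] integral_mult_right_zero)
  also have "\<dots> = (if int k = \<bar>n\<bar> then complex_of_real pi * cis (of_int n * \<alpha>) else 0)"
  proof (cases "n \<ge> 0")
    case True
    then have "n + int k \<noteq> 0" "\<bar>n\<bar> = n" "n - int k = 0 \<longleftrightarrow> int k = n" using assms by auto
    moreover have "real k * \<alpha> = of_int n * \<alpha>" if "int k = n" using that by auto
    ultimately show ?thesis by (simp only: integral_cis) auto
  next
    case False
    then have "n - int k \<noteq> 0" "\<bar>n\<bar> = - n" "n + int k = 0 \<longleftrightarrow> int k = - n" using assms by auto
    moreover have "- (real k * \<alpha>) = of_int n * \<alpha>" if "int k = - n"
    proof -
      have "real k = - of_int n" using that by (metis of_int_minus of_int_of_nat_eq)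
      then show ?thesis by simp
    qed
    ultimately show ?thesis by (simp only: integral_cis) auto
  qed
  finally show ?thesis .
qed

text \<open>The geometric majorant 2 r^k permits termwise integration, and orthogonality keeps only
  k = |n|. For n = 0 the right-hand side is 0 by division by zero, so the kernel has mean
  zero.\<close>

lemma log_kernel_fourier:
  assumes r: "0 \<le> r" "r < 1"
  shows "(\<integral>\<beta>. complex_of_real (log_kernel \<alpha> r \<beta>) * cis (of_int n * \<beta>) \<partial>circ)
    = - complex_of_real (2 * pi * r ^ nat \<bar>n\<bar> / \<bar>of_int n\<bar>) * cis (of_int n * \<alpha>)"
    and "integrable circ (log_kernel \<alpha> r)"
proof -
  let ?c = "\<lambda>k. - 2 * r ^ k / real k"
  let ?f = "\<lambda>k \<beta>. complex_of_real (?c k) * (complex_of_real (cos (real k * (\<alpha> - \<beta>))) * cis (of_int n * \<beta>))"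
  have c_le: "\<bar>?c k\<bar> \<le> 2 * r ^ k" for k
  proof (cases "k = 0")
    case False
    then show ?thesis using r by (simp add: abs_mult divide_le_eq mult_le_cancel_left1)
  qed (use r in simp)
  have geo: "summable (\<lambda>k. 2 * r ^ k)" by (intro summable_mult summable_geometric) (use r in simp)
  have f_le: "cmod (?f k \<beta>) \<le> 2 * r ^ k" for k \<beta>
  proof -
    have "cmod (?f k \<beta>) = \<bar>?c k\<bar> * \<bar>cos (real k * (\<alpha> - \<beta>))\<bar>" by (simp only: norm_mult norm_of_real norm_cis)
    also have "\<dots> \<le> 2 * r ^ k * 1" by (intro mult_mono c_le abs_cos_le_one) (use r in auto)
    finally show ?thesis by simp
  qed
  have f_int: "integrable circ (?f k)" for k
    by (intro integrable_circ_continuous continuous_intros)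
  have eq: "(\<Sum>k. ?f k \<beta>) = complex_of_real (log_kernel \<alpha> r \<beta>) * cis (of_int n * \<beta>)" for \<beta>
  proof -
    have "(\<lambda>k. complex_of_real (?c k * cos (real k * (\<alpha> - \<beta>))) * cis (of_int n * \<beta>)) sums (complex_of_real (log_kernel \<alpha> r \<beta>) * cis (of_int n * \<beta>))"
      by (intro sums_mult2 sums_of_real log_kernel_sums r)
    then show ?thesis by (simp add: sums_iff mult.assoc)
  qed
  have s1: "AE \<beta> in circ. summable (\<lambda>k. norm (?f k \<beta>))"
    by (intro AE_I2 summable_comparison_test[OF _ geo]) (use f_le in auto)
  have s2: "summable (\<lambda>k. \<integral>\<beta>. norm (?f k \<beta>) \<partial>circ)"
  proof (rule summable_comparison_test)
    show "summable (\<lambda>k. 2 * pi * (2 * r ^ k))" by (intro summable_mult geo)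
    have "(\<integral>\<beta>. norm (?f k \<beta>) \<partial>circ) \<le> (\<integral>\<beta>. 2 * r ^ k \<partial>circ)" for k
      by (intro integral_mono f_le integrable_norm f_int finite_measure.integrable_const[OF finite_measure_circ])
    also have "(\<integral>\<beta>. 2 * r ^ k \<partial>circ) = 2 * pi * (2 * r ^ k)" for k by (simp add: measure_restrict_space)
    finally show "\<exists>N. \<forall>k\<ge>N. norm (\<integral>\<beta>. norm (?f k \<beta>) \<partial>circ) \<le> 2 * pi * (2 * r ^ k)" by simp
  qed
  have "(\<lambda>k. \<integral>\<beta>. ?f k \<beta> \<partial>circ) sums (\<integral>\<beta>. complex_of_real (log_kernel \<alpha> r \<beta>) * cis (of_int n * \<beta>) \<partial>circ)"
    using sums_integral[OF f_int s1 s2] by (simp only: eq)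
  moreover have "(\<lambda>k. \<integral>\<beta>. ?f k \<beta> \<partial>circ) sums (- complex_of_real (2 * pi * r ^ nat \<bar>n\<bar> / \<bar>of_int n\<bar>) * cis (of_int n * \<alpha>))"
  proof -
    have coeff: "(\<integral>\<beta>. ?f k \<beta> \<partial>circ) = (if k = nat \<bar>n\<bar> then - complex_of_real (2 * pi * r ^ nat \<bar>n\<bar> / \<bar>of_int n\<bar>) * cis (of_int n * \<alpha>) else 0)" for k
    proof (cases "k = 0")
      case False
      show ?thesis
      proof (cases "k = nat \<bar>n\<bar>")
        case True
        then have "int k = \<bar>n\<bar>" by simp
        then have "real k = \<bar>of_int n\<bar>" by (metis of_int_abs of_int_of_nat_eq)
        then show ?thesis unfolding integral_mult_right_zero integral_cos_cis[OF False] using \<open>int k = \<bar>n\<bar>\<close> True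
          by (simp add: mult.commute mult.left_commute)
      next
        case F: False
        then have "int k \<noteq> \<bar>n\<bar>" by auto
        then show ?thesis unfolding integral_mult_right_zero integral_cos_cis[OF False] using F by simp
      qed
    qed auto
    show ?thesis unfolding coeff by (rule sums_single)
  qed
  ultimately show "(\<integral>\<beta>. complex_of_real (log_kernel \<alpha> r \<beta>) * cis (of_int n * \<beta>) \<partial>circ)
    = - complex_of_real (2 * pi * r ^ nat \<bar>n\<bar> / \<bar>of_int n\<bar>) * cis (of_int n * \<alpha>)"
    by (rule sums_unique2)
  have nz: "1 - complex_of_real r * cis (\<alpha> - \<beta>) \<noteq> 0" for \<beta>
  proof
    assume "1 - complex_of_real r * cis (\<alpha> - \<beta>) = 0"
    then have "cmod (complex_of_real r * cis (\<alpha> - \<beta>)) = 1" by simp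
    then show False using r by (simp add: norm_mult)
  qed
  show "integrable circ (log_kernel \<alpha> r)"
    unfolding log_kernel_def
    by (intro integrable_circ_continuous continuous_on_ln continuous_intros) (use nz in auto)
qed

text \<open>The regularisation is removed along r tending to 1. The singular points form a countable
  set; away from them the kernels converge, bounded above by ln 4 and below by the limit minus ln
  4.\<close>

lemma log_kernel_limit:
  shows "integrable circ (log_kernel \<alpha> 1)"
    and "(\<integral>\<beta>. complex_of_real (log_kernel \<alpha> 1 \<beta>) * cis (of_int n * \<beta>) \<partial>circ)
      = - complex_of_real (2 * pi / \<bar>of_int n\<bar>) * cis (of_int n * \<alpha>)"
proof -
  define r where "r m = 1 - 1 / real (m + 2)" for m
  have r: "0 \<le> r m" "r m < 1" for m by (auto simp: r_def)
  have r_lim: "r \<longlonglongrightarrow> 1"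
  proof -
    have "(\<lambda>m. 1 - 1 / real (m + 2)) \<longlonglongrightarrow> 1 - 0"
      by (intro tendsto_intros LIMSEQ_ignore_initial_segment[of "\<lambda>m. 1 / real m"] lim_1_over_n)
    then show ?thesis by (simp add: r_def[abs_def])
  qed
  define Z where "Z = {\<beta>. cis (\<alpha> - \<beta>) = 1}"
  have "Z \<subseteq> (\<lambda>k. \<alpha> - 2 * pi * of_int k) ` UNIV"
  proof
    fix \<beta> assume "\<beta> \<in> Z"
    then have "cos (\<alpha> - \<beta>) = 1" by (simp add: Z_def complex_eq_iff)
    then obtain k :: int where "\<alpha> - \<beta> = of_int k * 2 * pi" unfolding cos_one_2pi_int by auto
    then have "\<beta> = \<alpha> - 2 * pi * of_int k" by (simp add: algebra_simps)
    then show "\<beta> \<in> (\<lambda>k. \<alpha> - 2 * pi * of_int k) ` UNIV" by blast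
  qed
  then have "countable Z" by (rule countable_subset) auto
  then have "AE \<beta> in lebesgue. \<beta> \<notin> Z"
    by (intro AE_not_in null_sets_completionI countable_imp_null_set_lborel)
  then have Z: "AE \<beta> in circ. \<beta> \<notin> Z" by (subst AE_restrict_space_iff) auto
  have lim: "AE \<beta> in circ. (\<lambda>m. log_kernel \<alpha> (r m) \<beta>) \<longlonglongrightarrow> log_kernel \<alpha> 1 \<beta>"
    using Z
  proof eventually_elim
    case (elim \<beta>)
    then have nz: "1 - of_real 1 * cis (\<alpha> - \<beta>) \<noteq> 0" by (auto simp: Z_def)
    show ?case unfolding log_kernel_def
      by (rule tendsto_ln, intro tendsto_intros r_lim) (use nz in auto)
  qed
  have upper: "log_kernel \<alpha> (r m) \<beta> \<le> ln 4" for m \<beta>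
  proof -
    let ?w = "of_real (r m) * cis (\<alpha> - \<beta>)"
    have "cmod ?w < 1" using r[of m] by (simp add: norm_mult)
    then have "1 - ?w \<noteq> 0" by auto
    have "cmod (1 - ?w) \<le> 2" using norm_triangle_ineq4[of 1 ?w] \<open>cmod ?w < 1\<close> by simp
    then have "(cmod (1 - ?w))\<^sup>2 \<le> 2\<^sup>2" by (intro power_mono) auto
    then show ?thesis unfolding log_kernel_def using \<open>1 - ?w \<noteq> 0\<close> by (intro ln_mono) auto
  qed
  \<comment> \<open>Moving from cis (\<alpha> - \<beta>) to r cis (\<alpha> - \<beta>) costs 1 - r,
    itself at most |1 - r cis (\<alpha> - \<beta>)|. Hence |1 - cis (\<alpha> - \<beta>)| at most
    doubles the regularised distance, which is ln 4 after squaring.\<close>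
  have lower: "AE \<beta> in circ. \<forall>m. log_kernel \<alpha> 1 \<beta> - ln 4 \<le> log_kernel \<alpha> (r m) \<beta>"
    using Z
  proof eventually_elim
    case (elim \<beta>)
    let ?e = "cis (\<alpha> - \<beta>)"
    have nz: "cmod (1 - ?e) > 0" using elim by (auto simp: Z_def)
    show ?case
    proof
      fix m
      have "cmod (1 - ?e) \<le> cmod (1 - of_real (r m) * ?e) + cmod (of_real (r m) * ?e - ?e)"
        using norm_triangle_ineq[of "1 - of_real (r m) * ?e" "of_real (r m) * ?e - ?e"] by simp
      also have "cmod (of_real (r m) * ?e - ?e) = 1 - r m"
      proof -
        have "of_real (r m) * ?e - ?e = - (of_real (1 - r m) * ?e)" by (simp add: algebra_simps)
        then show ?thesis using r[of m] by (simp only: norm_minus_cancel norm_mult norm_of_real norm_cis) simp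
      qed
      also have "1 - r m \<le> cmod (1 - of_real (r m) * ?e)"
        using norm_triangle_ineq2[of 1 "of_real (r m) * ?e"] r[of m] by (simp add: norm_mult)
      finally have le: "cmod (1 - ?e) \<le> 2 * cmod (1 - of_real (r m) * ?e)" by simp
      then have "(cmod (1 - ?e))\<^sup>2 \<le> (2 * cmod (1 - of_real (r m) * ?e))\<^sup>2" by (intro power_mono) auto
      then have "ln ((cmod (1 - ?e))\<^sup>2) \<le> ln (4 * (cmod (1 - of_real (r m) * ?e))\<^sup>2)"
        using nz by (intro ln_mono) (auto simp: power_mult_distrib)
      also have "\<dots> = ln 4 + ln ((cmod (1 - of_real (r m) * ?e))\<^sup>2)"
      proof -
        have "0 < cmod (1 - of_real (r m) * ?e)" using nz le by linarith
        then show ?thesis by (simp add: ln_mult)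
      qed
      finally show "log_kernel \<alpha> 1 \<beta> - ln 4 \<le> log_kernel \<alpha> (r m) \<beta>" by (simp add: log_kernel_def)
    qed
  qed
  have meas: "log_kernel \<alpha> 1 \<in> borel_measurable circ"
  proof -
    have "log_kernel \<alpha> 1 = (\<lambda>\<beta>. ln (4 * (sin ((\<alpha> - \<beta>) / 2))\<^sup>2))" by (simp add: fun_eq_iff log_kernel_1)
    also have "\<dots> \<in> borel_measurable borel" by measurable
    finally have "log_kernel \<alpha> 1 \<in> borel_measurable lborel" by simp
    then show ?thesis by (intro measurable_restrict_space1 measurable_completion)
  qed
  have mean: "(\<integral>\<beta>. log_kernel \<alpha> (r m) \<beta> \<partial>circ) = 0" for m
    using log_kernel_fourier(1)[OF r, of \<alpha> m 0] by simp
  have int_c: "integrable circ (\<lambda>\<beta>. ln 4 :: real)" by (rule finite_measure.integrable_const[OF finite_measure_circ])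
  \<comment> \<open>Integrability of the singularity comes from Fatou: the regularised versions are
    nonnegative, and their integral is exactly 2 \<pi> ln 4 because the kernels have mean
    zero.\<close>
  have "integrable circ (\<lambda>\<beta>. ln 4 - log_kernel \<alpha> 1 \<beta>)"
  proof (rule fatou_bound(1)[where f = "\<lambda>m \<beta>. ln 4 - log_kernel \<alpha> (r m) \<beta>" and C = "2 * pi * ln 4"])
    show "integrable circ (\<lambda>\<beta>. ln 4 - log_kernel \<alpha> (r m) \<beta>)" for m
      by (rule Bochner_Integration.integrable_diff[OF int_c log_kernel_fourier(2)[OF r]])
    show "(\<integral>\<beta>. ln 4 - log_kernel \<alpha> (r m) \<beta> \<partial>circ) \<le> 2 * pi * ln 4" for m
      by (simp add: Bochner_Integration.integral_diff[OF int_c log_kernel_fourier(2)[OF r]] mean measure_restrict_space)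
    show "AE \<beta> in circ. (\<lambda>m. ln 4 - log_kernel \<alpha> (r m) \<beta>) \<longlonglongrightarrow> ln 4 - log_kernel \<alpha> 1 \<beta>"
      using lim by eventually_elim (intro tendsto_intros)
  qed (use upper meas in auto)
  from Bochner_Integration.integrable_diff[OF int_c this] show int: "integrable circ (log_kernel \<alpha> 1)" by simp
  show "(\<integral>\<beta>. complex_of_real (log_kernel \<alpha> 1 \<beta>) * cis (of_int n * \<beta>) \<partial>circ)
      = - complex_of_real (2 * pi / \<bar>of_int n\<bar>) * cis (of_int n * \<alpha>)"
  proof (rule LIMSEQ_unique)
    have mc: "(\<lambda>x. cis (of_int n * x)) \<in> borel_measurable circ"
      by (intro borel_measurable_circ_continuous continuous_intros)
    show "(\<lambda>m. \<integral>\<beta>. complex_of_real (log_kernel \<alpha> (r m) \<beta>) * cis (of_int n * \<beta>) \<partial>circ)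
        \<longlonglongrightarrow> (\<integral>\<beta>. complex_of_real (log_kernel \<alpha> 1 \<beta>) * cis (of_int n * \<beta>) \<partial>circ)"
    proof (rule integral_dominated_convergence[where w = "\<lambda>\<beta>. \<bar>log_kernel \<alpha> 1 \<beta>\<bar> + ln 4"])
      show "integrable circ (\<lambda>\<beta>. \<bar>log_kernel \<alpha> 1 \<beta>\<bar> + ln 4)"
        by (intro Bochner_Integration.integrable_add integrable_abs int int_c)
      show "AE \<beta> in circ. (\<lambda>m. complex_of_real (log_kernel \<alpha> (r m) \<beta>) * cis (of_int n * \<beta>))
          \<longlonglongrightarrow> complex_of_real (log_kernel \<alpha> 1 \<beta>) * cis (of_int n * \<beta>)"
        using lim by eventually_elim (intro tendsto_intros)
      show "AE \<beta> in circ. norm (complex_of_real (log_kernel \<alpha> (r m) \<beta>) * cis (of_int n * \<beta>)) \<le> \<bar>log_kernel \<alpha> 1 \<beta>\<bar> + ln 4" for m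
        using lower
      proof eventually_elim
        case (elim \<beta>)
        have "\<bar>log_kernel \<alpha> (r m) \<beta>\<bar> \<le> \<bar>log_kernel \<alpha> 1 \<beta>\<bar> + ln 4"
          using elim[rule_format, of m] upper[of m \<beta>] ln_ge_zero[of 4] by linarith
        then show ?case by (simp add: norm_mult)
      qed
      show "(\<lambda>\<beta>. complex_of_real (log_kernel \<alpha> (r m) \<beta>) * cis (of_int n * \<beta>)) \<in> borel_measurable circ" for m
        using borel_measurable_integrable[OF log_kernel_fourier(2)[OF r, of \<alpha> m]] mc by measurable
    qed (use meas mc in measurable)
    have "(\<lambda>m. - complex_of_real (2 * pi * r m ^ nat \<bar>n\<bar> / \<bar>of_int n\<bar>) * cis (of_int n * \<alpha>))
        \<longlonglongrightarrow> - complex_of_real (2 * pi * 1 ^ nat \<bar>n\<bar> / \<bar>of_int n\<bar>) * cis (of_int n * \<alpha>)"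
      unfolding divide_inverse by (intro tendsto_intros r_lim)
    then show "(\<lambda>m. \<integral>\<beta>. complex_of_real (log_kernel \<alpha> (r m) \<beta>) * cis (of_int n * \<beta>) \<partial>circ)
        \<longlonglongrightarrow> - complex_of_real (2 * pi / \<bar>of_int n\<bar>) * cis (of_int n * \<alpha>)"
      by (simp only: log_kernel_fourier(1)[OF r] power_one mult_1_right)
  qed
qed

section \<open>Absolutely convergent Fourier series\<close>

definition synth :: "(int \<Rightarrow> complex) \<Rightarrow> real \<Rightarrow> complex" where
  "synth b x = (\<Sum>\<^sub>\<infinity>n. b n * cis (of_int n * x))"

abbreviation l1 :: "(int \<Rightarrow> complex) \<Rightarrow> bool" where
  "l1 b \<equiv> (\<lambda>n. cmod (b n)) summable_on UNIV"

lemma l1_comparison: "M summable_on UNIV \<Longrightarrow> (\<And>n. cmod (b n) \<le> M n) \<Longrightarrow> l1 b"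
  by (rule summable_on_comparison_test) auto

lemma has_sum_synth: "l1 b \<Longrightarrow> ((\<lambda>n. b n * cis (of_int n * x)) has_sum synth b x) UNIV"
  unfolding synth_def by (rule has_sum_infsum, rule abs_summable_summable) (simp add: norm_mult)

text \<open>Enumerating the integers turns unordered sums into series, to which the theorems on
  termwise differentiation and integration apply.\<close>

lemma has_sum_int_sums:
  assumes "(f has_sum s) (UNIV :: int set)"
  shows "(\<lambda>k. f (int_decode k)) sums s"
  using has_sum_reindex_bij_betw[OF bij_int_decode, of f s] assms by (intro has_sum_imp_sums) simp

lemma summable_int_decode:
  fixes M :: "int \<Rightarrow> real"
  shows "M summable_on UNIV \<Longrightarrow> summable (\<lambda>k. M (int_decode k))"
  by (rule sums_summable[OF has_sum_int_sums[OF has_sum_infsum]])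

lemma synth_sums: "l1 b \<Longrightarrow> (\<lambda>k. b (int_decode k) * cis (of_int (int_decode k) * x)) sums synth b x"
  by (rule has_sum_int_sums[OF has_sum_synth])

lemma synth_eqI: "l1 b \<Longrightarrow> ((\<lambda>n. b n * cis (of_int n * x)) has_sum s) UNIV \<Longrightarrow> synth b x = s"
  using has_sum_synth has_sum_unique by blast

lemma synth_cmult: "synth (\<lambda>n. k * b n) x = k * synth b x"
  unfolding synth_def by (simp add: mult.assoc infsum_cmult_right')

lemma synth_add: "l1 b \<Longrightarrow> l1 c \<Longrightarrow> synth (\<lambda>n. b n + c n) x = synth b x + synth c x"
  unfolding synth_def[of "\<lambda>n. b n + c n"] distrib_right
  by (rule infsumI, rule has_sum_add; rule has_sum_synth)

lemma synth_diff: "l1 b \<Longrightarrow> l1 c \<Longrightarrow> synth (\<lambda>n. b n - c n) x = synth b x - synth c x"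
  using synth_add[of b "\<lambda>n. (- 1) * c n" x] synth_cmult[of "- 1" c x] by simp

lemma synth_real:
  assumes "l1 b" "\<And>n. b (- n) = cnj (b n)"
  shows "complex_of_real (Re (synth b x)) = synth b x"
proof -
  have "((\<lambda>n. cnj (b n * cis (of_int n * x))) has_sum cnj (synth b x)) UNIV"
    by (rule iffD2[OF has_sum_cnj_iff has_sum_synth[OF assms(1)]])
  also have "?this \<longleftrightarrow> ((\<lambda>n. b n * cis (of_int n * x)) has_sum cnj (synth b x)) UNIV"
    by (rule has_sum_reindex_bij_witness[where i = uminus and j = uminus]) (auto simp: assms(2) cis_cnj)
  finally have "synth b x = cnj (synth b x)" by (rule synth_eqI[OF assms(1)])
  then show ?thesis by (metis Reals_cnj_iff of_real_Re)
qed

lemma synth_deriv: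
  assumes "l1 b" "(\<lambda>n. \<bar>of_int n\<bar> * cmod (b n)) summable_on UNIV"
  shows "((\<lambda>x. Re (synth b x)) has_real_derivative Re (synth (\<lambda>n. \<i> * of_int n * b n) x)) (at x)"
proof -
  let ?f = "\<lambda>k x. Re (b (int_decode k) * cis (of_int (int_decode k) * x))"
  let ?f' = "\<lambda>k x. Re (\<i> * of_int (int_decode k) * b (int_decode k) * cis (of_int (int_decode k) * x))"
  have l1': "l1 (\<lambda>n. \<i> * of_int n * b n)" using assms(2) by (simp add: norm_mult)
  have f: "(?f k has_real_derivative ?f' k x) (at x within UNIV)" for k x
    by (auto intro!: derivative_eq_intros simp: algebra_simps)
  have unif: "uniformly_convergent_on UNIV (\<lambda>K x. \<Sum>k<K. ?f' k x)"
  proof (rule Weierstrass_m_test')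
    show "norm (?f' k x) \<le> \<bar>of_int (int_decode k)\<bar> * cmod (b (int_decode k))" for k x
      unfolding real_norm_def by (rule order_trans[OF abs_Re_le_cmod]) (simp add: norm_mult)
    show "summable (\<lambda>k. \<bar>of_int (int_decode k)\<bar> * cmod (b (int_decode k)))"
      by (rule summable_int_decode[OF assms(2)])
  qed
  have summ: "summable (\<lambda>k. ?f k 0)" using sums_Re[OF synth_sums[OF assms(1)]] by (rule sums_summable)
  have "((\<lambda>x. \<Sum>k. ?f k x) has_field_derivative (\<Sum>k. ?f' k x)) (at x)"
    by (rule has_field_derivative_series'(2)[OF _ f unif _ summ]) auto
  moreover have "(\<Sum>k. ?f k x) = Re (synth b x)" for x
    using sums_Re[OF synth_sums[OF assms(1)]] by (rule sums_unique[symmetric])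
  moreover have "(\<Sum>k. ?f' k x) = Re (synth (\<lambda>n. \<i> * of_int n * b n) x)"
    using sums_Re[OF synth_sums[OF l1']] by (rule sums_unique[symmetric])
  ultimately show ?thesis by simp
qed

text \<open>A majorant independent of time makes the differentiated series converge uniformly on the
  half-line, one-sided endpoint included. Termwise differentiation yields some antiderivative g,
  which is then identified with the series itself.\<close>

lemma synth_time_deriv:
  fixes a a' :: "real \<Rightarrow> int \<Rightarrow> complex"
  assumes a: "\<And>t n. t \<ge> 0 \<Longrightarrow> ((\<lambda>s. a s n) has_vector_derivative a' t n) (at t within {0..})"
    and l1: "\<And>t. t \<ge> 0 \<Longrightarrow> l1 (a t)"
    and M: "\<And>t n. t \<ge> 0 \<Longrightarrow> cmod (a' t n) \<le> M n" "M summable_on UNIV" and t: "t \<ge> 0"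
  shows "((\<lambda>s. Re (synth (a s) x)) has_real_derivative Re (synth (a' t) x)) (at t within {0..})"
proof -
  let ?f = "\<lambda>k s. Re (a s (int_decode k) * cis (of_int (int_decode k) * x))"
  let ?f' = "\<lambda>k s. Re (a' s (int_decode k) * cis (of_int (int_decode k) * x))"
  have l1': "l1 (a' s)" if "s \<ge> 0" for s by (rule l1_comparison[OF M(2)]) (use M(1) that in auto)
  have f: "(?f k has_real_derivative ?f' k s) (at s within {0..})" if "s \<in> {0..}" for k s
  proof -
    have "((\<lambda>s. a s (int_decode k) * cis (of_int (int_decode k) * x)) has_vector_derivative
        a' s (int_decode k) * cis (of_int (int_decode k) * x)) (at s within {0..})"
      using a[of s "int_decode k"] that by (intro has_vector_derivative_mult_left) auto
    then have "((\<lambda>s. Re (a s (int_decode k) * cis (of_int (int_decode k) * x))) has_vector_derivative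
        Re (a' s (int_decode k) * cis (of_int (int_decode k) * x))) (at s within {0..})"
      by (rule bounded_linear.has_vector_derivative[OF bounded_linear_Re])
    then show ?thesis by (simp add: has_real_derivative_iff_has_vector_derivative)
  qed
  have "uniform_limit {0..} (\<lambda>K s. \<Sum>k<K. ?f' k s) (\<lambda>s. \<Sum>k. ?f' k s) sequentially"
  proof (rule Weierstrass_m_test)
    show "norm (?f' k s) \<le> M (int_decode k)" if "s \<in> {0..}" for k s
    proof -
      have "norm (?f' k s) \<le> cmod (a' s (int_decode k) * cis (of_int (int_decode k) * x))"
        unfolding real_norm_def by (rule abs_Re_le_cmod)
      also have "\<dots> \<le> M (int_decode k)" using M(1)[of s] that by (simp add: norm_mult)
      finally show ?thesis .
    qed
    show "summable (\<lambda>k. M (int_decode k))" by (rule summable_int_decode[OF M(2)])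
  qed
  from has_field_derivative_series[OF _ f this, of 0]
  obtain g where g: "\<And>s. s \<ge> 0 \<Longrightarrow> (\<lambda>k. ?f k s) sums g s"
    "\<And>s. s \<ge> 0 \<Longrightarrow> (g has_field_derivative (\<Sum>k. ?f' k s)) (at s within {0..})"
    using sums_summable[OF sums_Re[OF synth_sums[OF l1[of 0]]]] by auto
  have gs: "g s = Re (synth (a s) x)" if "s \<ge> 0" for s
    using g(1)[OF that] sums_Re[OF synth_sums[OF l1[OF that]]] by (rule sums_unique2)
  have "(\<Sum>k. ?f' k t) = Re (synth (a' t) x)"
    using sums_Re[OF synth_sums[OF l1'[OF t]]] by (rule sums_unique[symmetric])
  then have "(g has_real_derivative Re (synth (a' t) x)) (at t within {0..})" using g(2)[OF t] by simp
  then show ?thesis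
    unfolding has_real_derivative_iff_has_vector_derivative
    by (rule has_vector_derivative_transform[rotated 2]) (use t gs in auto)
qed

section \<open>Products and convolutions of absolutely convergent series\<close>

lemma abs_summable_on_product:
  fixes p :: "'a \<Rightarrow> complex" and q :: "'b \<Rightarrow> complex"
  assumes "(\<lambda>x. cmod (p x)) summable_on UNIV" "(\<lambda>y. cmod (q y)) summable_on UNIV"
  shows "(\<lambda>z. cmod (case z of (x, y) \<Rightarrow> p x * q y)) summable_on UNIV"
    and "infsum (\<lambda>(x, y). p x * q y) UNIV = infsum p UNIV * infsum q UNIV"
proof -
  have "(\<lambda>(x, y). cmod (p x) * cmod (q y)) summable_on UNIV"
    by (rule summable_on_product_nonneg) (use assms in auto)
  then show *: "(\<lambda>z. cmod (case z of (x, y) \<Rightarrow> p x * q y)) summable_on UNIV"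
    by (simp add: split_def norm_mult)
  have "(\<lambda>(x, y). p x * q y) summable_on (UNIV \<times> UNIV)"
    using abs_summable_summable[OF *] by simp
  from infsum_Sigma'_banach[OF this] show "infsum (\<lambda>(x, y). p x * q y) UNIV = infsum p UNIV * infsum q UNIV"
    by (simp add: infsum_cmult_right' infsum_cmult_left')
qed

lemma bij_convolution:
  "bij_betw (\<lambda>(n :: int, j, k). (j, k, n - j - k)) UNIV UNIV"
  by (rule bij_betwI[where g = "\<lambda>(j, k, l). (j + k + l, j, k)"]) auto

text \<open>In the variables (j, k, l) with n = j + k + l the sum is a triple product, and |n| <=
  |j| + |k| + |l| puts the derivative on one factor at a time. Applied to a majorant valid at all
  times, it bounds the coefficients of u^3 and of its derivative uniformly in t.\<close>

lemma cconv_weight_summable: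
  fixes w :: "int \<Rightarrow> real"
  assumes w: "\<And>n. w n \<ge> 0" "w summable_on UNIV" "(\<lambda>n. \<bar>of_int n\<bar> * w n) summable_on UNIV"
  shows "(\<lambda>n. \<bar>of_int n\<bar> * (\<Sum>\<^sub>\<infinity>(j, k)\<in>UNIV. w j * w k * w (n - j - k))) summable_on UNIV"
    and "(\<lambda>n. \<Sum>\<^sub>\<infinity>(j, k)\<in>UNIV. w j * w k * w (n - j - k)) summable_on UNIV"
    and "(\<lambda>(j, k). w j * w k * w (n - j - k)) summable_on UNIV"
proof -
  have prod3: "(\<lambda>(j, k, l). f j * (g k * h l)) summable_on UNIV"
    if "f summable_on UNIV" "g summable_on UNIV" "h summable_on UNIV"
      "\<And>n. f n \<ge> 0" "\<And>n. g n \<ge> 0" "\<And>n. h n \<ge> 0" for f g h :: "int \<Rightarrow> real"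
  proof -
    have "(\<lambda>(k, l). g k * h l) summable_on UNIV" by (rule summable_on_product_nonneg) (use that in auto)
    then have "(\<lambda>(j, y). f j * (case y of (k, l) \<Rightarrow> g k * h l)) summable_on UNIV"
      by (intro summable_on_product_nonneg) (use that in auto)
    then show ?thesis by (simp add: split_def)
  qed
  let ?m = "\<lambda>n::int. \<bar>of_int n\<bar> * w n"
  have m: "\<And>n. ?m n \<ge> 0" using w by simp
  have s3: "(\<lambda>(j, k, l). w j * (w k * w l)) summable_on UNIV" by (intro prod3 w)
  have "(\<lambda>z. (\<lambda>(j, k, l). ?m j * (w k * w l)) z + ((\<lambda>(j, k, l). w j * (?m k * w l)) z
      + (\<lambda>(j, k, l). w j * (w k * ?m l)) z)) summable_on UNIV"
    by (intro summable_on_add prod3 w m)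
  then have t3: "(\<lambda>(j, k, l). \<bar>of_int (j + k + l)\<bar> * (w j * (w k * w l))) summable_on UNIV"
  proof (rule summable_on_comparison_test)
    fix z :: "int \<times> int \<times> int"
    obtain j k l where z: "z = (j, k, l)" by (cases z)
    have "\<bar>of_int (j + k + l)\<bar> * (w j * (w k * w l)) \<le> (\<bar>of_int j\<bar> + \<bar>of_int k\<bar> + \<bar>of_int l\<bar>) * (w j * (w k * w l))"
      by (intro mult_right_mono mult_nonneg_nonneg w) simp
    then show "(\<lambda>(j, k, l). \<bar>of_int (j + k + l)\<bar> * (w j * (w k * w l))) z \<le>
        (\<lambda>(j, k, l). ?m j * (w k * w l)) z + ((\<lambda>(j, k, l). w j * (?m k * w l)) z + (\<lambda>(j, k, l). w j * (w k * ?m l)) z)"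
      by (simp add: z algebra_simps)
  qed (use w in auto)
  have reindex: "(\<lambda>(n, j, k). f (j, k, n - j - k)) summable_on UNIV \<longleftrightarrow> f summable_on UNIV"
    for f :: "int \<times> int \<times> int \<Rightarrow> real"
    using summable_on_reindex_bij_betw[OF bij_convolution, of f] by (simp add: split_def)
  have s: "(\<lambda>(n, y). case y of (j, k) \<Rightarrow> w j * w k * w (n - j - k)) summable_on (UNIV \<times> UNIV)"
    using s3 reindex[of "\<lambda>(j, k, l). w j * (w k * w l)"] by (simp add: split_def mult.assoc)
  have t: "(\<lambda>(n, y). \<bar>of_int n\<bar> * (case y of (j, k) \<Rightarrow> w j * w k * w (n - j - k))) summable_on (UNIV \<times> UNIV)"
    using t3 reindex[of "\<lambda>(j, k, l). \<bar>of_int (j + k + l)\<bar> * (w j * (w k * w l))"] by (simp add: split_def mult.assoc)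
  show "(\<lambda>n. \<Sum>\<^sub>\<infinity>(j, k)\<in>UNIV. w j * w k * w (n - j - k)) summable_on UNIV"
    by (rule summable_on_Sigma_banach[OF s])
  show "(\<lambda>n. \<bar>of_int n\<bar> * (\<Sum>\<^sub>\<infinity>(j, k)\<in>UNIV. w j * w k * w (n - j - k))) summable_on UNIV"
    using summable_on_Sigma_banach[OF t] by (simp add: infsum_cmult_right')
  have "(\<lambda>(n, y). case y of (j, k) \<Rightarrow> w j * w k * w (n - j - k)) summable_on (Pair n ` UNIV)"
    by (rule summable_on_subset_banach[OF s]) auto
  then show "(\<lambda>(j, k). w j * w k * w (n - j - k)) summable_on UNIV"
    by (subst (asm) summable_on_reindex) (auto simp: o_def inj_on_def)
qed

lemma cmod_cconv_le:
  assumes w: "\<And>n. w n \<ge> 0" "w summable_on UNIV" "(\<lambda>n. \<bar>of_int n\<bar> * w n) summable_on UNIV"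
    and b: "\<And>n. cmod (b n) \<le> w n"
  shows "cmod (cconv b n) \<le> (\<Sum>\<^sub>\<infinity>(j, k)\<in>UNIV. w j * w k * w (n - j - k))"
proof -
  have le: "cmod (case z of (j, k) \<Rightarrow> b j * b k * b (n - j - k)) \<le> (case z of (j, k) \<Rightarrow> w j * w k * w (n - j - k))" for z
    by (auto simp: norm_mult split: prod.split intro!: mult_mono b mult_nonneg_nonneg w)
  have s: "(\<lambda>z. cmod (case z of (j, k) \<Rightarrow> b j * b k * b (n - j - k))) summable_on UNIV"
    by (rule summable_on_comparison_test[OF cconv_weight_summable(3)[OF w, of n]]) (use le in auto)
  have "cmod (cconv b n) \<le> (\<Sum>\<^sub>\<infinity>z\<in>UNIV. cmod (case z of (j, k) \<Rightarrow> b j * b k * b (n - j - k)))"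
    unfolding cconv_def by (rule norm_infsum_bound[OF s])
  also have "\<dots> \<le> (\<Sum>\<^sub>\<infinity>(j, k)\<in>UNIV. w j * w k * w (n - j - k))"
    by (rule infsum_mono[OF s cconv_weight_summable(3)[OF w, of n]]) (rule le)
  finally show ?thesis .
qed

text \<open>The triple product of the absolutely convergent series is regrouped along n = j + k + l,
  the characters multiplying to cis (n x).\<close>

lemma synth_cube:
  assumes "l1 b"
  shows "synth (cconv b) x = (synth b x) ^ 3"
proof -
  define f where "f n = b n * cis (of_int n * x)" for n
  have f: "(\<lambda>n. cmod (f n)) summable_on UNIV" using assms by (simp add: f_def norm_mult)
  have S: "infsum f UNIV = synth b x" by (simp add: f_def[abs_def] synth_def)
  note p2 = abs_summable_on_product[OF f f]
  note p3 = abs_summable_on_product[OF f p2(1)]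
  have "infsum (\<lambda>(j, y). f j * (case y of (k, l) \<Rightarrow> f k * f l)) UNIV = (synth b x) ^ 3"
    unfolding p3(2) p2(2) S by (simp add: power3_eq_cube)
  then have 1: "infsum (\<lambda>(j, k, l). f j * (f k * f l)) UNIV = (synth b x) ^ 3" by (simp add: split_def)
  have 2: "(\<lambda>(j, k, l). f j * (f k * f l)) summable_on UNIV"
    using abs_summable_summable[OF p3(1)] by (simp add: split_def)
  have eq: "(\<lambda>(j, k, l). f j * (f k * f l)) ((\<lambda>(n, j, k). (j, k, n - j - k)) z)
      = (case z of (n, y) \<Rightarrow> (case y of (j, k) \<Rightarrow> b j * b k * b (n - j - k)) * cis (of_int n * x))" for z
  proof -
    obtain n j k where z: "z = (n, j, k)" by (cases z)
    have "f j * (f k * f (n - j - k)) = b j * b k * b (n - j - k)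
        * (cis (of_int j * x) * (cis (of_int k * x) * cis (of_int (n - j - k) * x)))"
      unfolding f_def by (simp only: ac_simps)
    also have "cis (of_int j * x) * (cis (of_int k * x) * cis (of_int (n - j - k) * x)) = cis (of_int n * x)"
      by (simp only: cis_mult) (simp add: algebra_simps)
    finally have "f j * (f k * f (n - j - k)) = b j * b k * b (n - j - k) * cis (of_int n * x)" .
    then show ?thesis by (simp add: z)
  qed
  have "(\<lambda>(n, y). (case y of (j, k) \<Rightarrow> b j * b k * b (n - j - k)) * cis (of_int n * x)) summable_on (UNIV \<times> UNIV)"
    using 2 summable_on_reindex_bij_betw[OF bij_convolution, of "\<lambda>(j, k, l). f j * (f k * f l)"]
    by (simp only: eq UNIV_Times_UNIV)
  from infsum_Sigma'_banach[OF this]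
  have "(\<Sum>\<^sub>\<infinity>n. cconv b n * cis (of_int n * x))
    = infsum (\<lambda>(n, y). (case y of (j, k) \<Rightarrow> b j * b k * b (n - j - k)) * cis (of_int n * x)) UNIV"
    by (simp add: cconv_def infsum_cmult_left')
  also have "\<dots> = infsum (\<lambda>(j, k, l). f j * (f k * f l)) UNIV"
    using infsum_reindex_bij_betw[OF bij_convolution, of "\<lambda>(j, k, l). f j * (f k * f l)"] by (simp only: eq)
  finally show ?thesis using 1 by (simp add: synth_def)
qed

lemma continuous_synth: "l1 b \<Longrightarrow> continuous_on UNIV (synth b)"
proof -
  assume b: "l1 b"
  have "uniform_limit UNIV (\<lambda>K x. \<Sum>k<K. b (int_decode k) * cis (of_int (int_decode k) * x))
      (\<lambda>x. \<Sum>k. b (int_decode k) * cis (of_int (int_decode k) * x)) sequentially"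
    by (rule Weierstrass_m_test[OF _ summable_int_decode[OF b]]) (simp add: norm_mult)
  then have "continuous_on UNIV (\<lambda>x. \<Sum>k. b (int_decode k) * cis (of_int (int_decode k) * x))"
    by (rule uniform_limit_theorem[rotated]) (auto intro!: always_eventually continuous_intros)
  also have "(\<lambda>x. \<Sum>k. b (int_decode k) * cis (of_int (int_decode k) * x)) = synth b"
    using sums_unique[OF synth_sums[OF b]] by auto
  finally show ?thesis .
qed

lemma synth_periodic: "synth b (x + 2 * pi) = synth b x"
proof -
  have "cis (of_int n * (x + 2 * pi)) = cis (of_int n * x)" for n
  proof -
    have "cis (of_int n * (x + 2 * pi)) = cis (of_int n * x) * cis (2 * pi * of_int n)"
      by (simp add: cis_mult algebra_simps)
    then show ?thesis by (simp add: cis_multiple_2pi)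
  qed
  then show ?thesis by (simp add: synth_def)
qed

lemma synth_L2: "l1 b \<Longrightarrow> (\<lambda>x. Re (synth b x)) \<in> L2"
  unfolding L2_def
  by (auto simp: synth_periodic intro!: borel_measurable_circ_continuous integrable_circ_continuous
      continuous_intros continuous_synth)

section \<open>Fourier coefficients and the inverse operator applied to series\<close>

lemma integral_kernel_synth:
  assumes b: "l1 b" and K: "integrable circ K"
  shows "(\<lambda>k. b (int_decode k) * (\<integral>x. complex_of_real (K x) * cis (of_int (int_decode k) * x) \<partial>circ)) sums
    (\<integral>x. complex_of_real (K x) * synth b x \<partial>circ)"
proof -
  let ?f = "\<lambda>k x. b (int_decode k) * (complex_of_real (K x) * cis (of_int (int_decode k) * x))"
  have Kc: "integrable circ (\<lambda>x. complex_of_real (K x))" using K by simp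
  have fi: "integrable circ (?f k)" for k by (intro integrable_mult_right integrable_circ_mult_cis Kc)
  have nf: "norm (?f k x) = cmod (b (int_decode k)) * \<bar>K x\<bar>" for k x by (simp add: norm_mult)
  have "(\<lambda>k. \<integral>x. ?f k x \<partial>circ) sums (\<integral>x. (\<Sum>k. ?f k x) \<partial>circ)"
  proof (rule sums_integral[OF fi])
    show "AE x in circ. summable (\<lambda>k. norm (?f k x))"
      unfolding nf by (intro AE_I2 summable_mult2 summable_int_decode[OF b])
    show "summable (\<lambda>k. \<integral>x. norm (?f k x) \<partial>circ)"
      unfolding nf integral_mult_right_zero by (intro summable_mult2 summable_int_decode[OF b])
  qed
  moreover have "(\<Sum>k. ?f k x) = complex_of_real (K x) * synth b x" for x
  proof -
    have "(\<lambda>k. complex_of_real (K x) * (b (int_decode k) * cis (of_int (int_decode k) * x))) sums (complex_of_real (K x) * synth b x)"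
      by (intro sums_mult synth_sums b)
    then show ?thesis by (simp add: sums_iff mult.left_commute)
  qed
  ultimately show ?thesis by (simp only: integral_mult_right_zero)
qed

text \<open>Multiplication by cis (-n x) shifts the coefficients by n, so only the mean of a series
  has to be found; it comes from integrating against the constant kernel 1.\<close>

lemma fourier_coeff_synth:
  assumes b: "l1 b" "\<And>n. b (- n) = cnj (b n)"
  shows "fourier_coeff (\<lambda>x. Re (synth b x)) n = b n"
proof -
  define c where "c m = b (m + n)" for m
  have c: "l1 c" unfolding c_def
    using summable_on_reindex_bij_betw[of "\<lambda>m. m + n" UNIV UNIV "\<lambda>m. cmod (b m)"] b(1)
      bij_betwI[of "\<lambda>m. m + n" UNIV UNIV "\<lambda>m. m - n"] by auto
  have "complex_of_real (Re (synth b x)) * cis (- (of_int n * x)) = synth c x" for x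
  proof -
    have "((\<lambda>m. b m * cis (of_int m * x) * cis (- (of_int n * x))) has_sum synth b x * cis (- (of_int n * x))) UNIV"
      by (intro has_sum_cmult_left has_sum_synth b)
    also have "?this \<longleftrightarrow> ((\<lambda>m. c m * cis (of_int m * x)) has_sum synth b x * cis (- (of_int n * x))) UNIV"
    proof (rule has_sum_reindex_bij_witness[where i = "\<lambda>m. m + n" and j = "\<lambda>m. m - n"])
      show "c (m - n) * cis (of_int (m - n) * x) = b m * cis (of_int m * x) * cis (- (of_int n * x))" for m
        unfolding mult.assoc cis_mult by (simp add: c_def algebra_simps)
    qed auto
    finally have "synth c x = synth b x * cis (- (of_int n * x))" by (rule synth_eqI[OF c])
    then show ?thesis using synth_real[OF b] by simp
  qed
  then have "fourier_coeff (\<lambda>x. Re (synth b x)) n = 1 / (2 * pi) * (\<integral>x. synth c x \<partial>circ)"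
    by (simp add: fourier_coeff_def)
  also have "(\<integral>x. synth c x \<partial>circ) = complex_of_real (2 * pi) * c 0"
  proof (rule sums_unique2)
    show "(\<lambda>k. c (int_decode k) * (\<integral>x. complex_of_real 1 * cis (of_int (int_decode k) * x) \<partial>circ)) sums (\<integral>x. synth c x \<partial>circ)"
      using integral_kernel_synth[OF c, of "\<lambda>_. 1"] finite_measure.integrable_const[OF finite_measure_circ] by simp
    have "c (int_decode k) * (\<integral>x. complex_of_real 1 * cis (of_int (int_decode k) * x) \<partial>circ)
        = (if k = int_encode 0 then complex_of_real (2 * pi) * c 0 else 0)" for k
    proof -
      have "int_decode k = 0 \<longleftrightarrow> k = int_encode 0" by (metis int_decode_inverse int_encode_inverse)
      then show ?thesis by (simp add: integral_cis)
    qed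
    then show "(\<lambda>k. c (int_decode k) * (\<integral>x. complex_of_real 1 * cis (of_int (int_decode k) * x) \<partial>circ)) sums (complex_of_real (2 * pi) * c 0)"
      by (simp only:) (rule sums_single)
  qed
  finally show ?thesis by (simp add: c_def)
qed

text \<open>Each mode meets the kernel coefficient -2 \<pi> / |n|, which the prefactor -1 / (2
  \<pi>) normalises to 1 / |n|. The zero mode is annihilated on both sides by division by
  zero.\<close>

lemma Lambda_inv_synth:
  assumes b: "l1 b" "\<And>n. b (- n) = cnj (b n)"
  shows "Lambda_inv (\<lambda>x. Re (synth b x)) \<alpha> = Re (synth (\<lambda>n. b n / of_int \<bar>n\<bar>) \<alpha>)"
proof -
  let ?c = "\<lambda>n. b n / of_int \<bar>n\<bar>"
  have c: "l1 ?c"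
    by (rule l1_comparison[OF b(1) cmod_divide_abs_int_le])
  have "(\<lambda>k. b (int_decode k) * (\<integral>x. complex_of_real (log_kernel \<alpha> 1 x) * cis (of_int (int_decode k) * x) \<partial>circ)) sums
    (\<integral>x. complex_of_real (log_kernel \<alpha> 1 x) * synth b x \<partial>circ)"
    by (rule integral_kernel_synth[OF b(1) log_kernel_limit(1)])
  then have "(\<lambda>k. - complex_of_real (2 * pi) * (?c (int_decode k) * cis (of_int (int_decode k) * \<alpha>))) sums
    (\<integral>x. complex_of_real (log_kernel \<alpha> 1 x) * synth b x \<partial>circ)"
    unfolding log_kernel_limit(2)
  proof (rule back_subst[of "\<lambda>f. f sums _"])
    have "complex_of_real \<bar>real_of_int m\<bar> = of_int \<bar>m\<bar>" for m by (metis of_int_abs of_real_of_int_eq)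
    then have "- complex_of_real (2 * pi) * (?c m * z) = b m * (- complex_of_real (2 * pi / \<bar>of_int m\<bar>) * z)" for m z
      by (simp add: mult.commute mult.left_commute)
    then show "(\<lambda>k. b (int_decode k) * (- complex_of_real (2 * pi / \<bar>of_int (int_decode k)\<bar>) * cis (of_int (int_decode k) * \<alpha>)))
        = (\<lambda>k. - complex_of_real (2 * pi) * (?c (int_decode k) * cis (of_int (int_decode k) * \<alpha>)))"
      by (simp only:)
  qed
  moreover have "(\<lambda>k. - complex_of_real (2 * pi) * (?c (int_decode k) * cis (of_int (int_decode k) * \<alpha>))) sums
    (- complex_of_real (2 * pi) * synth ?c \<alpha>)"
    by (intro sums_mult synth_sums c)
  ultimately have "(\<integral>x. complex_of_real (log_kernel \<alpha> 1 x) * synth b x \<partial>circ) = - complex_of_real (2 * pi) * synth ?c \<alpha>"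
    by (rule sums_unique2)
  moreover have "(\<integral>x. complex_of_real (log_kernel \<alpha> 1 x) * synth b x \<partial>circ)
    = complex_of_real (\<integral>x. log_kernel \<alpha> 1 x * Re (synth b x) \<partial>circ)"
  proof -
    have "complex_of_real (log_kernel \<alpha> 1 x) * synth b x = complex_of_real (log_kernel \<alpha> 1 x * Re (synth b x))" for x
      by (simp only: of_real_mult synth_real[OF b])
    then show ?thesis by (simp only: integral_complex_of_real)
  qed
  ultimately have "(\<integral>x. log_kernel \<alpha> 1 x * Re (synth b x) \<partial>circ) = Re (- complex_of_real (2 * pi) * synth ?c \<alpha>)"
    by (metis Re_complex_of_real)
  then show ?thesis by (simp add: Lambda_inv_def log_kernel_1)
qed

section \<open>The Cauchy problem\<close>

text \<open>Above a large N the tail of the H^3 energy is at most e / 2. On the modes up to N the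
  ramp is at most N / R, which leaves N B / R; R is chosen to make this at most e / 2, the summand 1
  keeping it positive.\<close>

lemma wt_sum_small:
  fixes y :: "int \<Rightarrow> real"
  assumes y: "\<And>n. y n \<ge> 0" and bd: "\<And>F. finite F \<Longrightarrow> (\<Sum>n\<in>F. of_int n ^ 6 * y n) \<le> B" and "e > 0"
  obtains R where "R > 0" "\<And>F. finite F \<Longrightarrow> (\<Sum>n\<in>F. wt R n * y n) \<le> e"
proof -
  have B: "B \<ge> 0" using bd[of "{}"] by simp
  have nn: "\<And>n. of_int n ^ 6 * y n \<ge> 0" using y by simp
  obtain N :: nat where N: "\<And>F. finite F \<Longrightarrow> F \<inter> {- int N..int N} = {} \<Longrightarrow> (\<Sum>n\<in>F. of_int n ^ 6 * y n) \<le> e / 2"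
    using summable_small_tail[of "\<lambda>n. of_int n ^ 6 * y n" B "e / 2", OF nn bd] \<open>e > 0\<close> by (metis half_gt_zero)
  define R where "R = 2 * real N * B / e + 1"
  have R: "R > 0" using B \<open>e > 0\<close> by (simp add: R_def add_nonneg_pos)
  have "real N * B / R \<le> e / 2"
  proof -
    have "2 * real N * B / e \<le> R" by (simp add: R_def)
    then have "2 * (real N * B) \<le> R * e" using \<open>e > 0\<close> by (simp add: divide_le_eq)
    then show ?thesis using R by (simp add: divide_le_eq mult.commute)
  qed
  have "(\<Sum>n\<in>F. wt R n * y n) \<le> e" if F: "finite F" for F
  proof -
    let ?I = "{- int N..int N}"
    have "(\<Sum>n\<in>F. wt R n * y n) = (\<Sum>n\<in>F \<inter> ?I. wt R n * y n) + (\<Sum>n\<in>F - ?I. wt R n * y n)"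
      using F by (rule sum.Int_Diff)
    also have "(\<Sum>n\<in>F - ?I. wt R n * y n) \<le> (\<Sum>n\<in>F - ?I. of_int n ^ 6 * y n)"
      by (intro sum_mono mult_right_mono wt_le y)
    also have "\<dots> \<le> e / 2" using F by (intro N) auto
    also have "(\<Sum>n\<in>F \<inter> ?I. wt R n * y n) \<le> (\<Sum>n\<in>F \<inter> ?I. real N / R * (of_int n ^ 6 * y n))"
    proof (rule sum_mono)
      fix n assume n: "n \<in> F \<inter> ?I"
      then have "\<bar>n\<bar> \<le> int N" by auto
      then have "\<bar>real_of_int n\<bar> \<le> real N" by linarith
      then have "ramp R n \<le> real N / R" unfolding ramp_def using R by (intro min.coboundedI2 divide_right_mono) auto
      then have "of_int n ^ 6 * ramp R n \<le> of_int n ^ 6 * (real N / R)" by (intro mult_left_mono) auto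
      then have "wt R n * y n \<le> of_int n ^ 6 * (real N / R) * y n" unfolding wt_def by (intro mult_right_mono y)
      then show "wt R n * y n \<le> real N / R * (of_int n ^ 6 * y n)" by (simp add: mult.commute mult.left_commute)
    qed
    also have "\<dots> = real N / R * (\<Sum>n\<in>F \<inter> ?I. of_int n ^ 6 * y n)" by (simp add: sum_distrib_left)
    also have "\<dots> \<le> real N / R * B" using F R by (intro mult_left_mono bd) auto
    also have "\<dots> \<le> e / 2" using \<open>real N * B / R \<le> e / 2\<close> by simp
    finally show ?thesis by simp
  qed
  with R show thesis by (rule that)
qed

lemma abs_powr_3: "(\<bar>real_of_int n\<bar> powr 3) = \<bar>of_int n\<bar> ^ 3"
  using powr_realpow[of "\<bar>real_of_int n\<bar>" 3] by (cases "n = 0") auto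

text \<open>Riesz-Fischer provides a representative of the third derivative, so the choice in
  \<open>Lambda_powr\<close> is a genuine one. The homogeneous part and, the zero mode being absent,
  the L^2 part each contribute 2 \<pi> B.\<close>

lemma sobolev_3_synth:
  assumes b: "l1 b" "\<And>n. b (- n) = cnj (b n)" and b0: "b 0 = 0"
    and bd: "\<And>F. finite F \<Longrightarrow> (\<Sum>n\<in>F. of_int n ^ 6 * (cmod (b n))\<^sup>2) \<le> B"
  shows "(\<lambda>x. Re (synth b x)) \<in> sobolev 3" "H_norm 3 (\<lambda>x. Re (synth b x)) \<le> sqrt (4 * pi * B)"
proof -
  let ?f = "\<lambda>x. Re (synth b x)"
  let ?c = "\<lambda>n. complex_of_real (\<bar>of_int n\<bar> ^ 3) * b n"
  have f: "?f \<in> L2" "\<And>n. fourier_coeff ?f n = b n"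
    using synth_L2[OF b(1)] fourier_coeff_synth[OF b] by auto
  have sq: "(cmod (?c n))\<^sup>2 = of_int n ^ 6 * (cmod (b n))\<^sup>2" for n
    by (simp add: norm_mult power_mult_distrib norm_power flip: power_mult)
  have c: "\<And>F. finite F \<Longrightarrow> (\<Sum>n\<in>F. (cmod (?c n))\<^sup>2) \<le> B" unfolding sq by (rule bd)
  have lam: "is_Lambda_powr 3 ?f g \<longleftrightarrow> g \<in> L2 \<and> (\<forall>n. fourier_coeff g n = ?c n)" for g
    by (simp add: is_Lambda_powr_def abs_powr_3 f(2))
  obtain g where "g \<in> L2" "\<And>n. fourier_coeff g n = ?c n"
    using riesz_fischer[of ?c B] c b(2) by (metis (no_types, lifting) abs_minus_cancel complex_cnj_complex_of_real complex_cnj_mult of_int_minus)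
  then have ex: "\<exists>g. is_Lambda_powr 3 ?f g" using lam by blast
  then show "?f \<in> sobolev 3" using f(1) by (simp add: sobolev_def)
  have "is_Lambda_powr 3 ?f (Lambda_powr 3 ?f)" unfolding Lambda_powr_def using ex by (rule someI_ex)
  then have L: "Lambda_powr 3 ?f \<in> L2" "\<And>n. fourier_coeff (Lambda_powr 3 ?f) n = ?c n" using lam by auto
  have 1: "(Hdot_norm 3 ?f)\<^sup>2 \<le> 2 * pi * B" unfolding Hdot_norm_def
    by (rule L2_norm_le_coeffs[OF L(1)]) (unfold L(2), rule c)
  have 2: "(L2_norm ?f)\<^sup>2 \<le> 2 * pi * B"
  proof (rule L2_norm_le_coeffs[OF f(1)], unfold f(2))
    fix F :: "int set" assume F: "finite F"
    have "(\<Sum>n\<in>F. (cmod (b n))\<^sup>2) \<le> (\<Sum>n\<in>F. of_int n ^ 6 * (cmod (b n))\<^sup>2)"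
      using le_abs_int_power_mult[of "(cmod (b n))\<^sup>2" n 6 for n]
      by (intro sum_mono) (simp add: b0 power_even_abs)
    also have "\<dots> \<le> B" by (rule bd[OF F])
    finally show "(\<Sum>n\<in>F. (cmod (b n))\<^sup>2) \<le> B" .
  qed
  show "H_norm 3 ?f \<le> sqrt (4 * pi * B)" unfolding H_norm_def
    using 1 2 by (intro real_sqrt_le_mono) simp
qed

text \<open>By periodicity the exceptional set on the line lies in the countable union of the
  translates by 2 \<pi> k of a null set in one period.\<close>

lemma AE_lebesgue_periodic_eq:
  assumes "AE x in circ. f x = g x" "\<And>x. f (x + 2 * pi) = f x" "\<And>x. g (x + 2 * pi) = (g x :: real)"
  shows "AE x in lebesgue. f x = g x"
proof -
  let ?Z = "{x \<in> {- pi..pi}. f x \<noteq> g x}"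
  have "AE x in lebesgue. x \<in> {- pi..pi} \<longrightarrow> f x = g x"
    using assms(1) by (subst (asm) AE_restrict_space_iff) auto
  then have "AE x in lebesgue. x \<notin> ?Z" by eventually_elim auto
  then obtain N where N: "\<And>x. x \<in> space lebesgue - N \<Longrightarrow> x \<notin> ?Z" "N \<in> null_sets lebesgue"
    by (rule AE_E3) blast
  then have "negligible N" "?Z \<subseteq> N" by (auto simp: negligible_iff_null_sets)
  then have "negligible ?Z" by (rule negligible_subset)
  then have "negligible ((+) (2 * pi * of_int k) ` ?Z)" for k by (rule negligible_translation)
  then have neg: "negligible (\<Union>k::int. (+) (2 * pi * of_int k) ` ?Z)"
    by (intro negligible_countable_Union) auto
  have shift: "h (x + 2 * pi * of_int k) = h x" if "\<And>x. h (x + 2 * pi) = (h x :: real)" for h x and k :: int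
  proof -
    have n: "h (x + 2 * pi * real m) = h x" for m :: nat and x
    proof (induction m)
      case (Suc m)
      have "h (x + 2 * pi * real (Suc m)) = h (x + 2 * pi * real m + 2 * pi)" by (simp add: algebra_simps)
      then show ?case using that Suc by simp
    qed simp
    show ?thesis
    proof (cases "k \<ge> 0")
      case True
      then show ?thesis using n[of x "nat k"] by simp
    next
      case False
      then show ?thesis using n[of "x + 2 * pi * of_int k" "nat (- k)"] by simp
    qed
  qed
  have "{x. f x \<noteq> g x} \<subseteq> (\<Union>k::int. (+) (2 * pi * of_int k) ` ?Z)"
  proof
    fix x assume x: "x \<in> {x. f x \<noteq> g x}"
    define k where "k = \<lfloor>(x + pi) / (2 * pi)\<rfloor>"
    define y where "y = x - 2 * pi * of_int k"
    have "of_int k \<le> (x + pi) / (2 * pi)" "(x + pi) / (2 * pi) < of_int k + 1" by (auto simp: k_def)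
    then have "y \<in> {- pi..pi}" by (auto simp: y_def field_simps)
    moreover have "f y \<noteq> g y" using x shift[of f y k] shift[of g y k] assms(2,3) by (simp add: y_def)
    ultimately show "x \<in> (\<Union>k::int. (+) (2 * pi * of_int k) ` ?Z)" by (auto simp: y_def intro!: exI[of _ k] image_eqI[of _ _ y])
  qed
  then have "{x. f x \<noteq> g x} \<in> null_sets lebesgue" 
    using negligible_subset[OF neg] by (simp add: negligible_iff_null_sets)
  then have "AE x in lebesgue. x \<notin> {x. f x \<noteq> g x}" by (rule AE_not_in)
  then show ?thesis by simp
qed

theorem theorem4:
  "\<exists>\<epsilon>>0. \<forall>u0. u0 \<in> sobolev 3 \<longrightarrow> (\<integral>\<alpha>. u0 \<alpha> \<partial>circ) = 0 \<longrightarrow> Hdot_norm 3 u0 \<le> \<epsilon> \<longrightarrow>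
     (\<exists>u. solves_cauchy u0 u \<and>
          (\<forall>T>0. continuous_into_sobolev {0..T} 3 u) \<and>
          (\<exists>C. \<forall>t\<ge>0. L2_norm (u t) \<le> C * (1 + t) powr (- 1.25)))"
proof (intro exI[of _ "1 / 10 ^ 6 :: real"] conjI allI impI)
  fix u0 assume u0: "u0 \<in> sobolev 3" and mean: "(\<integral>\<alpha>. u0 \<alpha> \<partial>circ) = 0" and small: "Hdot_norm 3 u0 \<le> 1 / 10 ^ 6"
  let ?c = "fourier_coeff u0"
  have u0_L2: "u0 \<in> L2" using u0 by (simp add: sobolev_def)
  have "\<exists>g. is_Lambda_powr 3 u0 g" using u0 by (simp add: sobolev_def)
  then have "is_Lambda_powr 3 u0 (Lambda_powr 3 u0)" unfolding Lambda_powr_def by (rule someI_ex)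
  then have g0: "Lambda_powr 3 u0 \<in> L2" "\<And>n. fourier_coeff (Lambda_powr 3 u0) n = complex_of_real (\<bar>of_int n\<bar> ^ 3) * ?c n"
    by (auto simp: is_Lambda_powr_def abs_powr_3)
  \<comment> \<open>Origin of the radius 10^-6: its square 10^-12 lies below 1 / (2 * 10^10), and
    the Bessel factor 2 \<pi> is at least 1.\<close>
  have c_bd: "(\<Sum>n\<in>F. of_int n ^ 6 * (cmod (?c n))\<^sup>2) \<le> 1 / (2 * 10 ^ 10)" if "finite F" for F
  proof -
    have "(cmod (fourier_coeff (Lambda_powr 3 u0) n))\<^sup>2 = of_int n ^ 6 * (cmod (?c n))\<^sup>2" for n
      unfolding g0(2) by (simp add: norm_mult power_mult_distrib norm_power flip: power_mult)
    then have "2 * pi * (\<Sum>n\<in>F. of_int n ^ 6 * (cmod (?c n))\<^sup>2) \<le> (L2_norm (Lambda_powr 3 u0))\<^sup>2"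
      using bessel[OF g0(1) that] by simp
    also have "\<dots> \<le> (1 / 10 ^ 6)\<^sup>2"
      using small unfolding Hdot_norm_def by (intro power_mono) (auto simp: L2_norm_def)
    finally have "2 * pi * (\<Sum>n\<in>F. of_int n ^ 6 * (cmod (?c n))\<^sup>2) \<le> 1 / 10 ^ 12" by (simp add: power_divide)
    moreover have "1 * (\<Sum>n\<in>F. of_int n ^ 6 * (cmod (?c n))\<^sup>2) \<le> 2 * pi * (\<Sum>n\<in>F. of_int n ^ 6 * (cmod (?c n))\<^sup>2)"
      using pi_ge_two by (intro mult_right_mono sum_nonneg) auto
    ultimately show ?thesis by simp
  qed
  have c_0: "?c 0 = 0" using mean by (simp add: fourier_coeff_def)
  obtain a where a0: "a 0 = ?c" and a_cnj: "\<And>t n. t \<ge> 0 \<Longrightarrow> a t (- n) = cnj (a t n)"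
    and a_bd: "\<And>t n. t \<ge> 0 \<Longrightarrow> cmod (a t n) \<le> cube_decay n"
    and a_deriv: "\<And>t n. t \<ge> 0 \<Longrightarrow>
      ((\<lambda>s. a s n) has_vector_derivative - (\<i> * of_int n / 3) * cconv (a t) n - a t n / of_int \<bar>n\<bar>) (at t within {0..})"
    and a_L2: "\<And>t F. t \<ge> 0 \<Longrightarrow> finite F \<Longrightarrow> (\<Sum>n\<in>F. (cmod (a t n))\<^sup>2) \<le> 1 / (1 + t) ^ 6"
    and a_wt: "\<And>t R F G. t \<ge> 0 \<Longrightarrow> R > 0 \<Longrightarrow> finite F \<Longrightarrow> (\<And>H. finite H \<Longrightarrow> (\<Sum>n\<in>H. wt R n * (cmod (?c n))\<^sup>2) \<le> G) \<Longrightarrow>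
      (\<Sum>n\<in>F. wt R n * (cmod (a t n))\<^sup>2) \<le> 2 * G"
    using fourier_flow_exists[OF fourier_coeff_minus c_0 c_bd] by blast
  define u where "u t x = Re (synth (a t) x)" for t x
  have l1: "l1 (a t)" if "t \<ge> 0" for t
    by (rule l1_comparison[OF summable_cube_decay a_bd[OF that]])
  have a_zero: "a t 0 = 0" if "t \<ge> 0" for t using a_bd[OF that, of 0] by (simp add: cube_decay_def)
  have u_L2: "u t \<in> L2" and u_coeff: "fourier_coeff (u t) n = a t n" if "t \<ge> 0" for t n
    using synth_L2[OF l1[OF that]] fourier_coeff_synth[OF l1[OF that] a_cnj[OF that]]
    by (simp_all add: u_def[abs_def])
  have sq_summable: "(\<lambda>n. \<bar>of_int n\<bar> * cube_decay n) summable_on UNIV"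
    unfolding abs_times_cube_decay by (rule summable_inverse_squares)
  \<comment> \<open>A time-independent majorant for the coefficients of u^3. Cubic decay is just
    enough: after one derivative it is 1 / n^2, still summable, and this passes to the
    convolution.\<close>
  define CC where "CC n = (\<Sum>\<^sub>\<infinity>(j, k)\<in>UNIV. cube_decay j * cube_decay k * cube_decay (n - j - k))" for n
  note CC = cconv_weight_summable[OF cube_decay_nonneg summable_cube_decay sq_summable, folded CC_def]
  have cc_le: "cmod (cconv (a t) n) \<le> CC n" if "t \<ge> 0" for t n
    unfolding CC_def by (rule cmod_cconv_le[OF cube_decay_nonneg summable_cube_decay sq_summable a_bd[OF that]])
  let ?a' = "\<lambda>t n. - (\<i> * of_int n / 3) * cconv (a t) n - a t n / of_int \<bar>n\<bar>"
  show "\<exists>u. solves_cauchy u0 u \<and> (\<forall>T>0. continuous_into_sobolev {0..T} 3 u)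
      \<and> (\<exists>C. \<forall>t\<ge>0. L2_norm (u t) \<le> C * (1 + t) powr (- 1.25))"
  proof (intro exI[of _ u] conjI allI impI)
    show "solves_cauchy u0 u"
      unfolding solves_cauchy_def
    proof (intro conjI allI impI)
      fix t \<alpha> :: real assume t: "0 \<le> t"
      have u_t: "((\<lambda>r. u r \<alpha>) has_real_derivative Re (synth (?a' t) \<alpha>)) (at t within {0..})"
        unfolding u_def
      proof (rule synth_time_deriv[OF a_deriv l1 _ _ t])
        show "cmod (?a' s n) \<le> \<bar>of_int n\<bar> * CC n + cube_decay n" if "s \<ge> 0" for s n
        proof -
          have "cmod (?a' s n) \<le> cmod (- (\<i> * of_int n / 3) * cconv (a s) n) + cmod (a s n / of_int \<bar>n\<bar>)"
            by (rule norm_triangle_ineq4)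
          also have "cmod (- (\<i> * of_int n / 3) * cconv (a s) n) \<le> \<bar>of_int n\<bar> * CC n"
            unfolding norm_mult by (intro mult_mono cc_le that) (auto simp: norm_mult norm_divide)
          also have "cmod (a s n / of_int \<bar>n\<bar>) \<le> cube_decay n"
            by (rule order_trans[OF cmod_divide_abs_int_le a_bd[OF that]])
          finally show ?thesis by simp
        qed
        show "(\<lambda>n. \<bar>of_int n\<bar> * CC n + cube_decay n) summable_on UNIV"
          by (intro summable_on_add CC summable_cube_decay)
      qed auto
      have l1_c: "l1 (cconv (a t))" by (rule l1_comparison[OF CC(2) cc_le[OF t]])
      have l1_nc: "(\<lambda>n. \<bar>of_int n\<bar> * cmod (cconv (a t) n)) summable_on UNIV"
        by (rule summable_on_comparison_test[OF CC(1)]) (auto intro!: mult_left_mono cc_le t)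
      have u_x: "(u t has_real_derivative Re (synth (\<lambda>n. \<i> * of_int n * a t n) \<alpha>)) (at \<alpha>)"
        unfolding u_def[abs_def]
      proof (rule synth_deriv[OF l1[OF t]])
        show "(\<lambda>n. \<bar>of_int n\<bar> * cmod (a t n)) summable_on UNIV"
          by (rule summable_on_comparison_test[OF sq_summable]) (auto intro!: mult_left_mono a_bd t)
      qed
      let ?ux = "Re (synth (\<lambda>n. \<i> * of_int n * a t n) \<alpha>)"
      have cube: "Re (synth (cconv (a t)) x) = (u t x) ^ 3" for x
      proof -
        have "synth (cconv (a t)) x = complex_of_real ((u t x) ^ 3)"
          using synth_cube[OF l1[OF t], of x] synth_real[OF l1[OF t] a_cnj[OF t], of x] by (simp add: u_def)
        then show ?thesis by simp
      qed
      \<comment> \<open>The derivative of u^3 is computed twice, termwise from its coefficients and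
        by the chain rule; equating the two recovers u^2 u_x from the conservative form.\<close>
      have "((\<lambda>x. (u t x) ^ 3) has_real_derivative Re (synth (\<lambda>n. \<i> * of_int n * cconv (a t) n) \<alpha>)) (at \<alpha>)"
        using synth_deriv[OF l1_c l1_nc, of \<alpha>] by (simp add: cube)
      moreover have "((\<lambda>x. (u t x) ^ 3) has_real_derivative 3 * (u t \<alpha>)\<^sup>2 * ?ux) (at \<alpha>)"
        using u_x by (auto intro!: derivative_eq_intros)
      ultimately have nl: "Re (synth (\<lambda>n. \<i> * of_int n * cconv (a t) n) \<alpha>) = 3 * (u t \<alpha>)\<^sup>2 * ?ux"
        by (rule DERIV_unique)
      have "?a' t = (\<lambda>n. (- 1 / 3) * (\<i> * of_int n * cconv (a t) n) + (- 1) * (a t n / of_int \<bar>n\<bar>))"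
        by (rule ext) simp
      then have "synth (?a' t) \<alpha> = synth (\<lambda>n. (- 1 / 3) * (\<i> * of_int n * cconv (a t) n) + (- 1) * (a t n / of_int \<bar>n\<bar>)) \<alpha>"
        by (rule arg_cong)
      also have "\<dots> = (- 1 / 3) * synth (\<lambda>n. \<i> * of_int n * cconv (a t) n) \<alpha> + (- 1) * synth (\<lambda>n. a t n / of_int \<bar>n\<bar>) \<alpha>"
      proof -
        have "l1 (\<lambda>n. (- 1 / 3) * (\<i> * of_int n * cconv (a t) n))"
          using summable_on_cmult_right[OF l1_nc, of "1 / 3"] by (simp add: norm_mult norm_divide)
        moreover have "l1 (\<lambda>n. (- 1) * (a t n / of_int \<bar>n\<bar>))"
          by (rule l1_comparison[OF l1[OF t]]) (use cmod_divide_abs_int_le in simp)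
        ultimately show ?thesis by (simp only: synth_add synth_cmult)
      qed
      also have "Re \<dots> = - (u t \<alpha>)\<^sup>2 * ?ux - Lambda_inv (u t) \<alpha>"
        using nl Lambda_inv_synth[OF l1[OF t] a_cnj[OF t], of \<alpha>] by (simp add: u_def[abs_def])
      finally have "Re (synth (?a' t) \<alpha>) + (u t \<alpha>)\<^sup>2 * ?ux = - Lambda_inv (u t) \<alpha>" by simp
      then show "\<exists>u_t u_\<alpha>. ((\<lambda>r. u r \<alpha>) has_real_derivative u_t) (at t within {0..}) \<and>
          (u t has_real_derivative u_\<alpha>) (at \<alpha>) \<and> u_t + (u t \<alpha>)\<^sup>2 * u_\<alpha> = - Lambda_inv (u t) \<alpha>"
        using u_t u_x by blast
    next
      have "AE \<alpha> in circ. u 0 \<alpha> - u0 \<alpha> = 0"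
      proof (rule fourier_coeff_unique)
        show "fourier_coeff (\<lambda>\<alpha>. u 0 \<alpha> - u0 \<alpha>) n = 0" for n
          using u_coeff[of 0 n] a0 by (simp add: fourier_coeff_diff L2_integrable u_L2 u0_L2)
      qed (simp add: L2_integrable u_L2 u0_L2)
      then have "AE \<alpha> in circ. u 0 \<alpha> = u0 \<alpha>" by simp
      then show "AE \<alpha> in lebesgue. u 0 \<alpha> = u0 \<alpha>"
        by (rule AE_lebesgue_periodic_eq) (use u_L2[of 0] u0_L2 in \<open>auto simp: L2_def\<close>)
    qed
    show "continuous_into_sobolev {0..T} 3 u" if "0 < T" for T
      unfolding continuous_into_sobolev_def
    proof (intro conjI ballI)
      have H3: "(\<Sum>n\<in>F. of_int n ^ 6 * (cmod (a t n))\<^sup>2) \<le> 2 * (1 / (2 * 10 ^ 10))" if "finite F" "t \<ge> 0" for F t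
        using a_wt[of t 1 F "1 / (2 * 10 ^ 10)"] c_bd that by (simp add: wt_1)
      show "u t \<in> sobolev 3" if "t \<in> {0..T}" for t
        unfolding u_def[abs_def]
        by (rule sobolev_3_synth(1)[OF l1 a_cnj a_zero H3]) (use that in auto)
      fix t assume t: "t \<in> {0..T}"
      show "((\<lambda>r. H_norm 3 (\<lambda>\<alpha>. u r \<alpha> - u t \<alpha>)) \<longlongrightarrow> 0) (at t within {0..T})"
      proof (rule tendstoI)
        fix e :: real assume "e > 0"
        \<comment> \<open>Then 4 \<pi> \<eta> = e^2 / 2, strictly below e^2.\<close>
        define \<eta> where "\<eta> = e\<^sup>2 / (8 * pi)"
        have \<eta>: "\<eta> > 0" using \<open>e > 0\<close> by (simp add: \<eta>_def)
        \<comment> \<open>The tail estimate loses a factor 2 in time, a factor 2 from the square of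
          a difference, and a factor 2 for the two times r and t; so \<eta> / 16 turns into \<eta> /
          2.\<close>
        obtain R where R: "R > 0" "\<And>F. finite F \<Longrightarrow> (\<Sum>n\<in>F. wt R n * (cmod (?c n))\<^sup>2) \<le> \<eta> / 16"
          using wt_sum_small[of "\<lambda>n. (cmod (?c n))\<^sup>2" "1 / (2 * 10 ^ 10)" "\<eta> / 16"] c_bd \<eta> by auto
        define I where "I = {- \<lceil>R\<rceil>..\<lceil>R\<rceil>}"
        define h where "h r = (\<Sum>n\<in>I. of_int n ^ 6 * (cmod (a r n - a t n))\<^sup>2)" for r
        have "((\<lambda>s. a s n) \<longlongrightarrow> a t n) (at t within {0..T})" for n
        proof -
          have "continuous (at t within {0..}) (\<lambda>s. a s n)"
            using a_deriv[of t n] t by (intro has_vector_derivative_continuous) auto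
          then have "continuous (at t within {0..T}) (\<lambda>s. a s n)" by (rule continuous_within_subset) auto
          then show ?thesis by (simp add: continuous_within)
        qed
        then have "(h \<longlongrightarrow> (\<Sum>n\<in>I. of_int n ^ 6 * (cmod (a t n - a t n))\<^sup>2)) (at t within {0..T})"
          unfolding h_def by (intro tendsto_intros)
        then have "\<forall>\<^sub>F r in at t within {0..T}. h r < \<eta> / 2"
          using \<eta> by (intro order_tendstoD(2)) auto
        moreover have "\<forall>\<^sub>F r in at t within {0..T}. r \<in> {0..T}" by (simp add: eventually_at_filter)
        ultimately show "\<forall>\<^sub>F r in at t within {0..T}. dist (H_norm 3 (\<lambda>\<alpha>. u r \<alpha> - u t \<alpha>)) 0 < e"
        proof eventually_elim
          case (elim r)
          have rt: "r \<ge> 0" "t \<ge> 0" using elim t by auto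
          let ?b = "\<lambda>n. a r n - a t n"
          have b_sum: "(\<Sum>n\<in>F. of_int n ^ 6 * (cmod (?b n))\<^sup>2) \<le> \<eta>" if F: "finite F" for F
          proof -
            have "(\<Sum>n\<in>F. of_int n ^ 6 * (cmod (?b n))\<^sup>2)
              = (\<Sum>n\<in>F \<inter> I. of_int n ^ 6 * (cmod (?b n))\<^sup>2) + (\<Sum>n\<in>F - I. of_int n ^ 6 * (cmod (?b n))\<^sup>2)"
              using F by (rule sum.Int_Diff)
            also have "(\<Sum>n\<in>F \<inter> I. of_int n ^ 6 * (cmod (?b n))\<^sup>2) \<le> h r"
              unfolding h_def by (rule sum_mono2) (auto simp: I_def)
            also have "h r \<le> \<eta> / 2" using elim by simp
            also have "(\<Sum>n\<in>F - I. of_int n ^ 6 * (cmod (?b n))\<^sup>2)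
              \<le> (\<Sum>n\<in>F - I. 2 * (wt R n * (cmod (a r n))\<^sup>2) + 2 * (wt R n * (cmod (a t n))\<^sup>2))"
            proof (rule sum_mono)
              fix n assume "n \<in> F - I"
              then have "\<lceil>R\<rceil> < \<bar>n\<bar>" by (auto simp: I_def)
              then have "R \<le> \<bar>real_of_int n\<bar>" by linarith
              then have w: "wt R n = of_int n ^ 6" by (rule wt_large[OF R(1)])
              have "(cmod (?b n))\<^sup>2 \<le> (cmod (a r n) + cmod (a t n))\<^sup>2"
                by (intro power_mono norm_triangle_ineq4) auto
              also have "\<dots> \<le> 2 * (cmod (a r n))\<^sup>2 + 2 * (cmod (a t n))\<^sup>2"
                using sum_squares_bound[of "cmod (a r n)" "cmod (a t n)"] by (simp add: power2_sum)
              finally have "of_int n ^ 6 * (cmod (?b n))\<^sup>2 \<le> of_int n ^ 6 * (2 * (cmod (a r n))\<^sup>2 + 2 * (cmod (a t n))\<^sup>2)"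
                by (rule mult_left_mono) auto
              then show "of_int n ^ 6 * (cmod (?b n))\<^sup>2 \<le> 2 * (wt R n * (cmod (a r n))\<^sup>2) + 2 * (wt R n * (cmod (a t n))\<^sup>2)"
                unfolding w by (simp add: algebra_simps)
            qed
            also have "\<dots> = 2 * (\<Sum>n\<in>F - I. wt R n * (cmod (a r n))\<^sup>2) + 2 * (\<Sum>n\<in>F - I. wt R n * (cmod (a t n))\<^sup>2)"
              by (simp add: sum.distrib sum_distrib_left)
            also have "\<dots> \<le> 2 * (2 * (\<eta> / 16)) + 2 * (2 * (\<eta> / 16))"
              using F by (intro add_mono mult_left_mono a_wt rt R) auto
            finally show ?thesis by simp
          qed
          have b_l1: "l1 ?b"
          proof (rule l1_comparison[OF summable_on_add[OF summable_cube_decay summable_cube_decay]])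
            show "cmod (?b n) \<le> cube_decay n + cube_decay n" for n
              by (rule order_trans[OF norm_triangle_ineq4 add_mono]) (use a_bd rt in auto)
          qed
          have "(\<lambda>\<alpha>. u r \<alpha> - u t \<alpha>) = (\<lambda>\<alpha>. Re (synth ?b \<alpha>))"
            by (simp add: u_def synth_diff l1 rt)
          moreover have "H_norm 3 (\<lambda>\<alpha>. Re (synth ?b \<alpha>)) \<le> sqrt (4 * pi * \<eta>)"
            by (rule sobolev_3_synth(2)[OF b_l1 _ _ b_sum]) (use a_cnj a_zero rt in auto)
          moreover have "sqrt (4 * pi * \<eta>) < e"
          proof (rule real_less_lsqrt)
            show "4 * pi * \<eta> < e\<^sup>2" using \<open>e > 0\<close> by (simp add: \<eta>_def)
          qed (use \<open>e > 0\<close> \<eta> in auto)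
          moreover have "0 \<le> H_norm 3 (\<lambda>\<alpha>. Re (synth ?b \<alpha>))" by (simp add: H_norm_def)
          ultimately show ?case by (simp add: dist_norm)
        qed
      qed
    qed
    show "\<exists>C. \<forall>t\<ge>0. L2_norm (u t) \<le> C * (1 + t) powr (- 1.25)"
    proof (intro exI[of _ "sqrt (2 * pi)"] allI impI)
      fix t :: real assume t: "0 \<le> t"
      have "(L2_norm (u t))\<^sup>2 \<le> 2 * pi * (1 / (1 + t) ^ 6)"
        by (rule L2_norm_le_coeffs[OF u_L2[OF t]]) (use u_coeff[OF t] a_L2[OF t] in simp)
      also have "\<dots> = (sqrt (2 * pi) * (1 / (1 + t) ^ 3))\<^sup>2"
        by (simp add: power_mult_distrib power_divide flip: power_mult)
      finally have "L2_norm (u t) \<le> sqrt (2 * pi) * (1 / (1 + t) ^ 3)"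
        by (rule power2_le_imp_le) (use t in auto)
      also have "1 / (1 + t) ^ 3 = (1 + t) powr (- 3)"
        using t powr_realpow[of "1 + t" 3] by (simp add: powr_minus_divide)
      \<comment> \<open>As 1 + t >= 1, the exponent -3 is stronger than the claimed -1.25.\<close>
      also have "sqrt (2 * pi) * (1 + t) powr (- 3) \<le> sqrt (2 * pi) * (1 + t) powr (- 1.25)"
        using t by (intro mult_left_mono powr_mono) auto
      finally show "L2_norm (u t) \<le> sqrt (2 * pi) * (1 + t) powr (- 1.25)" .
    qed
  qed
qed simp

end
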